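(* Let $n\ge 1$. The Frobenius characteristic of the $\mathfrak{S}_n$-module $\mathbb{C}\mathcal{T}^B_n$ spanned by Bernardi trees on $n$ nodes, graded by the number of right edges (with grading variable $q$), is $$G_n(\mathsf{x};1,0,q,0)=\sum_{T\in\mathcal{T}_n}q^{\mathrm{r}(T)}h_{\mathbf{c}(T)},$$ where $\mathcal{T}_n$ is the set of unlabeled plane binary trees on $n$ nodes, $\mathrm{r}(T)$ is the number of right edges of $T$, and $\mathbf{c}(T)$ is the composition type of $T$. Moreover, transporting the $\mathfrak{S}_n$-action (and grading) along Bernardi's bijection between $\mathcal{T}^B_n$ and the set of regions of the Linial arrangement $\mathcal{L}_n$ gives an $\mathfrak{S}_n$-action on the regions of $\mathcal{L}_n$ whose graded Frobenius characteristic is also $G_n(\mathsf{x};1,0,q,0)$.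
   Context: **Trees and $G_n$.** A (plane binary) tree is a rooted tree in which every node has at most one left child and at most one right child (it may have only one of the two), and no other children. An edge to a right child is a right edge. A labeled tree has nodes labeled with positive integers, repetitions allowed; $\mathcal{T}^{\ell}_n$ is the set of labeled trees on $n$ nodes. Write $v^\ell$ for the label of $v$. If $v$ is the left child of $w$, the edge is a left ascent if $v^\ell\le w^\ell$ and a left descent otherwise. If $w$ is the right child of $v$, the edge is a right ascent if $v^\ell\le w^\ell$ and a right descent otherwise. $\mathrm{lasc},\mathrm{ldes},\mathrm{rasc},\mathrm{rdes}$ count these edges. With $\mathsf{x}^T=\prod_{v\in T}x_{v^\ell}$, $$G_n(\mathsf{x};\bar\lambda,\lambda,\bar\rho,\rho)=\sum_{T\in\mathcal{T}^\ell_n}\bar\lambda^{\mathrm{lasc}(T)}\lambda^{\mathrm{ldes}(T)}\bar\rho^{\,\mathrm{rasc}(T)}\rho^{\,\mathrm{rdes}(T)}\,\mathsf{x}^T.$$ **Preorder and composition type.** Preorder here visits the root, then recursively the right subtree in preorder, then the left subtree in preorder. Let $v_1,\dots,v_n$ be the nodes of $T$ in preorder and let $v_{i_1},\dots,v_{i_k}$ with $i_1<\cdots<i_k=n$ be the terminal nodes (nodes with no children). Put $i_0=0$. The composition type is $\mathbf{c}(T)=(i_1-i_0,i_2-i_1,\dots,i_k-i_{k-1})\vDash n$. For a composition $\alpha$, $h_\alpha=\prod_jh_{\alpha_j}$ is a product of complete homogeneous symmetric functions. **Bernardi trees.** A Bernardi tree on $n$ nodes is a tree whose nodes are labeled bijectively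 by $[n]$ such that every internal (non-terminal) node has a label greater than that of its right child if it has a right child, and otherwise greater than that of its left child. $\mathcal{T}^B_n$ is the set of Bernardi trees on $n$ nodes. **Action.** For $T\in\mathcal{T}^B_n$, let $v_1,\dots,v_n$ be the nodes of $T$ listed in preorder (root, then right subtree, then left subtree), let $v_{i_1},\dots,v_{i_k}$ with $i_1<\cdots<i_k=n$ be the terminal nodes of $T$, and put $i_0=0$. The preorder word $v_1^\ell\cdots v_n^\ell$ factors as $W_1\cdots W_k$ with $W_j=v_{i_{j-1}+1}^\ell\cdots v_{i_j}^\ell$, each $W_j$ strictly decreasing. For $\sigma\in\mathfrak{S}_n$, let $\widetilde\sigma(W_j)$ be obtained by applying $\sigma$ to each letter of $W_j$ and sorting the result into decreasing order; $\sigma(T)$ is the labeled tree with the same underlying unlabeled tree as $T$ and preorder word $\widetilde\sigma(W_1)\cdots\widetilde\sigma(W_k)$. This is an action of $\mathfrak{S}_n$ on $\mathcal{T}^B_n$ preserving the number of right edges. $\mathbb{C}\mathcal{T}^B_n$ is the resulting permutation module, graded so that the degree-$k$ part is spanned by Bernardi trees with exactly $k$ right edges. The graded Frobenius characteristic is $\sum_kq^k\,\mathrm{Frob}(\text{degree-}k\text{ part})$. **Linial arrangement and Bernardi's bijection.** $\mathcal{L}_n$ consists of the hyperplanes $x_i-x_j=1$, $1\le i<j\le n$, in $\mathbb{R}^n$; regions are connected components of the complement of their union. Bernardi's (known) bijection sends $T\in\mathcal{T}^B_n$ to the region in which, for $i<j$, one has $x_i-x_j<1$ exactly when $\mathrm{drift}(i)\le\mathrm{drift}(j)$,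 or $\mathrm{drift}(i)=\mathrm{drift}(j)+1$ and $i$ precedes $j$ in preorder (nodes are identified with their labels), where $\mathrm{drift}(v)$ is the number of ancestors of $v$, including $v$ itself, that are right children. *)

theory Defs
  imports
    "HOL-Analysis.Analysis"
    "HOL-Library.Tree"
    "HOL-Library.Multiset"
    "HOL-Computational_Algebra.Polynomial"
    "HOL-Combinatorics.Orbits"
    "HOL-Algebra.Sym_Groups"
    "HOL-Algebra.Group_Action"
begin

section \<open>Plane binary trees\<close>

text \<open>
  A plane binary tree is an element of \<^typ>\<open>'a tree\<close>, where \<^const>\<open>Leaf\<close> stands for an absent
  child (or the empty tree) and the nodes are the \<^const>\<open>Node\<close> constructors. A node is
  identified with the subtree rooted at it. Unlabeled trees are trees over \<^typ>\<open>unit\<close>.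
\<close>

text \<open>The preorder used here visits the right subtree before the left one, unlike
  \<^const>\<open>preorder\<close> from the library.\<close>

fun nodes_preorder :: "'a tree \<Rightarrow> 'a tree list" where
  "nodes_preorder \<langle>\<rangle> = []"
| "nodes_preorder \<langle>l, a, r\<rangle> = \<langle>l, a, r\<rangle> # nodes_preorder r @ nodes_preorder l"

definition preorder_word :: "'a tree \<Rightarrow> 'a list" where
  "preorder_word T = map value (nodes_preorder T)"

definition terminal :: "'a tree \<Rightarrow> bool" where
  "terminal v \<longleftrightarrow> left v = \<langle>\<rangle> \<and> right v = \<langle>\<rangle>"

text \<open>The positions of the terminal nodes in preorder, counted from 1.\<close>

definition terminal_positions :: "'a tree \<Rightarrow> nat list" where
  "terminal_positions T =
     filter (\<lambda>i. terminal (nodes_preorder T ! (i - 1))) [1..<Suc (size T)]"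

definition composition_type :: "'a tree \<Rightarrow> nat list" where
  "composition_type T = map2 (-) (terminal_positions T) (0 # terminal_positions T)"

fun right_edges :: "'a tree \<Rightarrow> nat" where
  "right_edges \<langle>\<rangle> = 0"
| "right_edges \<langle>l, a, r\<rangle> = of_bool (r \<noteq> \<langle>\<rangle>) + right_edges l + right_edges r"

fun lasc :: "nat tree \<Rightarrow> nat" where
  "lasc \<langle>\<rangle> = 0"
| "lasc \<langle>l, a, r\<rangle> = of_bool (l \<noteq> \<langle>\<rangle> \<and> value l \<le> a) + lasc l + lasc r"

fun ldes :: "nat tree \<Rightarrow> nat" where
  "ldes \<langle>\<rangle> = 0"
| "ldes \<langle>l, a, r\<rangle> = of_bool (l \<noteq> \<langle>\<rangle> \<and> value l > a) + ldes l + ldes r"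

fun rasc :: "nat tree \<Rightarrow> nat" where
  "rasc \<langle>\<rangle> = 0"
| "rasc \<langle>l, a, r\<rangle> = of_bool (r \<noteq> \<langle>\<rangle> \<and> a \<le> value r) + rasc l + rasc r"

fun rdes :: "nat tree \<Rightarrow> nat" where
  "rdes \<langle>\<rangle> = 0"
| "rdes \<langle>l, a, r\<rangle> = of_bool (r \<noteq> \<langle>\<rangle> \<and> a > value r) + rdes l + rdes r"

definition unlabeled_trees :: "nat \<Rightarrow> unit tree set" where
  "unlabeled_trees n = {T. size T = n}"

definition labeled_trees :: "nat \<Rightarrow> nat tree set" where
  "labeled_trees n = {T. size T = n \<and> (\<forall>a\<in>set_tree T. 0 < a)}"

section \<open>Symmetric functions\<close>

text \<open>
  A formal power series in the variables \<open>x\<^sub>1, x\<^sub>2, \<dots>\<close> is given by its coefficients: the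
  multiset \<open>{#i\<^sub>1, \<dots>, i\<^sub>d#}\<close> stands for the monomial \<open>x\<^bsub>i\<^sub>1\<^esub> \<cdots> x\<^bsub>i\<^sub>d\<^esub>\<close>. There is no variable
  \<open>x\<^sub>0\<close>: all series below have coefficient 0 at multisets containing 0.
\<close>

type_synonym 'a series = "nat multiset \<Rightarrow> 'a"

definition one_series :: "'a::comm_semiring_1 series" where
  "one_series M = of_bool (M = {#})"

definition times_series :: "'a::comm_semiring_1 series \<Rightarrow> 'a series \<Rightarrow> 'a series" where
  "times_series f g M = (\<Sum>A | A \<subseteq># M. f A * g (M - A))"

definition prod_series :: "'a::comm_semiring_1 series list \<Rightarrow> 'a series" where
  "prod_series fs = foldr times_series fs one_series"

definition complete_homogeneous :: "nat \<Rightarrow> 'a::comm_semiring_1 series" where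
  "complete_homogeneous k M = of_bool (size M = k \<and> 0 \<notin># M)"

definition h_composition :: "nat list \<Rightarrow> 'a::comm_semiring_1 series" where
  "h_composition \<alpha> = prod_series (map complete_homogeneous \<alpha>)"

text \<open>The power sum \<open>p\<^sub>k\<close>, for \<open>k \<ge> 1\<close>.\<close>

definition power_sum :: "nat \<Rightarrow> 'a::comm_semiring_1 series" where
  "power_sum k M = of_bool (\<exists>i>0. M = replicate_mset k i)"

definition p_partition :: "nat multiset \<Rightarrow> 'a::comm_semiring_1 series" where
  "p_partition \<mu> = prod_series (map power_sum (sorted_list_of_multiset \<mu>))"

text \<open>The arguments after \<^term>\<open>n\<close> are the values of the parameters
  \<open>\<lambda>\<close>-bar, \<open>\<lambda>\<close>, \<open>\<rho>\<close>-bar, \<open>\<rho>\<close>, in this order.\<close>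

definition G_series ::
    "nat \<Rightarrow> 'a::comm_semiring_1 \<Rightarrow> 'a \<Rightarrow> 'a \<Rightarrow> 'a \<Rightarrow> 'a series" where
  "G_series n lb l rb r M =
     (\<Sum>T | T \<in> labeled_trees n \<and> mset (preorder_word T) = M.
        lb ^ lasc T * l ^ ldes T * rb ^ rasc T * r ^ rdes T)"

section \<open>Permutation modules and Frobenius characteristics\<close>

definition cycle_type :: "nat \<Rightarrow> (nat \<Rightarrow> nat) \<Rightarrow> nat multiset" where
  "cycle_type n \<sigma> = image_mset card (mset_set (Orbits.orbit \<sigma> ` {1..n}))"

text \<open>The Frobenius characteristic of an \<open>S\<^sub>n\<close>-module with character \<open>ch\<close>.\<close>

definition frobenius :: "nat \<Rightarrow> ((nat \<Rightarrow> nat) \<Rightarrow> complex) \<Rightarrow> complex series" where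
  "frobenius n ch M =
     (\<Sum>\<sigma>\<in>carrier (sym_group n). ch \<sigma> * p_partition (cycle_type n \<sigma>) M) / fact n"

text \<open>
  The elements of \<open>\<complex>X\<close>, for finite \<open>X\<close>, are functions \<^term>\<open>f :: 'x \<Rightarrow> complex\<close> supported on \<open>X\<close>;
  the basis vector \<open>x\<close> is \<^term>\<open>indicator {x} :: 'x \<Rightarrow> complex\<close>. The operator below is the linear
  map with \<open>x \<mapsto> \<phi> \<sigma> x\<close>, and the character is its trace with respect to the basis \<open>X\<close>.
\<close>

definition perm_module ::
    "'x set \<Rightarrow> ('g \<Rightarrow> 'x \<Rightarrow> 'x) \<Rightarrow> 'g \<Rightarrow> ('x \<Rightarrow> complex) \<Rightarrow> ('x \<Rightarrow> complex)" where
  "perm_module X \<phi> \<sigma> f = (\<lambda>y. \<Sum>x | x \<in> X \<and> \<phi> \<sigma> x = y. f x)"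

definition perm_character :: "'x set \<Rightarrow> ('g \<Rightarrow> 'x \<Rightarrow> 'x) \<Rightarrow> 'g \<Rightarrow> complex" where
  "perm_character X \<phi> \<sigma> = (\<Sum>x\<in>X. perm_module X \<phi> \<sigma> (indicator {x}) x)"

text \<open>An action of \<open>S\<^sub>n\<close> on \<open>X\<close> that preserves the statistic \<open>deg\<close>.\<close>

definition graded_action ::
    "nat \<Rightarrow> 'x set \<Rightarrow> ('x \<Rightarrow> nat) \<Rightarrow> ((nat \<Rightarrow> nat) \<Rightarrow> 'x \<Rightarrow> 'x) \<Rightarrow> bool" where
  "graded_action n X deg \<phi> \<longleftrightarrow>
     group_action (sym_group n) X \<phi> \<and>
     (\<forall>\<sigma>\<in>carrier (sym_group n). \<forall>x\<in>X. deg (\<phi> \<sigma> x) = deg x)"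

text \<open>The grading variable \<open>q\<close>.\<close>

definition qvar :: "complex poly" where
  "qvar = monom 1 1"

text \<open>The sum of \<open>q\<^sup>k\<close> times the Frobenius characteristic of the span of
  \<^term>\<open>{x\<in>X. deg x = k}\<close>, with coefficients in \<open>\<complex>[q]\<close>; all other degrees contribute 0.\<close>

definition graded_frobenius ::
    "nat \<Rightarrow> 'x set \<Rightarrow> ('x \<Rightarrow> nat) \<Rightarrow> ((nat \<Rightarrow> nat) \<Rightarrow> 'x \<Rightarrow> 'x) \<Rightarrow> complex poly series" where
  "graded_frobenius n X deg \<phi> M =
     (\<Sum>k\<in>deg ` X. monom (frobenius n (perm_character {x\<in>X. deg x = k} \<phi>) M) k)"

text \<open>Transport of an action on \<open>X\<close> along a map \<open>f\<close> that is injective on \<open>X\<close>.\<close>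

definition transport_action ::
    "'x set \<Rightarrow> ('x \<Rightarrow> 'y) \<Rightarrow> ('g \<Rightarrow> 'x \<Rightarrow> 'x) \<Rightarrow> 'g \<Rightarrow> 'y \<Rightarrow> 'y" where
  "transport_action X f \<phi> \<sigma> = (\<lambda>y\<in>f ` X. f (\<phi> \<sigma> (inv_into X f y)))"

definition transport_deg :: "'x set \<Rightarrow> ('x \<Rightarrow> 'y) \<Rightarrow> ('x \<Rightarrow> nat) \<Rightarrow> 'y \<Rightarrow> nat" where
  "transport_deg X f deg y = deg (inv_into X f y)"

section \<open>Bernardi trees\<close>

fun bernardi_decreasing :: "nat tree \<Rightarrow> bool" where
  "bernardi_decreasing \<langle>\<rangle> \<longleftrightarrow> True"
| "bernardi_decreasing \<langle>l, a, r\<rangle> \<longleftrightarrow>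
     (if r \<noteq> \<langle>\<rangle> then value r < a else l \<noteq> \<langle>\<rangle> \<longrightarrow> value l < a) \<and>
     bernardi_decreasing l \<and> bernardi_decreasing r"

definition bernardi_trees :: "nat \<Rightarrow> nat tree set" where
  "bernardi_trees n =
     {T. size T = n \<and> distinct (preorder_word T) \<and> set_tree T = {1..n} \<and> bernardi_decreasing T}"

fun factor_word :: "nat list \<Rightarrow> 'a list \<Rightarrow> 'a list list" where
  "factor_word [] w = []"
| "factor_word (c # cs) w = take c w # factor_word cs (drop c w)"

definition act_word :: "(nat \<Rightarrow> nat) \<Rightarrow> nat list \<Rightarrow> nat list" where
  "act_word \<sigma> W = rev (sort (map \<sigma> W))"

definition act_tree :: "(nat \<Rightarrow> nat) \<Rightarrow> nat tree \<Rightarrow> nat tree" where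
  "act_tree \<sigma> T = (THE T'. map_tree (\<lambda>_. ()) T' = map_tree (\<lambda>_. ()) T \<and>
     preorder_word T' =
       concat (map (act_word \<sigma>) (factor_word (composition_type T) (preorder_word T))))"

text \<open>Restricted because \<^const>\<open>BijGroup\<close> consists of extensional functions.\<close>

definition bernardi_action :: "nat \<Rightarrow> (nat \<Rightarrow> nat) \<Rightarrow> nat tree \<Rightarrow> nat tree" where
  "bernardi_action n \<sigma> = restrict (act_tree \<sigma>) (bernardi_trees n)"

section \<open>The Linial arrangement\<close>

text \<open>\<open>\<real>\<^sup>n\<close> with coordinates \<open>x 1, \<dots>, x n\<close>. The topology on it is inherited from the product
  topology on \<^typ>\<open>nat \<Rightarrow> real\<close>, hence is the usual one.\<close>

definition Rn :: "nat \<Rightarrow> (nat \<Rightarrow> real) set" where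
  "Rn n = {1..n} \<rightarrow>\<^sub>E UNIV"

definition linial_arrangement :: "nat \<Rightarrow> (nat \<Rightarrow> real) set set" where
  "linial_arrangement n = {{x \<in> Rn n. x i - x j = 1} | i j. 1 \<le> i \<and> i < j \<and> j \<le> n}"

definition linial_regions :: "nat \<Rightarrow> (nat \<Rightarrow> real) set set" where
  "linial_regions n = components (Rn n - \<Union>(linial_arrangement n))"

text \<open>
  For a tree with distinct labels, the number of ancestors of the node labeled \<open>i\<close>, including
  that node, that are right children. If the node lies in the right subtree of the root, the root
  of that subtree is one of them.
\<close>

fun drift :: "nat tree \<Rightarrow> nat \<Rightarrow> nat" where
  "drift \<langle>\<rangle> i = 0"
| "drift \<langle>l, a, r\<rangle> i =
     (if i = a then 0 else if i \<in> set_tree r then Suc (drift r i) else drift l i)"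

definition precedes :: "nat tree \<Rightarrow> nat \<Rightarrow> nat \<Rightarrow> bool" where
  "precedes T i j \<longleftrightarrow>
     (\<exists>a b. a < b \<and> b < size T \<and> preorder_word T ! a = i \<and> preorder_word T ! b = j)"

definition bernardi_region :: "nat \<Rightarrow> nat tree \<Rightarrow> (nat \<Rightarrow> real) set" where
  "bernardi_region n T =
     {x \<in> Rn n - \<Union>(linial_arrangement n). \<forall>i j. 1 \<le> i \<and> i < j \<and> j \<le> n \<longrightarrow>
        (x i - x j < 1 \<longleftrightarrow>
           drift T i \<le> drift T j \<or> drift T i = drift T j + 1 \<and> precedes T i j)}"

end

theory Submission
  imports Defs "HOL-Library.Multiset_Order" "HOL-Library.Poly_Mapping"
    "HOL-Computational_Algebra.Formal_Power_Series"
begin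

text \<open>
  Regions. A labeled tree is encoded by its preorder word together with the drifts. A Bernardi tree
  gives the point with \<open>x\<^sub>v = drift v + position v / n\<close>, which lies in its region. This is the lowest
  point of the region up to small perturbations: each node has either drift 0 or an earlier node
  whose inequality with it forces its drift. Hence the region determines the tree. Conversely, among
  all pairs (drift, position) with a prescribed sign vector, a minimal one comes from a Bernardi tree.

  Frobenius characteristic. The value of \<open>p\<^sub>\<mu>\<close> at a monomial counts the labelings of \<open>[n]\<close> by
  variables that are constant on the cycles of a permutation of type \<open>\<mu>\<close>. By Burnside's lemma, the
  coefficients of the characteristic count orbits of pairs of a Bernardi tree and such a labeling.
  These orbits correspond to the trees whose blocks are weakly decreasing.

  Generating functions. Let \<open>F\<close> be the generating function, including the empty tree, either of the
  trees without descents or of the trees with weakly decreasing blocks. Decomposing at the root, by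
  the root label, shows in both cases \<open>F (1 + q F - q) \<Prod>\<^sub>i (1 - x\<^sub>i (1 + q F)) = 1\<close>, and this equation
  has only one solution with constant term 1.
\<close>

section \<open>Encoding trees by preorder words and drifts\<close>

text \<open>Whether a difference of coordinates is below 1 depends only on their integer parts and,
  when these differ by exactly 1, on the order of the fractional parts. This is why regions reduce
  to pairs \<open>(d, p)\<close> of integer parts and a ranking. Trees without descents and trees
  with weakly decreasing blocks are not equinumerous shape by shape: with labels 1, 2, 3, a root
  with two children admits one labeling of the first kind and three of the second. Only the sums
  over all shapes with a given number of right edges agree, and this is what the generating
  functions are for. Their variable \<open>fps_X\<close> records the size and accompanies every
  label variable, so constant terms can be read off and two solutions compared. The coefficients are
  finitely supported polynomials, which form an integral domain; the labels are therefore first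
  confined to \<open>{1..m}\<close>, and for a fixed monomial a large enough \<open>m\<close> loses
  nothing.\<close>

lemma preorder_word_Leaf [simp]: "preorder_word \<langle>\<rangle> = []"
  and preorder_word_Node [simp]:
    "preorder_word \<langle>l, a, r\<rangle> = a # preorder_word r @ preorder_word l"
  by (simp_all add: preorder_word_def)

lemma length_preorder_word [simp]: "length (preorder_word T) = size T"
  by (induction T) auto

lemma set_preorder_word [simp]: "set (preorder_word T) = set_tree T"
  by (induction T) auto

text \<open>Pairs each label in preorder with its drift. Unlike \<open>drift\<close>, it makes sense
  for repeated labels, and it determines the tree.\<close>

fun drift_list :: "'a tree \<Rightarrow> (nat \<times> 'a) list" where
  "drift_list \<langle>\<rangle> = []"
| "drift_list \<langle>l, a, r\<rangle> = (0, a) # map (apfst Suc) (drift_list r) @ drift_list l"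

lemma map_snd_drift_list [simp]: "map snd (drift_list T) = preorder_word T"
  by (induction T) (auto simp: comp_def)

lemma length_drift_list [simp]: "length (drift_list T) = size T"
  by (metis length_map length_preorder_word map_snd_drift_list)

lemma drift_list_eq_Nil_iff [simp]: "drift_list T = [] \<longleftrightarrow> T = \<langle>\<rangle>"
  by (cases T) auto

lemma hd_drift_list: "T \<noteq> \<langle>\<rangle> \<Longrightarrow> hd (drift_list T) = (0, value T)"
  by (cases T) auto

lemma snd_drift_list_in_set_tree: "(d, v) \<in> set (drift_list T) \<Longrightarrow> v \<in> set_tree T"
  by (metis list.set_map map_snd_drift_list rev_image_eqI set_preorder_word snd_conv)

text \<open>\<open>drift\<close> finds a node by its label; distinct labels keep the search from
  entering the wrong subtree.\<close>

lemma drift_eqI: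
  "\<lbrakk>distinct (preorder_word T); (d, v) \<in> set (drift_list T)\<rbrakk> \<Longrightarrow> drift T v = d"
proof (induction T arbitrary: d)
  case (Node l a r)
  from Node.prems(2) consider "v = a" "d = 0"
    | d' where "d = Suc d'" "(d', v) \<in> set (drift_list r)"
    | "(d, v) \<in> set (drift_list l)"
    by auto
  then show ?case
  proof cases
    case 2
    have "drift r v = d'" using Node.IH(2) Node.prems(1) 2(2) by simp
    with Node.prems(1) 2(1) snd_drift_list_in_set_tree[OF 2(2)] show ?thesis by auto
  next
    case 3
    have "drift l v = d" using Node.IH(1) Node.prems(1) 3 by simp
    with Node.prems(1) snd_drift_list_in_set_tree[OF 3] show ?thesis by auto
  qed simp
qed simp

text \<open>The next node in preorder is either the right child, with drift one higher, or the left
  child of the current node or of an ancestor, whose drift is not higher.\<close>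

lemma successively_drift_list: "successively (\<lambda>(d, v) (e, w). e \<le> Suc d) (drift_list T)"
proof (induction T)
  case (Node l a r)
  have "l \<noteq> \<langle>\<rangle> \<Longrightarrow> fst (hd (drift_list l)) = 0"
    by (simp add: hd_drift_list)
  moreover have "r \<noteq> \<langle>\<rangle> \<Longrightarrow> fst (hd (drift_list r)) = 0"
    by (simp add: hd_drift_list)
  ultimately show ?case using Node
    apply (cases "r = \<langle>\<rangle>"; cases "l = \<langle>\<rangle>")
      apply (simp_all add: successively_append_iff successively_map successively_Cons case_prod_unfold hd_map)
    done
qed simp

text \<open>A step that does not lower the drift leads exactly to the child that the Bernardi
  condition compares: the right child if there is one (drift up by 1), otherwise the left child
  (same drift). Leaving a right subtree lowers the drift strictly, and no condition applies
  there.\<close>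

lemma bernardi_decreasing_iff_successively:
  "bernardi_decreasing T \<longleftrightarrow> successively (\<lambda>(d, v) (e, w). d \<le> e \<longrightarrow> w < v) (drift_list T)"
proof (induction T)
  case (Node l a r)
  have "r \<noteq> \<langle>\<rangle> \<Longrightarrow> fst (last (map (apfst Suc) (drift_list r))) > 0"
    by (simp add: last_map)
  then show ?case using Node
    apply (cases "r = \<langle>\<rangle>"; cases "l = \<langle>\<rangle>")
      apply (simp_all add: successively_append_iff successively_map successively_Cons case_prod_unfold
        hd_map hd_drift_list )
      apply auto
    done
qed simp

text \<open>Locates the boundary between the subtrees: the shifted drifts on the right are positive,
  while a nonempty left part starts with 0.\<close>

lemma takeWhile_drift_list:
  "takeWhile (\<lambda>x. 0 < fst x) (map (apfst Suc) (drift_list r) @ drift_list l) = map (apfst Suc) (drift_list r)"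
proof -
  have "takeWhile (\<lambda>x. 0 < fst x) (drift_list l) = []"
    by (cases l) auto
  then show ?thesis by (subst takeWhile_append2) auto
qed

lemma drift_list_inject: "drift_list T = drift_list T' \<longleftrightarrow> T = T'"
proof
  show "drift_list T = drift_list T' \<Longrightarrow> T = T'"
  proof (induction T arbitrary: T')
    case (Node l a r)
    then obtain l' a' r' where T': "T' = \<langle>l', a', r'\<rangle>"
      by (cases T') auto
    have eq: "map (apfst Suc) (drift_list r) @ drift_list l = map (apfst Suc) (drift_list r') @ drift_list l'"
      using Node.prems T' by simp
    then have *: "map (apfst Suc) (drift_list r) = map (apfst Suc) (drift_list r')"
      by (metis takeWhile_drift_list)
    have "inj (apfst Suc :: nat \<times> 'a \<Rightarrow> _)"
      by (auto simp: inj_def)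
    with * have "drift_list r = drift_list r'"
      by (simp add: inj_map_eq_map)
    with eq have "drift_list l = drift_list l'" by simp
    with \<open>drift_list r = drift_list r'\<close> Node T' show ?case by simp
  qed (auto dest: sym)
qed simp

text \<open>After the root, the maximal run of positive drifts, lowered by 1, encodes the right
  subtree, and the rest encodes the left one. The bound on increments makes the first positive drift
  equal to 1, so the lowered run starts with 0 again.\<close>

lemma ex_drift_list:
  assumes "successively (\<lambda>(d, v) (e, w). e \<le> Suc d) xs" and "xs \<noteq> [] \<Longrightarrow> fst (hd xs) = 0"
  shows "\<exists>T. drift_list T = xs"
  using assms
proof (induction "length xs" arbitrary: xs rule: less_induct)
  case less
  show ?case
  proof (cases xs)
    case (Cons x ys)
    obtain a where x: "x = (0, a)"
      using less.prems(2) Cons by (cases x) auto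
    define us where "us = takeWhile (\<lambda>x. 0 < fst x) ys"
    define vs where "vs = dropWhile (\<lambda>x. 0 < fst x) ys"
    have ys: "ys = us @ vs" by (simp add: us_def vs_def)
    have pos: "0 < fst u" if "u \<in> set us" for u
      using that unfolding us_def by (meson set_takeWhileD)
    have suc: "successively (\<lambda>(d, v) (e, w). e \<le> Suc d) us"
              "successively (\<lambda>(d, v) (e, w). e \<le> Suc d) vs"
      using less.prems(1) Cons ys by (auto simp: successively_append_iff successively_Cons)
    define us' where "us' = map (apfst (\<lambda>d. d - 1)) us"
    have us: "us = map (apfst Suc) us'"
      unfolding us'_def using pos by (auto simp: comp_def intro!: map_idI[symmetric])
    have "successively (\<lambda>(d, v) (e, w). e \<le> Suc d) us'"
      using suc(1) unfolding us by (simp add: successively_map case_prod_unfold)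
    moreover have "fst (hd us') = 0" if "us' \<noteq> []"
    proof -
      have "fst (hd us) \<le> Suc 0"
        using less.prems(1) Cons ys us that x
        by (simp add: successively_Cons case_prod_unfold)
      then show ?thesis using us that by (simp add: hd_map)
    qed
    ultimately obtain r where r: "drift_list r = us'"
      using less.hyps[of us'] Cons ys us by fastforce
    have "fst (hd vs) = 0" if "vs \<noteq> []"
      using that hd_dropWhile[of "\<lambda>x. 0 < fst x" ys] unfolding vs_def by auto
    then obtain l where l: "drift_list l = vs"
      using less.hyps[of vs] Cons ys suc(2) by fastforce
    have "drift_list \<langle>l, a, r\<rangle> = xs"
      using Cons x ys us l r by simp
    then show ?thesis by blast
  next
    case Nil
    then show ?thesis by (auto intro: exI[of _ "\<langle>\<rangle>"])
  qed
qed

text \<open>Here \<open>d v\<close> and \<open>p v\<close> stand for the drift of the node labeled \<open>v\<close> and for its position in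
  preorder, counted from 0.\<close>

definition bernardi_code :: "nat \<Rightarrow> (nat \<Rightarrow> nat) \<Rightarrow> (nat \<Rightarrow> nat) \<Rightarrow> bool" where
  "bernardi_code n d p \<longleftrightarrow> bij_betw p {1..n} {..<n} \<and>
     (\<forall>v\<in>{1..n}. p v = 0 \<longrightarrow> d v = 0) \<and>
     (\<forall>u\<in>{1..n}. \<forall>v\<in>{1..n}. p v = Suc (p u) \<longrightarrow> d v \<le> Suc (d u) \<and> (d u \<le> d v \<longrightarrow> v < u))"

lemma bernardi_tree_imp_code:
  assumes T: "T \<in> bernardi_trees n"
  obtains p where "bernardi_code n (drift T) p"
    "\<And>i j. i \<in> {1..n} \<Longrightarrow> j \<in> {1..n} \<Longrightarrow> precedes T i j \<longleftrightarrow> p i < p j"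
    "\<And>i. i < n \<Longrightarrow> p (preorder_word T ! i) = i"
proof -
  from T have n: "size T = n" and dist: "distinct (preorder_word T)"
    and set: "set_tree T = {1..n}" and dec: "bernardi_decreasing T"
    by (auto simp: bernardi_trees_def)
  let ?w = "preorder_word T"
  have bij: "bij_betw ((!) ?w) {..<n} {1..n}"
    using bij_betw_nth[OF dist, of "{..<n}" "{1..n}"] n set by simp
  define p where "p = inv_into {..<n} ((!) ?w)"
  have pw: "p (?w ! i) = i" if "i < n" for i
    using bij that unfolding p_def by (simp add: bij_betw_inv_into_left)
  have wp: "?w ! p v = v" "p v < n" if "v \<in> {1..n}" for v
    using bij_betw_inv_into_right[OF bij that] bij_betw_apply[OF bij_betw_inv_into[OF bij] that]
    unfolding p_def by simp_all
  have drift: "drift T (?w ! i) = fst (drift_list T ! i)" if "i < n" for i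
  proof (rule drift_eqI[OF dist])
    have "?w ! i = snd (drift_list T ! i)"
      using that n by (simp flip: map_snd_drift_list)
    then show "(fst (drift_list T ! i), ?w ! i) \<in> set (drift_list T)"
      using that n by simp
  qed
  have snd: "snd (drift_list T ! i) = ?w ! i" if "i < n" for i
    using that n by (simp flip: map_snd_drift_list)
  have "bernardi_code n (drift T) p"
    unfolding bernardi_code_def
  proof (intro conjI ballI impI)
    show "bij_betw p {1..n} {..<n}"
      unfolding p_def by (rule bij_betw_inv_into[OF bij])
  next
    fix v assume v: "v \<in> {1..n}" "p v = 0"
    then have "T \<noteq> \<langle>\<rangle>" using n by auto
    then have "fst (drift_list T ! 0) = 0"
      by (metis drift_list_eq_Nil_iff fst_conv hd_conv_nth hd_drift_list)
    then show "drift T v = 0"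
      using drift[of 0] wp[OF v(1)] v by simp
  next
    fix u v assume u: "u \<in> {1..n}" and v: "v \<in> {1..n}" and p: "p v = Suc (p u)"
    have lt: "Suc (p u) < n" using wp[OF v] p by simp
    have du: "drift T u = fst (drift_list T ! p u)" and dv: "drift T v = fst (drift_list T ! Suc (p u))"
      using drift wp[OF u] wp[OF v] p by metis+
    have su: "snd (drift_list T ! p u) = u" and sv: "snd (drift_list T ! Suc (p u)) = v"
      using snd wp[OF u] wp[OF v] p by metis+
    show "drift T v \<le> Suc (drift T u)"
      using successively_drift_list[of T] lt n du dv
      by (auto simp: successively_conv_nth case_prod_unfold)
    show "v < u" if "drift T u \<le> drift T v"
      using dec that lt n du dv su sv
      by (auto simp: bernardi_decreasing_iff_successively successively_conv_nth case_prod_unfold)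
  qed
  moreover have "precedes T i j \<longleftrightarrow> p i < p j" if "i \<in> {1..n}" "j \<in> {1..n}" for i j
  proof
    show "precedes T i j \<Longrightarrow> p i < p j"
      unfolding precedes_def using pw n by (auto dest: order.strict_trans)
    show "p i < p j \<Longrightarrow> precedes T i j"
      unfolding precedes_def using wp[OF that(1)] wp[OF that(2)] n
      by (intro exI[of _ "p i"] exI[of _ "p j"]) simp
  qed
  ultimately show ?thesis using pw that by blast
qed

lemma bernardi_tree_of_code:
  assumes code: "bernardi_code n d p"
  obtains T where "T \<in> bernardi_trees n" "\<And>v. v \<in> {1..n} \<Longrightarrow> drift T v = d v"
    "\<And>i j. i \<in> {1..n} \<Longrightarrow> j \<in> {1..n} \<Longrightarrow> precedes T i j \<longleftrightarrow> p i < p j"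
proof -
  have bij: "bij_betw p {1..n} {..<n}" using code by (simp add: bernardi_code_def)
  define v where "v = inv_into {1..n} p"
  have bijv: "bij_betw v {..<n} {1..n}" unfolding v_def by (rule bij_betw_inv_into[OF bij])
  have v: "v i \<in> {1..n}" "p (v i) = i" if "i < n" for i
    using that bijv bij by (auto simp: v_def bij_betw_inv_into_right dest: bij_betw_apply)
  have vp: "v (p i) = i" "p i < n" if "i \<in> {1..n}" for i
    using that bij by (auto simp: v_def bij_betw_inv_into_left dest: bij_betw_apply)
  define xs where "xs = map (\<lambda>i. (d (v i), v i)) [0..<n]"
  have nth: "d (v (Suc i)) \<le> Suc (d (v i)) \<and> (d (v i) \<le> d (v (Suc i)) \<longrightarrow> v (Suc i) < v i)"
    if "Suc i < n" for i
    using code v[of i] v[of "Suc i"] that unfolding bernardi_code_def by simp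
  have "\<exists>T. drift_list T = xs"
  proof (rule ex_drift_list)
    show "successively (\<lambda>(d, v) (e, w). e \<le> Suc d) xs"
      using nth by (auto simp: xs_def successively_conv_nth)
    show "fst (hd xs) = 0" if "xs \<noteq> []"
      using code v[of 0] that unfolding bernardi_code_def by (auto simp: xs_def hd_map)
  qed
  then obtain T where T: "drift_list T = xs" by blast
  have w: "preorder_word T = map v [0..<n]"
    using map_snd_drift_list[of T] T by (simp add: xs_def comp_def)
  have size: "size T = n" using w length_preorder_word by (metis length_map length_upt minus_nat.diff_0)
  have dist: "distinct (preorder_word T)"
    using bijv unfolding w by (simp add: distinct_map bij_betw_def lessThan_atLeast0)
  have "set_tree T = {1..n}"
    using bijv arg_cong[OF w, of set] by (simp add: bij_betw_def lessThan_atLeast0)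
  moreover have "bernardi_decreasing T"
    using nth unfolding bernardi_decreasing_iff_successively T
    by (auto simp: xs_def successively_conv_nth)
  ultimately have "T \<in> bernardi_trees n"
    using dist size by (simp add: bernardi_trees_def)
  moreover have "drift T i = d i" if i: "i \<in> {1..n}" for i
  proof (rule drift_eqI[OF dist])
    show "(d i, i) \<in> set (drift_list T)"
      unfolding T xs_def using vp[OF i] by (auto intro!: image_eqI[of _ _ "p i"])
  qed
  moreover have "precedes T i j \<longleftrightarrow> p i < p j" if "i \<in> {1..n}" "j \<in> {1..n}" for i j
  proof
    show "precedes T i j \<Longrightarrow> p i < p j"
      unfolding precedes_def w size using v(2) by auto
    show "p i < p j \<Longrightarrow> precedes T i j"
      unfolding precedes_def w size using vp[OF that(1)] vp[OF that(2)]
      by (intro exI[of _ "p i"] exI[of _ "p j"]) simp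
  qed
  ultimately show ?thesis using that by blast
qed

text \<open>Word and drifts together recover the drift list, because labels are distinct.\<close>

lemma bernardi_tree_eqI:
  assumes T: "T \<in> bernardi_trees n" and T': "T' \<in> bernardi_trees n"
    and word: "preorder_word T = preorder_word T'"
    and drift: "\<And>v. v \<in> {1..n} \<Longrightarrow> drift T v = drift T' v"
  shows "T = T'"
proof -
  have *: "drift_list S = map (\<lambda>v. (drift S v, v)) (preorder_word S)" if "S \<in> bernardi_trees n" for S
  proof -
    have "distinct (preorder_word S)" using that by (simp add: bernardi_trees_def)
    then have "map (\<lambda>x. (drift S (snd x), snd x)) (drift_list S) = drift_list S"
      by (intro map_idI) (auto dest: drift_eqI)
    then show ?thesis
      by (simp add: comp_def flip: map_snd_drift_list)
  qed
  have "set_tree T' = {1..n}" using T' by (simp add: bernardi_trees_def)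
  then have "drift_list T = drift_list T'"
    unfolding *[OF T] *[OF T'] word using drift by simp
  then show ?thesis by (simp add: drift_list_inject)
qed

section \<open>Sign vectors of drifts and positions\<close>

text \<open>For \<open>i < j\<close>, the side of the hyperplane on which the point with coordinates
  \<open>d v + p v / n\<close> lies: integer parts decide unless they differ by exactly 1, when the
  ranking \<open>p\<close> of the fractional parts does.\<close>

definition drift_sign :: "(nat \<Rightarrow> nat) \<Rightarrow> (nat \<Rightarrow> nat) \<Rightarrow> nat \<Rightarrow> nat \<Rightarrow> bool" where
  "drift_sign d p i j \<longleftrightarrow> d i \<le> d j \<or> d i = d j + 1 \<and> p i < p j"

text \<open>The label \<open>w\<close> ties \<open>v\<close> to an earlier node by a sign. In the
  first case the sign of \<open>(w, v)\<close> is true and forces the drift of \<open>v\<close> to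
  be at least that of \<open>w\<close> minus 1; in the second the sign of \<open>(v, w)\<close> is
  false and forces it to be at least that of \<open>w\<close> plus 1. Both bounds are attained by
  \<open>d\<close>. Such a \<open>w\<close> is found by walking from \<open>u\<close> to
  \<open>v\<close>: the drift rises by at most 1 per step, and the label drops whenever the drift
  does not.\<close>

lemma bernardi_code_witness:
  assumes code: "bernardi_code n d p" and v: "v \<in> {1..n}"
    and "u \<in> {1..n}" "p u < p v" "d u \<le> d v"
  shows "(\<exists>w\<in>{1..n}. p u \<le> p w \<and> p w < p v \<and> (d w = Suc (d v) \<and> w < v \<or> d v = Suc (d w) \<and> v < w)) \<or>
    d u = d v \<and> v < u"
  using assms(3-)
proof (induction "p v - p u" arbitrary: u rule: less_induct)
  case less
  have bij: "bij_betw p {1..n} {..<n}" using code by (simp add: bernardi_code_def)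
  have "Suc (p u) \<in> {..<n}"
    using less.prems(2) bij_betw_apply[OF bij v] by simp
  then obtain t where t: "t \<in> {1..n}" "p t = Suc (p u)"
    using bij unfolding bij_betw_def by (metis imageE)
  have step: "d t \<le> Suc (d u)" "d u \<le> d t \<Longrightarrow> t < u"
    using code less.prems(1) t unfolding bernardi_code_def by auto
  show ?case
  proof (cases "t = v")
    case True
    with step less.prems(3) have *: "d v = d u \<or> d v = Suc (d u)" "v < u" by auto
    show ?thesis
    proof (cases "d v = d u")
      case False
      with * less.prems show ?thesis by (intro disjI1 bexI[of _ u]) simp_all
    qed (use * in simp)
  next
    case False
    then have "p t \<noteq> p v"
      using inj_on_eq_iff[OF bij_betw_imp_inj_on[OF bij] t(1) v] by simp
    with less.prems(2) t have lt: "p t < p v" by simp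
    show ?thesis
    proof (cases "d t \<le> d v")
      case True
      have "(\<exists>w\<in>{1..n}. p t \<le> p w \<and> p w < p v \<and> (d w = Suc (d v) \<and> w < v \<or> d v = Suc (d w) \<and> v < w)) \<or>
          d t = d v \<and> v < t"
        using less.hyps[of t] lt t True by simp
      then show ?thesis
      proof
        assume "d t = d v \<and> v < t"
        with step less.prems(3) have *: "d u = d v \<or> d v = Suc (d u)" "v < u" by auto
        show ?thesis
        proof (cases "d v = d u")
          case False
          with * less.prems show ?thesis by (intro disjI1 bexI[of _ u]) simp_all
        qed (use * in simp)
      next
        assume "\<exists>w\<in>{1..n}. p t \<le> p w \<and> p w < p v \<and> (d w = Suc (d v) \<and> w < v \<or> d v = Suc (d w) \<and> v < w)"
        then obtain w where "w \<in> {1..n}" "p t \<le> p w" "p w < p v"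
          "d w = Suc (d v) \<and> w < v \<or> d v = Suc (d w) \<and> v < w" by blast
        with t show ?thesis by (intro disjI1 bexI[of _ w]) simp_all
      qed
    next
      case False
      \<comment> \<open>The drift exceeds that of \<open>v\<close> right after \<open>u\<close>.
        Either \<open>t < v\<close> and \<open>t\<close> is itself a witness, or
        \<open>v \<le> t < u\<close>.\<close>
      with step less.prems(3) have *: "d u = d v" "d t = Suc (d v)" "t < u" by auto
      show ?thesis
      proof (cases "t < v")
        case True
        then show ?thesis using * t lt by (intro disjI1 bexI[of _ t]) simp_all
      next
        case False
        then show ?thesis using * by simp
      qed
    qed
  qed
qed

text \<open>Codes have the least drifts among all pairs with the same signs. By induction along the
  preorder, a node of positive drift has an earlier witness, and the common sign carries the bound
  from the witness to the node.\<close>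

lemma bernardi_code_drift_le:
  assumes code: "bernardi_code n d p"
    and sign: "\<And>i j. \<lbrakk>1 \<le> i; i < j; j \<le> n; drift_sign d p i j\<rbrakk> \<Longrightarrow> drift_sign d' p' i j"
    and sign': "\<And>i j. \<lbrakk>1 \<le> i; i < j; j \<le> n; drift_sign d' p' i j\<rbrakk> \<Longrightarrow> drift_sign d p i j"
    and v: "v \<in> {1..n}"
  shows "d v \<le> d' v"
  using v
proof (induction "p v" arbitrary: v rule: less_induct)
  case less
  have bij: "bij_betw p {1..n} {..<n}" using code by (simp add: bernardi_code_def)
  have "0 \<in> {..<n}" using less.prems by simp
  then obtain u where u: "u \<in> {1..n}" "p u = 0"
    using bij unfolding bij_betw_def by (metis imageE)
  then have du: "d u = 0" using code by (simp add: bernardi_code_def)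
  show ?case
  proof (cases "p v = 0")
    case True
    then show ?thesis using code less.prems by (simp add: bernardi_code_def)
  next
    case False
    \<comment> \<open>Since \<open>d u = 0\<close>, the alternative without a witness means
      \<open>d v = 0\<close>.\<close>
    with bernardi_code_witness[OF code less.prems u(1)] u du consider "d v = 0"
      | w where "w \<in> {1..n}" "p w < p v" "d w = Suc (d v)" "w < v"
      | w where "w \<in> {1..n}" "p w < p v" "d v = Suc (d w)" "v < w"
      by auto
    then show ?thesis
    proof cases
      case 2
      then have "drift_sign d' p' w v"
        using less.prems by (intro sign) (auto simp: drift_sign_def)
      then show ?thesis
        using less.hyps[OF 2(2,1)] 2 by (auto simp: drift_sign_def)
    next
      case 3
      then have "\<not> drift_sign d' p' v w"
        using less.prems sign'[of v w] by (auto simp: drift_sign_def)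
      then show ?thesis
        using less.hyps[OF 3(2,1)] 3 by (auto simp: drift_sign_def)
    qed simp
  qed
qed

text \<open>\<open>k\<close> is the first position at which the two rankings differ, and
  \<open>order\<close> rules out the alternative without a witness. The witness \<open>w\<close>
  comes at or after \<open>k\<close> in \<open>p\<close>, but its sign with \<open>b\<close> forces
  it before \<open>b\<close> in \<open>p'\<close>, that is, before \<open>k\<close>, where the
  rankings agree.\<close>

lemma bernardi_code_first_difference:
  assumes code: "bernardi_code n d p"
    and bij': "bij_betw p' {1..n} {..<n}"
    and sign: "\<And>i j. \<lbrakk>1 \<le> i; i < j; j \<le> n\<rbrakk> \<Longrightarrow> drift_sign d p i j \<longleftrightarrow> drift_sign d p' i j"
    and before: "\<And>x. x \<in> {1..n} \<Longrightarrow> p' x < k \<Longrightarrow> p x = p' x"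
    and a: "a \<in> {1..n}" "p a = k" and b: "b \<in> {1..n}" "p' b = k" "k < p b"
    and order: "d a < d b \<or> d a = d b \<and> a < b"
  shows False
proof -
  from bernardi_code_witness[OF code b(1) a(1)] a b order
  consider w where "w \<in> {1..n}" "k \<le> p w" "p w < p b" "d w = Suc (d b)" "w < b"
      | w where "w \<in> {1..n}" "k \<le> p w" "p w < p b" "d b = Suc (d w)" "b < w"
    by auto
  then show False
  proof cases
    case 1
    then have "drift_sign d p' w b"
      using b by (subst sign[symmetric]) (auto simp: drift_sign_def)
    then show False
      using 1 b before[of w] by (auto simp: drift_sign_def)
  next
    case 2
    have "\<not> drift_sign d p b w" using 2 by (auto simp: drift_sign_def)
    then have "\<not> drift_sign d p' b w" using 2 b sign[of b w] by auto
    then have "p' w \<le> k" using 2 b by (auto simp: drift_sign_def)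
    moreover have "p' w \<noteq> k"
      using inj_on_eq_iff[OF bij_betw_imp_inj_on[OF bij'], of w b] 2 b by simp
    ultimately show False using 2 before[of w] by auto
  qed
qed

lemma bernardi_code_unique:
  assumes code: "bernardi_code n d p" and code': "bernardi_code n d' p'"
    and sign: "\<And>i j. \<lbrakk>1 \<le> i; i < j; j \<le> n\<rbrakk> \<Longrightarrow> drift_sign d p i j \<longleftrightarrow> drift_sign d' p' i j"
    and v: "v \<in> {1..n}"
  shows "d v = d' v" "p v = p' v"
proof -
  have d: "d x = d' x" if "x \<in> {1..n}" for x
  proof (rule le_antisym)
    show "d x \<le> d' x"
      by (rule bernardi_code_drift_le[OF code _ _ that]) (use sign in auto)
    show "d' x \<le> d x"
      by (rule bernardi_code_drift_le[OF code' _ _ that]) (use sign in auto)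
  qed
  then show "d v = d' v" using v .
  have bij: "bij_betw p {1..n} {..<n}" and bij': "bij_betw p' {1..n} {..<n}"
    using code code' by (simp_all add: bernardi_code_def)
  have inj: "p x = p y \<longleftrightarrow> x = y" "p' x = p' y \<longleftrightarrow> x = y" if "x \<in> {1..n}" "y \<in> {1..n}" for x y
    using that by (simp_all add: inj_on_eq_iff[OF bij_betw_imp_inj_on[OF bij]]
        inj_on_eq_iff[OF bij_betw_imp_inj_on[OF bij']])
  have code2: "bernardi_code n d p'"
    using code' d unfolding bernardi_code_def by simp
  have sign2: "drift_sign d p i j \<longleftrightarrow> drift_sign d p' i j" if "1 \<le> i" "i < j" "j \<le> n" for i j
    using sign[OF that] d[of i] d[of j] that by (simp add: drift_sign_def)
  have "\<forall>x\<in>{1..n}. p x = k \<longleftrightarrow> p' x = k" for k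
  proof (induction k rule: less_induct)
    case (less k)
    show ?case
    proof (cases "k < n")
      case True
      then have "k \<in> p ` {1..n}" "k \<in> p' ` {1..n}"
        using bij bij' by (simp_all add: bij_betw_imp_surj_on)
      then obtain a b where a: "a \<in> {1..n}" "p a = k" and b: "b \<in> {1..n}" "p' b = k"
        by (elim imageE) simp
      have "a = b"
      proof (rule ccontr)
        assume "a \<noteq> b"
        then have ne: "p b \<noteq> k" "p' a \<noteq> k"
          using a b inj by blast+
        have "\<not> p b < k" using less.IH[of "p b"] b by force
        moreover have "\<not> p' a < k" using less.IH[of "p' a"] a by force
        ultimately have lt: "k < p b" "k < p' a" using ne by simp_all
        have before: "p x = p' x" if "x \<in> {1..n}" "p x < k \<or> p' x < k" for x
          using that(2)
        proof
          assume "p x < k"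
          from bspec[OF less.IH[OF this] that(1)] show ?thesis by simp
        next
          assume "p' x < k"
          from bspec[OF less.IH[OF this] that(1)] show ?thesis by simp
        qed
        \<comment> \<open>The lexicographic order of drift and label decides which of the two
          rankings supplies the witness; the cases are symmetric.\<close>
        consider "d a < d b \<or> d a = d b \<and> a < b" | "d b < d a \<or> d b = d a \<and> b < a"
          using \<open>a \<noteq> b\<close> by linarith
        then show False
        proof cases
          case 1
          show False
            by (rule bernardi_code_first_difference[OF code bij' sign2 before[OF _ disjI2] a b lt(1) 1])
        next
          case 2
          show False
            by (rule bernardi_code_first_difference[OF code2 bij sign2[symmetric]
                  before[OF _ disjI1, symmetric] b a lt(2) 2])
        qed
      qed
      then show ?thesis
        using a b inj by blast
    next
      case False
      then show ?thesis
        using bij_betw_apply[OF bij] bij_betw_apply[OF bij'] by (metis lessThan_iff)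
    qed
  qed
  then show "p v = p' v" using v by blast
qed

lemma bij_betw_predecessor_cyclic:
  "bij_betw (\<lambda>i. if i = 0 then n - 1 else i - 1) {..<n} {..<n::nat}"
  by (rule bij_betw_byWitness[where f' = "\<lambda>i. if i = n - 1 then 0 else Suc i"]) auto

text \<open>Three moves preserve the signs: moving the first label to the end while lowering its drift,
  and exchanging two labels in adjacent positions that violate the drift or the label condition.
  Each of them decreases the measure.\<close>

lemma ex_bernardi_code:
  assumes "bij_betw p {1..n} {..<n}"
    and "\<And>i j. \<lbrakk>1 \<le> i; i < j; j \<le> n\<rbrakk> \<Longrightarrow> drift_sign d p i j \<longleftrightarrow> R i j"
  obtains d' p' where "bernardi_code n d' p'"
    "\<And>i j. \<lbrakk>1 \<le> i; i < j; j \<le> n\<rbrakk> \<Longrightarrow> drift_sign d' p' i j \<longleftrightarrow> R i j"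
proof -
  let ?m = "measures [\<lambda>(d, p). \<Sum>v = 1..n. d v, \<lambda>(d, p). \<Sum>v = 1..n. p v * d v, \<lambda>(d, p). \<Sum>v = 1..n. p v * v]"
  have "\<exists>d' p'. bernardi_code n d' p' \<and> (\<forall>i j. 1 \<le> i \<longrightarrow> i < j \<longrightarrow> j \<le> n \<longrightarrow> drift_sign d' p' i j = R i j)"
    using assms
  proof (induction "(d, p)" arbitrary: d p rule: wf_induct_rule[OF wf_measures[of "[\<lambda>(d, p). \<Sum>v = 1..n. d v, \<lambda>(d, p). \<Sum>v = 1..n. p v * d v, \<lambda>(d, p). \<Sum>v = 1..n. p v * v]"]])
    case (1 d p)
    note bij = \<open>bij_betw p {1..n} {..<n}\<close>
    have inj: "p x = p y \<longleftrightarrow> x = y" if "x \<in> {1..n}" "y \<in> {1..n}" for x y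
      using that by (simp add: inj_on_eq_iff[OF bij_betw_imp_inj_on[OF bij]])
    have pn: "p x < n" if "x \<in> {1..n}" for x using bij_betw_apply[OF bij that] by simp
    show ?case
    proof (cases "bernardi_code n d p")
      case True
      with "1.prems" show ?thesis by blast
    next
      case False
      then consider v where "v \<in> {1..n}" "p v = 0" "0 < d v"
        | u v where "u \<in> {1..n}" "v \<in> {1..n}" "p v = Suc (p u)"
            "Suc (d u) < d v \<or> d u \<le> d v \<and> u < v"
        unfolding bernardi_code_def using bij
        by (metis n_not_Suc_n nat_neq_iff neq0_conv not_le_imp_less)
      then show ?thesis
      proof cases
        case 1
        \<comment> \<open>All values \<open>d x + p x / n\<close> drop by \<open>1 / n\<close>: the
          first label passes from fractional part 0 to \<open>(n - 1) / n\<close> while its integer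
          part drops by 1. Differences, and hence signs, are unchanged.\<close>
        define d' where "d' = d(v := d v - 1)"
        define p' where "p' x = (if p x = 0 then n - 1 else p x - 1)" for x
        have p0: "p x = 0 \<longleftrightarrow> x = v" if "x \<in> {1..n}" for x
          using inj[OF that 1(1)] 1(2) by simp
        have "bij_betw p' {1..n} {..<n}"
        proof -
          have "p' = (\<lambda>i. if i = 0 then n - 1 else i - 1) \<circ> p" by (auto simp: p'_def)
          then show ?thesis using bij_betw_trans[OF bij bij_betw_predecessor_cyclic] by simp
        qed
        moreover have "drift_sign d' p' i j \<longleftrightarrow> R i j" if ij: "1 \<le> i" "i < j" "j \<le> n" for i j
        proof -
          have "drift_sign d' p' i j \<longleftrightarrow> drift_sign d p i j"
            using p0[of i] p0[of j] pn[of i] pn[of j] inj[of i j] 1 ij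
            by (auto simp: drift_sign_def d'_def p'_def)
          with "1.prems"(2)[OF ij] show ?thesis by simp
        qed
        moreover have "(\<Sum>x = 1..n. d' x) < (\<Sum>x = 1..n. d x)"
          by (rule sum_strict_mono_ex1) (use 1 in \<open>auto simp: d'_def\<close>)
        ultimately show ?thesis
          using "1.hyps"[of d' p'] by simp
      next
        case 2
        define p' where "p' x = Transposition.transpose (p u) (p v) (p x)" for x
        have p': "p' u = p v" "p' v = p u" by (simp_all add: p'_def)
        have p'_other: "p' x = p x" if "x \<in> {1..n}" "x \<noteq> u" "x \<noteq> v" for x
          using inj[OF that(1) 2(1)] inj[OF that(1) 2(2)] that
          by (simp add: p'_def Transposition.transpose_def)
        have "bij_betw p' {1..n} {..<n}"
        proof -
          have "bij_betw (Transposition.transpose (p u) (p v)) {..<n} {..<n}"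
            using pn[OF 2(1)] pn[OF 2(2)] by (intro permutes_imp_bij permutes_swap_id) simp_all
          moreover have "p' = Transposition.transpose (p u) (p v) \<circ> p" by (auto simp: p'_def)
          ultimately show ?thesis using bij_betw_trans[OF bij] by simp
        qed
        moreover have "drift_sign d p' i j \<longleftrightarrow> R i j" if ij: "1 \<le> i" "i < j" "j \<le> n" for i j
        proof -
          have i: "i \<in> {1..n}" and j: "j \<in> {1..n}" using ij by auto
          have ne: "p x \<noteq> p u \<and> p x \<noteq> Suc (p u)" if "x \<in> {1..n}" "x \<noteq> u" "x \<noteq> v" for x
            using inj[OF that(1) 2(1)] inj[OF that(1) 2(2)] that 2(3) by simp
          have *: "p' i < p' j \<longleftrightarrow> p i < p j" if "\<not> (i = u \<and> j = v)" "\<not> (i = v \<and> j = u)"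
          proof (cases "i = u \<or> i = v")
            case True
            with that ij have "j \<noteq> u" "j \<noteq> v" by auto
            with p'_other[OF j] ne[OF j] p' True 2(3) show ?thesis by auto
          next
            case i': False
            show ?thesis
            proof (cases "j = u \<or> j = v")
              case True
              with i' p'_other[OF i] ne[OF i] p' 2(3) show ?thesis by auto
            next
              case False
              with i' p'_other[OF i] p'_other[OF j] show ?thesis by simp
            qed
          qed
          \<comment> \<open>Only the order of \<open>u\<close> and \<open>v\<close> changes, and
            their sign does not look at positions: either their drifts differ by at least 2, or the
            smaller label has drift at most that of the larger one.\<close>
          have "drift_sign d p' i j \<longleftrightarrow> drift_sign d p i j"
          proof (cases "i = u \<and> j = v \<or> i = v \<and> j = u")
            case True
            with 2(4) ij(2) show ?thesis by (auto simp: drift_sign_def)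
          next
            case False
            with * show ?thesis by (auto simp: drift_sign_def)
          qed
          with "1.prems"(2)[OF ij] show ?thesis by simp
        qed
        moreover have "((d, p'), (d, p)) \<in> ?m"
        proof -
          have split: "(\<Sum>x = 1..n. g x * f x) = g u * f u + g v * f v + (\<Sum>x\<in>{1..n} - {u, v}. g x * f x)"
            for f g :: "nat \<Rightarrow> nat"
          proof -
            have "u \<noteq> v" using 2 by auto
            have "{1..n} = insert u (insert v ({1..n} - {u, v}))" using 2 by auto
            then have "(\<Sum>x = 1..n. g x * f x) = (\<Sum>x\<in>insert u (insert v ({1..n} - {u, v})). g x * f x)"
              by simp
            with \<open>u \<noteq> v\<close> show ?thesis by simp
          qed
          have "(\<Sum>x\<in>{1..n} - {u, v}. p' x * f x) = (\<Sum>x\<in>{1..n} - {u, v}. p x * f x)" for f :: "nat \<Rightarrow> nat"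
            using p'_other by (intro sum.cong) auto
          \<comment> \<open>The weighted sum changes by \<open>f u - f v\<close>. For
            \<open>f = d\<close> this is negative unless the drifts are equal; then
            \<open>u < v\<close>, and the sum weighted by labels drops instead.\<close>
          then have *: "(\<Sum>x = 1..n. p' x * f x) + f v = (\<Sum>x = 1..n. p x * f x) + f u" for f
            unfolding split using p' 2(3) by simp
          show ?thesis
            using *[of d] *[of "\<lambda>x. x"] 2(4) by auto
        qed
        ultimately show ?thesis
          using "1.hyps"[of d p'] by blast
      qed
    qed
  qed
  with that show ?thesis by blast
qed

section \<open>Regions of the Linial arrangement\<close>

text \<open>For arbitrary \<open>R\<close> the cell may be empty; the nonempty cells are the
  regions.\<close>

definition linial_cell :: "nat \<Rightarrow> (nat \<Rightarrow> nat \<Rightarrow> bool) \<Rightarrow> (nat \<Rightarrow> real) set" where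
  "linial_cell n R = {x \<in> Rn n - \<Union>(linial_arrangement n).
     \<forall>i j. 1 \<le> i \<and> i < j \<and> j \<le> n \<longrightarrow> (x i - x j < 1 \<longleftrightarrow> R i j)}"

lemma linial_complement_iff:
  "x \<in> Rn n - \<Union>(linial_arrangement n) \<longleftrightarrow>
     x \<in> Rn n \<and> (\<forall>i j. 1 \<le> i \<and> i < j \<and> j \<le> n \<longrightarrow> x i - x j \<noteq> 1)"
  by (auto simp: linial_arrangement_def)

lemma linial_cell_iff:
  "x \<in> linial_cell n R \<longleftrightarrow> x \<in> Rn n \<and> (\<forall>i j. 1 \<le> i \<and> i < j \<and> j \<le> n \<longrightarrow>
     (if R i j then x i - x j < 1 else 1 < x i - x j))"
proof -
  have "(if R i j then x i - x j < 1 else 1 < x i - x j) \<longleftrightarrow>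
      x i - x j \<noteq> 1 \<and> (x i - x j < 1 \<longleftrightarrow> R i j)" for i j
    by auto
  then show ?thesis
    unfolding linial_cell_def mem_Collect_eq linial_complement_iff by blast
qed

lemma linial_cell_eqI:
  assumes "\<And>i j. 1 \<le> i \<Longrightarrow> i < j \<Longrightarrow> j \<le> n \<Longrightarrow> R i j \<longleftrightarrow> R' i j"
  shows "linial_cell n R = linial_cell n R'"
  using assms unfolding linial_cell_def by auto

text \<open>A cell is cut out by strict linear inequalities, so it contains the segment between any
  two of its points.\<close>

lemma connected_linial_cell: "connected (linial_cell n R)"
proof -
  have "connected_component (linial_cell n R) x y"
    if x: "x \<in> linial_cell n R" and y: "y \<in> linial_cell n R" for x y
  proof -
    define \<gamma> where "\<gamma> t i = (1 - t) * x i + t * y i" for t :: real and i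
    have "continuous_on {0..1} \<gamma>"
      unfolding \<gamma>_def by (intro continuous_on_coordinatewise_then_product continuous_intros)
    then have "connected (\<gamma> ` {0..1})"
      by (rule connected_continuous_image) simp
    moreover have "\<gamma> t \<in> linial_cell n R" if t: "t \<in> {0..1}" for t
      unfolding linial_cell_iff
    proof (intro conjI allI impI)
      have undef: "z i = undefined" if "z \<in> linial_cell n R" "i \<notin> {1..n}" for z i
        using that PiE_arb[of z "{1..n}" "\<lambda>_. UNIV" i] by (simp add: linial_cell_iff Rn_def)
      \<comment> \<open>Outside \<open>{1..n}\<close> both end points take the value
        \<open>undefined\<close>, which an affine combination keeps, so the segment stays in
        \<open>Rn n\<close>.\<close>
      have "\<gamma> t i = undefined" if "i \<notin> {1..n}" for i
        unfolding \<gamma>_def undef[OF x that] undef[OF y that] by (simp add: algebra_simps)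
      then show "\<gamma> t \<in> Rn n" unfolding Rn_def by auto
      fix i j assume ij: "1 \<le> i \<and> i < j \<and> j \<le> n"
      have *: "\<gamma> t i - \<gamma> t j = (1 - t) * (x i - x j) + t * (y i - y j)"
        by (simp add: \<gamma>_def algebra_simps)
      have **: "if R i j then x i - x j < 1 else 1 < x i - x j"
          "if R i j then y i - y j < 1 else 1 < y i - y j"
        using x y ij by (simp_all add: linial_cell_iff)
      show "if R i j then \<gamma> t i - \<gamma> t j < 1 else 1 < \<gamma> t i - \<gamma> t j"
      proof (cases "R i j")
        case True
        with ** have "x i - x j < 1" "y i - y j < 1" by simp_all
        then have "(1 - t) * (x i - x j) + t * (y i - y j) < 1"
          using t by (intro convex_bound_lt) auto
        with True * show ?thesis by simp
      next
        case False
        with ** have "- (x i - x j) < - 1" "- (y i - y j) < - 1" by simp_all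
        then have "(1 - t) * (- (x i - x j)) + t * (- (y i - y j)) < - 1"
          using t by (intro convex_bound_lt) auto
        with False * show ?thesis by (simp add: algebra_simps)
      qed
    qed
    moreover have "\<gamma> 0 = x" "\<gamma> 1 = y" by (auto simp: \<gamma>_def)
    ultimately show ?thesis
      unfolding connected_component_def by (intro exI[of _ "\<gamma> ` {0..1}"]) force
  qed
  then show ?thesis by (simp add: connected_iff_connected_component)
qed

text \<open>On a connected subset of the complement, the continuous function
  \<open>x i - x j\<close> avoids the value 1 and so stays on one side of it. Conversely, the cell
  of \<open>x\<close> is connected and contains \<open>x\<close>.\<close>

lemma connected_component_linial:
  assumes x: "x \<in> Rn n - \<Union>(linial_arrangement n)"
  shows "connected_component_set (Rn n - \<Union>(linial_arrangement n)) x = linial_cell n (\<lambda>i j. x i - x j < 1)"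
    (is "?C = ?D")
proof
  show "?D \<subseteq> ?C"
    using x by (intro connected_component_maximal connected_linial_cell) (auto simp: linial_cell_def)
  show "?C \<subseteq> ?D"
  proof
    fix z assume z: "z \<in> ?C"
    have sub: "?C \<subseteq> Rn n - \<Union>(linial_arrangement n)" by (rule connected_component_subset)
    have "x i - x j < 1 \<longleftrightarrow> z i - z j < 1" if ij: "1 \<le> i \<and> i < j \<and> j \<le> n" for i j
    proof -
      let ?f = "\<lambda>w::nat \<Rightarrow> real. w i - w j"
      have "continuous_on ?C ?f"
        by (intro continuous_intros continuous_on_subset[OF continuous_on_product_coordinates]) simp_all
      then have "connected (?f ` ?C)"
        using connected_connected_component by (rule connected_continuous_image)
      moreover have "?f x \<in> ?f ` ?C" "?f z \<in> ?f ` ?C"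
        using x z by (auto simp: connected_component_refl)
      moreover have "1 \<notin> ?f ` ?C"
        using sub ij unfolding linial_complement_iff subset_iff by fastforce
      ultimately show ?thesis
        using connectedD_interval[of "?f ` ?C" "?f x" "?f z" 1]
          connectedD_interval[of "?f ` ?C" "?f z" "?f x" 1] by fastforce
    qed
    with z sub show "z \<in> ?D" unfolding linial_cell_def by blast
  qed
qed

lemma linial_regions_eq:
  "linial_regions n =
     (\<lambda>x. linial_cell n (\<lambda>i j. x i - x j < 1)) ` (Rn n - \<Union>(linial_arrangement n))"
  unfolding linial_regions_def components_def
  by (intro image_cong refl connected_component_linial)

lemma linial_cell_in_regions:
  assumes "x \<in> linial_cell n R"
  shows "linial_cell n R \<in> linial_regions n"
proof -
  from assms have x: "x \<in> Rn n - \<Union>(linial_arrangement n)"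
    and R: "\<And>i j. 1 \<le> i \<Longrightarrow> i < j \<Longrightarrow> j \<le> n \<Longrightarrow> R i j \<longleftrightarrow> x i - x j < 1"
    by (auto simp: linial_cell_def)
  have "linial_cell n R = linial_cell n (\<lambda>i j. x i - x j < 1)"
    by (rule linial_cell_eqI) (rule R)
  then show ?thesis using x by (simp add: linial_regions_eq)
qed

text \<open>The fractional parts \<open>p v / n\<close> are distinct, so no difference of
  coordinates with different indices equals 1, and their order is that of \<open>p\<close>.\<close>

lemma ex_mem_linial_cell_drift_sign:
  assumes "bij_betw p {1..n} {..<n}"
  shows "\<exists>x. x \<in> linial_cell n (drift_sign d p)"
proof
  define x where "x = restrict (\<lambda>v. real (d v) + real (p v) / real n) {1..n}"
  have pn: "p v < n" if "v \<in> {1..n}" for v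
    using bij_betw_apply[OF assms that] by simp
  show "x \<in> linial_cell n (drift_sign d p)"
    unfolding linial_cell_iff
  proof (intro conjI allI impI)
    show "x \<in> Rn n" by (simp add: x_def Rn_def)
    fix i j assume "1 \<le> i \<and> i < j \<and> j \<le> n"
    then have i: "i \<in> {1..n}" and j: "j \<in> {1..n}" and ij: "i \<noteq> j" by auto
    define e where "e v = real (p v) / real n" for v
    have e: "0 \<le> e v" "e v < 1" if "v \<in> {1..n}" for v
      using pn[OF that] by (auto simp: e_def)
    have less: "e i < e j \<longleftrightarrow> p i < p j"
      using i by (simp add: e_def divide_less_cancel)
    have ne: "p i \<noteq> p j"
      using inj_on_eq_iff[OF bij_betw_imp_inj_on[OF assms] i j] ij by simp
    then have "e i \<noteq> e j" using i by (simp add: e_def)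
    have x: "x i = d i + e i" "x j = d j + e j" using i j by (simp_all add: x_def e_def)
    consider "d i \<le> d j" | "d i = d j + 1" | "d j + 2 \<le> d i" by linarith
    then show "if drift_sign d p i j then x i - x j < 1 else 1 < x i - x j"
    proof cases
      case 1
      then have "real (d i) \<le> real (d j)" by simp
      with 1 x e[OF i] e[OF j] show ?thesis by (simp add: drift_sign_def)
    next
      case 2
      with x less \<open>e i \<noteq> e j\<close> show ?thesis by (auto simp: drift_sign_def)
    next
      case 3
      then have "real (d j) + 2 \<le> real (d i)" by simp
      with 3 x e[OF i] e[OF j] show ?thesis by (simp add: drift_sign_def)
    qed
  qed
qed

text \<open>Positions come from sorting by \<open>f\<close>; labels with equal keys are ranked
  somehow, and nothing is claimed about them.\<close>

lemma ex_position_by_key: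
  fixes f :: "nat \<Rightarrow> real"
  obtains p where "bij_betw p {1..n} {..<n}"
    "\<And>u v. \<lbrakk>u \<in> {1..n}; v \<in> {1..n}; f u < f v\<rbrakk> \<Longrightarrow> p u < p v"
proof -
  define w where "w = sort_key f [1..<Suc n]"
  have w: "length w = n" "distinct w" "set w = {1..n}" "sorted (map f w)"
    by (auto simp: w_def)
  have bij: "bij_betw ((!) w) {..<n} {1..n}"
    using bij_betw_nth[OF w(2), of "{..<n}" "{1..n}"] w by simp
  define p where "p = inv_into {..<n} ((!) w)"
  have bijp: "bij_betw p {1..n} {..<n}" unfolding p_def by (rule bij_betw_inv_into[OF bij])
  have wp: "w ! p v = v" "p v < n" if "v \<in> {1..n}" for v
    using bij_betw_inv_into_right[OF bij that] bij_betw_apply[OF bijp that] by (simp_all add: p_def)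
  have "p u < p v" if "u \<in> {1..n}" "v \<in> {1..n}" "f u < f v" for u v
  proof (rule ccontr)
    assume "\<not> p u < p v"
    then have "f (w ! p v) \<le> f (w ! p u)"
      using sorted_nth_mono[OF w(4), of "p v" "p u"] wp[OF that(1)] wp[OF that(2)] w(1) by simp
    with wp[OF that(1)] wp[OF that(2)] that show False by simp
  qed
  with bijp that show ?thesis by blast
qed

text \<open>The parts are taken after subtracting the least coordinate, so that the integer parts
  are natural numbers. Equal fractional parts with integer parts differing by 1 would put
  \<open>x\<close> on a hyperplane, so ties in the ranking never affect a sign.\<close>

lemma ex_drift_sign_of_point:
  assumes x: "x \<in> Rn n - \<Union>(linial_arrangement n)"
  obtains d p where "bij_betw p {1..n} {..<n}"
    "\<And>i j. \<lbrakk>1 \<le> i; i < j; j \<le> n\<rbrakk> \<Longrightarrow> drift_sign d p i j \<longleftrightarrow> x i - x j < 1"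
proof -
  define m where "m = Min (x ` {1..n})"
  define e where "e v = frac (x v - m)" for v
  define d where "d v = nat \<lfloor>x v - m\<rfloor>" for v
  obtain p where p: "bij_betw p {1..n} {..<n}"
    and mono: "\<And>u v. \<lbrakk>u \<in> {1..n}; v \<in> {1..n}; e u < e v\<rbrakk> \<Longrightarrow> p u < p v"
    using ex_position_by_key[of n e] by blast
  have xv: "x v = m + d v + e v" "0 \<le> e v" "e v < 1" if "v \<in> {1..n}" for v
  proof -
    have "m \<le> x v" unfolding m_def using that by (intro Min_le) auto
    then show "x v = m + d v + e v" by (simp add: d_def e_def frac_def)
    show "0 \<le> e v" "e v < 1" by (simp_all add: e_def frac_lt_1)
  qed
  have "drift_sign d p i j \<longleftrightarrow> x i - x j < 1" if ij: "1 \<le> i" "i < j" "j \<le> n" for i j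
  proof -
    have i: "i \<in> {1..n}" and j: "j \<in> {1..n}" using ij by auto
    have "x i - x j \<noteq> 1"
      using x ij unfolding linial_complement_iff by blast
    consider "d i \<le> d j" | "d i = d j + 1" | "d j + 2 \<le> d i" by linarith
    then show ?thesis
    proof cases
      case 1
      then have "real (d i) \<le> real (d j)" by simp
      with 1 xv[OF i] xv[OF j] show ?thesis by (simp add: drift_sign_def)
    next
      case 2
      with \<open>x i - x j \<noteq> 1\<close> xv[OF i] xv[OF j] have "e i \<noteq> e j" by auto
      then have "p i < p j \<longleftrightarrow> e i < e j"
        using mono[OF i j] mono[OF j i] by linarith
      with 2 xv[OF i] xv[OF j] show ?thesis by (simp add: drift_sign_def)
    next
      case 3
      then have "real (d j) + 2 \<le> real (d i)" by simp
      with 3 xv[OF i] xv[OF j] show ?thesis by (simp add: drift_sign_def)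
    qed
  qed
  with p that show ?thesis by blast
qed

lemma bernardi_region_eq_linial_cell:
  assumes "\<And>i j. i \<in> {1..n} \<Longrightarrow> j \<in> {1..n} \<Longrightarrow> precedes T i j \<longleftrightarrow> p i < p j"
  shows "bernardi_region n T = linial_cell n (drift_sign (drift T) p)"
proof -
  have "bernardi_region n T =
      linial_cell n (\<lambda>i j. drift T i \<le> drift T j \<or> drift T i = drift T j + 1 \<and> precedes T i j)"
    by (simp add: bernardi_region_def linial_cell_def)
  also have "\<dots> = linial_cell n (drift_sign (drift T) p)"
    using assms by (intro linial_cell_eqI) (simp add: drift_sign_def)
  finally show ?thesis .
qed

theorem bij_betw_bernardi_region:
  "bij_betw (bernardi_region n) (bernardi_trees n) (linial_regions n)"
proof (rule bij_betwI')
  fix T T' assume T: "T \<in> bernardi_trees n" and T': "T' \<in> bernardi_trees n"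
  obtain p where p: "bernardi_code n (drift T) p"
    "\<And>i j. i \<in> {1..n} \<Longrightarrow> j \<in> {1..n} \<Longrightarrow> precedes T i j \<longleftrightarrow> p i < p j"
    "\<And>i. i < n \<Longrightarrow> p (preorder_word T ! i) = i"
    by (rule bernardi_tree_imp_code[OF T], rule that) (assumption | blast)+
  obtain p' where p': "bernardi_code n (drift T') p'"
    "\<And>i j. i \<in> {1..n} \<Longrightarrow> j \<in> {1..n} \<Longrightarrow> precedes T' i j \<longleftrightarrow> p' i < p' j"
    "\<And>i. i < n \<Longrightarrow> p' (preorder_word T' ! i) = i"
    by (rule bernardi_tree_imp_code[OF T'], rule that) (assumption | blast)+
  have bij: "bij_betw p {1..n} {..<n}" and bij': "bij_betw p' {1..n} {..<n}"
    using p p' by (simp_all add: bernardi_code_def)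
  have region: "bernardi_region n T = linial_cell n (drift_sign (drift T) p)"
    by (rule bernardi_region_eq_linial_cell) (rule p(2))
  have region': "bernardi_region n T' = linial_cell n (drift_sign (drift T') p')"
    by (rule bernardi_region_eq_linial_cell) (rule p'(2))
  show "bernardi_region n T = bernardi_region n T' \<longleftrightarrow> T = T'"
  proof
    assume eq: "bernardi_region n T = bernardi_region n T'"
    \<comment> \<open>Nonemptiness matters: equal cells yield equal signs only through a common
      point.\<close>
    obtain x where "x \<in> linial_cell n (drift_sign (drift T) p)"
      using ex_mem_linial_cell_drift_sign[OF bij] by blast
    moreover from this have "x \<in> linial_cell n (drift_sign (drift T') p')"
      using eq region region' by simp
    ultimately have sign: "drift_sign (drift T) p i j \<longleftrightarrow> drift_sign (drift T') p' i j"
      if "1 \<le> i" "i < j" "j \<le> n" for i j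
      using that by (simp add: linial_cell_def)
    have uniq: "drift T v = drift T' v" "p v = p' v" if "v \<in> {1..n}" for v
    proof -
      show "drift T v = drift T' v" "p v = p' v"
        by (rule bernardi_code_unique[OF p(1) p'(1) _ that]; rule sign; assumption)+
    qed
    have "preorder_word T ! i = preorder_word T' ! i" if i: "i < n" for i
    proof -
      have in': "preorder_word S ! i \<in> {1..n}" if "S \<in> bernardi_trees n" for S
        using that i nth_mem[of i "preorder_word S"] by (simp add: bernardi_trees_def)
      have "p' (preorder_word T ! i) = p' (preorder_word T' ! i)"
        using uniq(2)[OF in'[OF T]] p(3)[OF i] p'(3)[OF i] by simp
      then show ?thesis
        using inj_on_eq_iff[OF bij_betw_imp_inj_on[OF bij'] in'[OF T] in'[OF T']] by simp
    qed
    then have "preorder_word T = preorder_word T'"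
      using T T' by (intro nth_equalityI) (auto simp: bernardi_trees_def)
    then show "T = T'"
      by (rule bernardi_tree_eqI[OF T T' _ uniq(1)])
  qed simp
next
  fix T assume T: "T \<in> bernardi_trees n"
  obtain p where p: "bernardi_code n (drift T) p"
    "\<And>i j. i \<in> {1..n} \<Longrightarrow> j \<in> {1..n} \<Longrightarrow> precedes T i j \<longleftrightarrow> p i < p j"
    by (rule bernardi_tree_imp_code[OF T], rule that) (assumption | blast)+
  have "bij_betw p {1..n} {..<n}" using p by (simp add: bernardi_code_def)
  then obtain x where "x \<in> linial_cell n (drift_sign (drift T) p)"
    using ex_mem_linial_cell_drift_sign by blast
  then have "linial_cell n (drift_sign (drift T) p) \<in> linial_regions n"
    by (rule linial_cell_in_regions)
  moreover have "bernardi_region n T = linial_cell n (drift_sign (drift T) p)"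
    by (rule bernardi_region_eq_linial_cell) (rule p(2))
  ultimately show "bernardi_region n T \<in> linial_regions n" by simp
next
  fix C assume "C \<in> linial_regions n"
  then obtain x where x: "x \<in> Rn n - \<Union>(linial_arrangement n)"
    and C: "C = linial_cell n (\<lambda>i j. x i - x j < 1)"
    unfolding linial_regions_eq by blast
  \<comment> \<open>Surjectivity: the point gives some pair with its signs, which is reduced to a
    code with the same signs and then decoded to a tree.\<close>
  obtain d0 p0 where p0: "bij_betw p0 {1..n} {..<n}"
    "\<And>i j. \<lbrakk>1 \<le> i; i < j; j \<le> n\<rbrakk> \<Longrightarrow> drift_sign d0 p0 i j \<longleftrightarrow> x i - x j < 1"
    by (rule ex_drift_sign_of_point[OF x], rule that) (assumption | blast)+
  obtain d p where code: "bernardi_code n d p"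
    and sign: "\<And>i j. \<lbrakk>1 \<le> i; i < j; j \<le> n\<rbrakk> \<Longrightarrow> drift_sign d p i j \<longleftrightarrow> x i - x j < 1"
    by (rule ex_bernardi_code[OF p0(1)], rule p0(2), assumption+, rule that) (assumption | blast)+
  obtain T where T: "T \<in> bernardi_trees n" "\<And>v. v \<in> {1..n} \<Longrightarrow> drift T v = d v"
    "\<And>i j. i \<in> {1..n} \<Longrightarrow> j \<in> {1..n} \<Longrightarrow> precedes T i j \<longleftrightarrow> p i < p j"
    by (rule bernardi_tree_of_code[OF code], rule that) (assumption | blast)+
  have "C = linial_cell n (drift_sign (drift T) p)"
    unfolding C
  proof (rule linial_cell_eqI)
    fix i j assume ij: "1 \<le> i" "i < j" "j \<le> n"
    show "x i - x j < 1 \<longleftrightarrow> drift_sign (drift T) p i j"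
      using sign[OF ij] T(2)[of i] T(2)[of j] ij by (simp add: drift_sign_def)
  qed
  also have "\<dots> = bernardi_region n T"
    by (rule bernardi_region_eq_linial_cell[symmetric]) (rule T(3))
  finally show "\<exists>T\<in>bernardi_trees n. C = bernardi_region n T"
    using T(1) by blast
qed

section \<open>Blocks of the preorder word and the action\<close>

abbreviation shape :: "'a tree \<Rightarrow> unit tree" where
  "shape \<equiv> map_tree (\<lambda>_. ())"

text \<open>Recursive counterpart of cutting the preorder word after each terminal node, suited to
  induction on trees. A root with a child joins the first block of what follows it; a childless root
  is a block of its own.\<close>

fun tree_blocks :: "'a tree \<Rightarrow> 'a list list" where
  "tree_blocks \<langle>\<rangle> = []"
| "tree_blocks \<langle>l, a, r\<rangle> =
     (case tree_blocks r @ tree_blocks l of [] \<Rightarrow> [[a]] | w # ws \<Rightarrow> (a # w) # ws)"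

text \<open>A flag \<open>True\<close> marks a terminal node and closes a block. Flags after the
  last \<open>True\<close> are dropped, in agreement with taking differences of positions.\<close>

fun block_lengths :: "bool list \<Rightarrow> nat list" where
  "block_lengths [] = []"
| "block_lengths (b # bs) =
     (if b then 1 # block_lengths bs else case block_lengths bs of [] \<Rightarrow> [] | c # cs \<Rightarrow> Suc c # cs)"

text \<open>A prepended flag shifts all later positions by 1. Differences between shifted positions
  are unchanged, so only the front of the list is affected.\<close>

lemma map2_minus_positions:
  "map2 (-) (filter (\<lambda>i. bs ! (i - 1)) [1..<Suc (length bs)])
     (0 # filter (\<lambda>i. bs ! (i - 1)) [1..<Suc (length bs)]) = block_lengths bs"
proof (induction bs)
  case (Cons b bs)
  define ps where "ps = filter (\<lambda>i. bs ! (i - 1)) [1..<Suc (length bs)]"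
  have IH: "map2 (-) ps (0 # ps) = block_lengths bs"
    using Cons.IH by (simp add: ps_def)
  have "[1..<Suc (length (b # bs))] = 1 # map Suc [1..<Suc (length bs)]"
    by (simp add: map_Suc_upt upt_conv_Cons del: upt_Suc)
  moreover have "filter (\<lambda>i. (b # bs) ! (i - 1)) (map Suc [1..<Suc (length bs)]) = map Suc ps"
    unfolding ps_def filter_map comp_def
    by (intro arg_cong[where f = "map Suc"] filter_cong refl) (auto simp: nth_Cons' simp del: upt_Suc)
  ultimately have ps': "filter (\<lambda>i. (b # bs) ! (i - 1)) [1..<Suc (length (b # bs))] =
      (if b then [1] else []) @ map Suc ps"
    by (cases b) (simp_all del: upt_Suc)
  have Suc: "map2 (-) (map Suc us) (map Suc vs) = map2 (-) us vs" for us vs :: "nat list"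
    by (simp add: zip_map1 zip_map2 case_prod_unfold comp_def)
  show ?case
  proof (cases b)
    case True
    have "map2 (-) (1 # map Suc ps) (0 # 1 # map Suc ps) = 1 # map2 (-) (map Suc ps) (map Suc (0 # ps))"
      by simp
    then show ?thesis unfolding ps' using True by (simp only: Suc IH) simp
  next
    case False
    show ?thesis
    proof (cases ps)
      case Nil
      with IH False show ?thesis unfolding ps' by auto
    next
      case (Cons p qs)
      have "map2 (-) (map Suc (p # qs)) (0 # map Suc (p # qs)) = Suc p # map2 (-) (map Suc qs) (map Suc (p # qs))"
        by simp
      also have "\<dots> = Suc p # map2 (-) qs (p # qs)" by (simp only: Suc)
      finally have *: "map2 (-) (map Suc (p # qs)) (0 # map Suc (p # qs)) = Suc p # map2 (-) qs (p # qs)" .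
      have "block_lengths bs = p # map2 (-) qs (p # qs)" using IH Cons by simp
      with False * show ?thesis unfolding ps' Cons by simp
    qed
  qed
qed simp

lemma length_nodes_preorder [simp]: "length (nodes_preorder T) = size T"
  by (induction T) auto

lemma composition_type_eq_block_lengths:
  "composition_type T = block_lengths (map terminal (nodes_preorder T))"
proof -
  have "terminal_positions T =
      filter (\<lambda>i. map terminal (nodes_preorder T) ! (i - 1)) [1..<Suc (length (map terminal (nodes_preorder T)))]"
    unfolding terminal_positions_def by (intro filter_cong) auto
  then show ?thesis
    unfolding composition_type_def using map2_minus_positions by metis
qed

lemma block_lengths_not_Nil: "bs \<noteq> [] \<Longrightarrow> last bs \<Longrightarrow> block_lengths bs \<noteq> []"
  by (induction bs) (auto split: list.splits if_splits)

text \<open>No block straddles the junction if the first list ends with a terminal node, as the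
  preorder list of every nonempty subtree does.\<close>

lemma block_lengths_append:
  "bs = [] \<or> last bs \<Longrightarrow> block_lengths (bs @ cs) = block_lengths bs @ block_lengths cs"
proof (induction bs)
  case (Cons b bs)
  show ?case
  proof (cases "bs = []")
    case False
    with Cons have "block_lengths (bs @ cs) = block_lengths bs @ block_lengths cs" "block_lengths bs \<noteq> []"
      using block_lengths_not_Nil by auto
    then show ?thesis by (auto split: list.splits)
  qed (use Cons.prems in auto)
qed simp

lemma nodes_preorder_eq_Nil_iff [simp]: "nodes_preorder T = [] \<longleftrightarrow> T = \<langle>\<rangle>"
  by (cases T) auto

lemma terminal_last_nodes_preorder: "T \<noteq> \<langle>\<rangle> \<Longrightarrow> terminal (last (nodes_preorder T))"
proof (induction T)
  case (Node l a r)
  then show ?case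
    by (cases "l = \<langle>\<rangle>"; cases "r = \<langle>\<rangle>") (auto simp: terminal_def)
qed simp

lemma tree_blocks_eq_Nil_iff [simp]: "tree_blocks T = [] \<longleftrightarrow> T = \<langle>\<rangle>"
  by (cases T) (auto split: list.splits)

lemma composition_type_eq: "composition_type T = map length (tree_blocks T)"
proof (induction T)
  case (Node l a r)
  let ?f = "\<lambda>T. map terminal (nodes_preorder T)"
  have "?f r = [] \<or> last (?f r)"
    using terminal_last_nodes_preorder[of r] by (cases "r = \<langle>\<rangle>") (simp_all add: last_map)
  then have *: "block_lengths (?f r @ ?f l) = map length (tree_blocks r @ tree_blocks l)"
    using Node by (simp add: block_lengths_append composition_type_eq_block_lengths)
  show ?case
  proof (cases "tree_blocks r @ tree_blocks l")
    case Nil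
    then have "l = \<langle>\<rangle>" "r = \<langle>\<rangle>" by auto
    then show ?thesis by (simp add: composition_type_eq_block_lengths terminal_def)
  next
    case (Cons w ws)
    then have "\<not> terminal \<langle>l, a, r\<rangle>" by (auto simp: terminal_def)
    with Cons * show ?thesis by (simp add: composition_type_eq_block_lengths)
  qed
qed (simp add: composition_type_eq_block_lengths)

lemma concat_tree_blocks [simp]: "concat (tree_blocks T) = preorder_word T"
proof (induction T)
  case (Node l a r)
  then have "concat (tree_blocks r @ tree_blocks l) = preorder_word r @ preorder_word l" by simp
  then show ?case by (cases "tree_blocks r @ tree_blocks l") simp_all
qed simp

lemma factor_word_concat [simp]: "factor_word (map length ws) (concat ws) = ws"
  by (induction ws) auto

lemma factor_word_composition_type: "factor_word (composition_type T) (preorder_word T) = tree_blocks T"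
  by (metis composition_type_eq concat_tree_blocks factor_word_concat)

lemma tree_blocks_map_tree: "tree_blocks (map_tree f T) = map (map f) (tree_blocks T)"
proof (induction T)
  case (Node l a r)
  have "tree_blocks (map_tree f r) @ tree_blocks (map_tree f l) = map (map f) (tree_blocks r @ tree_blocks l)"
    using Node by simp
  then show ?case by (cases "tree_blocks r @ tree_blocks l") simp_all
qed simp

lemma composition_type_map_tree [simp]: "composition_type (map_tree f T) = composition_type T"
  by (simp add: composition_type_eq tree_blocks_map_tree comp_def)

lemma right_edges_map_tree [simp]: "right_edges (map_tree f T) = right_edges T"
  by (induction T) auto

section \<open>Trees determined by a shape and a word\<close>

lemma tree_eqI:
  "shape T = shape T' \<Longrightarrow> preorder_word T = preorder_word T' \<Longrightarrow> T = T'"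
proof (induction T arbitrary: T')
  case (Node l a r)
  then obtain l' a' r' where T': "T' = \<langle>l', a', r'\<rangle>" by (cases T') auto
  with Node.prems(1) have sh: "shape l = shape l'" "shape r = shape r'" by auto
  then have "size r = size r'" by (metis size_map_tree)
  with Node.prems(2) T' have "preorder_word r = preorder_word r'" "preorder_word l = preorder_word l'" "a = a'"
    by auto
  with Node.IH sh T' show ?case by auto
next
  case Leaf
  then show ?case by (cases T') auto
qed

lemma tree_eqI_blocks: "shape T = shape T' \<Longrightarrow> tree_blocks T = tree_blocks T' \<Longrightarrow> T = T'"
  by (metis concat_tree_blocks tree_eqI)

lemma ex_tree_preorder_word:
  "length w = size t \<Longrightarrow> \<exists>T. shape T = shape t \<and> preorder_word T = w"
proof (induction t arbitrary: w)
  case (Node l a r)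
  then obtain b v where w: "w = b # v" by (cases w) auto
  obtain R where R: "shape R = shape r" "preorder_word R = take (size r) v"
    using Node.IH(2)[of "take (size r) v"] Node.prems w by auto
  obtain L where L: "shape L = shape l" "preorder_word L = drop (size r) v"
    using Node.IH(1)[of "drop (size r) v"] Node.prems w by auto
  show ?case
    using R L w by (intro exI[of _ "\<langle>L, b, R\<rangle>"]) simp
qed simp

lemma ex_tree_blocks:
  assumes "map length ws = composition_type t"
  obtains T where "shape T = shape t" "tree_blocks T = ws"
proof -
  have "length (concat ws) = sum_list (map length (tree_blocks t))"
    using assms by (simp add: length_concat composition_type_eq)
  also have "\<dots> = size t"
    by (simp flip: length_concat)
  finally obtain T where T: "shape T = shape t" "preorder_word T = concat ws"
    using ex_tree_preorder_word by blast
  have "composition_type T = composition_type t"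
    using T(1) by (metis composition_type_map_tree)
  then have "tree_blocks T = ws"
    using T(2) assms by (metis factor_word_composition_type factor_word_concat)
  with T that show ?thesis by blast
qed

text \<open>In its block the root is followed by the root of the right subtree, or of the left one
  if there is no right subtree. By transitivity it suffices to compare the root with this neighbour.
  The relation will be \<open>>\<close> for Bernardi trees and \<open>\<ge>\<close> for their weakly
  decreasing analogues.\<close>

lemma sorted_tree_blocks_Node_iff:
  assumes "transp R"
  shows "(\<forall>W\<in>set (tree_blocks \<langle>l, a, r\<rangle>). sorted_wrt R W) \<longleftrightarrow>
     (if r \<noteq> \<langle>\<rangle> then R a (value r) else l \<noteq> \<langle>\<rangle> \<longrightarrow> R a (value l)) \<and>
     (\<forall>W\<in>set (tree_blocks l). sorted_wrt R W) \<and> (\<forall>W\<in>set (tree_blocks r). sorted_wrt R W)"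
proof -
  have hd: "\<exists>v w. tree_blocks T = (value T # v) # w" if "T \<noteq> \<langle>\<rangle>" for T :: "'a tree"
    using that by (cases T) (auto split: list.splits)
  have step: "sorted_wrt R (a # b # v) \<longleftrightarrow> R a b \<and> sorted_wrt R (b # v)" for b v
    using assms by (auto simp: sorted_wrt.simps dest: transpD)
  show ?thesis
  proof (cases "r = \<langle>\<rangle>")
    case True
    show ?thesis
    proof (cases "l = \<langle>\<rangle>")
      case False
      then obtain v w where "tree_blocks l = (value l # v) # w" using hd by blast
      with True False step[of "value l" v] show ?thesis by auto
    qed (use True in auto)
  next
    case False
    then obtain v w where "tree_blocks r = (value r # v) # w" using hd by blast
    with False step[of "value r" v] show ?thesis by auto
  qed
qed

lemma bernardi_decreasing_iff_blocks:
  "bernardi_decreasing T \<longleftrightarrow> (\<forall>W\<in>set (tree_blocks T). sorted_wrt (>) W)"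
proof (induction T)
  case (Node l a r)
  have tr: "transp ((>) :: nat \<Rightarrow> nat \<Rightarrow> bool)" by (rule transpI) simp
  show ?case unfolding sorted_tree_blocks_Node_iff[OF tr] using Node by simp
qed simp

section \<open>Relabeling and sorting blocks\<close>

lemma mset_act_word [simp]: "mset (act_word \<sigma> W) = image_mset \<sigma> (mset W)"
  by (simp add: act_word_def)

lemma length_act_word [simp]: "length (act_word \<sigma> W) = length W"
  by (simp add: act_word_def)

lemma sorted_wrt_act_word: "sorted_wrt (\<ge>) (act_word \<sigma> W)"
  by (simp add: act_word_def sorted_wrt_rev)

lemma act_word_eqI:
  assumes "sorted_wrt (\<ge>) V" "mset V = image_mset \<sigma> (mset W)"
  shows "act_word \<sigma> W = V"
proof -
  have "sorted (rev V)" using assms(1) by (simp add: sorted_wrt_rev)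
  then have "sort (map \<sigma> W) = rev V" using assms(2) by (intro properties_for_sort) simp_all
  then show ?thesis by (simp add: act_word_def)
qed

text \<open>A sorted word depends only on its multiset, so the intermediate sorting is forgotten.
  The maps may be non-injective, which lets labelings by variables be composed with
  permutations.\<close>

lemma act_word_comp: "act_word \<sigma> (act_word \<tau> W) = act_word (\<sigma> \<circ> \<tau>) W"
  by (rule act_word_eqI) (simp_all add: sorted_wrt_act_word image_mset.compositionality)

text \<open>Sorting keeps the block lengths, so a tree of this shape with the new blocks exists;
  shape and word determine it, so the description in \<open>act_tree\<close> has exactly one
  solution.\<close>

lemma
  shows shape_act_tree [simp]: "shape (act_tree \<sigma> T) = shape T"
    and tree_blocks_act_tree: "tree_blocks (act_tree \<sigma> T) = map (act_word \<sigma>) (tree_blocks T)"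
proof -
  let ?P = "\<lambda>T'. shape T' = shape T \<and> preorder_word T' = concat (map (act_word \<sigma>) (tree_blocks T))"
  have len: "map length (map (act_word \<sigma>) (tree_blocks T)) = composition_type T"
    by (simp add: composition_type_eq comp_def)
  from ex_tree_blocks[OF len] obtain T' where T': "shape T' = shape T"
    "tree_blocks T' = map (act_word \<sigma>) (tree_blocks T)" .
  then have "?P T'" by (metis concat_tree_blocks)
  moreover from this have "S = T'" if "?P S" for S
    using that by (metis tree_eqI)
  ultimately have "act_tree \<sigma> T = T'"
    unfolding act_tree_def factor_word_composition_type by (rule the_equality)
  with T' show "shape (act_tree \<sigma> T) = shape T"
    "tree_blocks (act_tree \<sigma> T) = map (act_word \<sigma>) (tree_blocks T)" by simp_all
qed

lemma act_tree_comp: "act_tree \<sigma> (act_tree \<tau> T) = act_tree (\<sigma> \<circ> \<tau>) T"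
  by (rule tree_eqI_blocks) (simp_all add: tree_blocks_act_tree act_word_comp)

lemma in_block_imp_in_tree: "W \<in> set (tree_blocks T) \<Longrightarrow> x \<in> set W \<Longrightarrow> x \<in> set_tree T"
  by (metis UN_iff concat_tree_blocks set_concat set_preorder_word)

lemma act_tree_cong:
  assumes "\<And>x. x \<in> set_tree T \<Longrightarrow> \<sigma> x = \<tau> x"
  shows "act_tree \<sigma> T = act_tree \<tau> T"
proof (rule tree_eqI_blocks)
  have "act_word \<sigma> W = act_word \<tau> W" if "W \<in> set (tree_blocks T)" for W
    using in_block_imp_in_tree[OF that] assms unfolding act_word_def by (metis map_cong)
  then show "tree_blocks (act_tree \<sigma> T) = tree_blocks (act_tree \<tau> T)"
    by (simp add: tree_blocks_act_tree)
qed simp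

lemma act_tree_id:
  assumes "\<And>W. W \<in> set (tree_blocks T) \<Longrightarrow> sorted_wrt (\<ge>) W"
  shows "act_tree id T = T"
proof (rule tree_eqI_blocks)
  have "act_word id W = W" if "W \<in> set (tree_blocks T)" for W
    using assms[OF that] by (intro act_word_eqI) simp_all
  then show "tree_blocks (act_tree id T) = tree_blocks T"
    by (simp add: tree_blocks_act_tree map_idI)
qed simp

lemma mset_preorder_word_act_tree [simp]:
  "mset (preorder_word (act_tree \<sigma> T)) = image_mset \<sigma> (mset (preorder_word T))"
proof -
  have "mset (concat (map (act_word \<sigma>) ws)) = image_mset \<sigma> (mset (concat ws))" for ws
    by (induction ws) auto
  then show ?thesis
    by (metis concat_tree_blocks tree_blocks_act_tree)
qed

lemma size_act_tree [simp]: "size (act_tree \<sigma> T) = size T"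
  by (metis shape_act_tree size_map_tree)

lemma right_edges_act_tree [simp]: "right_edges (act_tree \<sigma> T) = right_edges T"
  by (metis right_edges_map_tree shape_act_tree)

lemma bernardi_trees_iff:
  "T \<in> bernardi_trees n \<longleftrightarrow>
     mset (preorder_word T) = mset_set {1..n} \<and> (\<forall>W\<in>set (tree_blocks T). sorted_wrt (>) W)"
proof -
  have "size T = n \<and> distinct (preorder_word T) \<and> set_tree T = {1..n} \<longleftrightarrow>
      mset (preorder_word T) = mset_set {1..n}"
  proof
    assume *: "size T = n \<and> distinct (preorder_word T) \<and> set_tree T = {1..n}"
    then show "mset (preorder_word T) = mset_set {1..n}"
      by (metis mset_set_set set_preorder_word)
  next
    assume *: "mset (preorder_word T) = mset_set {1..n}"
    then have set: "set_tree T = {1..n}"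
      using arg_cong[OF *, of set_mset] by (metis finite_atLeastAtMost finite_set_mset_mset_set set_mset_mset set_preorder_word)
    moreover have size: "size T = n"
      using arg_cong[OF *, of size] by simp
    moreover have "distinct (preorder_word T)"
      using set size by (intro card_distinct) simp
    ultimately show "size T = n \<and> distinct (preorder_word T) \<and> set_tree T = {1..n}" by blast
  qed
  then show ?thesis
    unfolding bernardi_trees_def bernardi_decreasing_iff_blocks by blast
qed

lemma sorted_wrt_greater_imp_ge: "sorted_wrt (>) W \<Longrightarrow> sorted_wrt (\<ge>) (W :: nat list)"
  by (induction W) auto

text \<open>A permutation keeps the letters of a block distinct, so the sorted block is strictly
  decreasing.\<close>

lemma act_tree_in_bernardi_trees:
  assumes T: "T \<in> bernardi_trees n" and \<sigma>: "\<sigma> permutes {1..n}"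
  shows "act_tree \<sigma> T \<in> bernardi_trees n"
proof -
  have "image_mset \<sigma> (mset_set {1..n}) = mset_set {1..n}"
    using \<sigma> by (simp add: image_mset_mset_set permutes_inj_on permutes_image)
  moreover have "sorted_wrt (>) (act_word \<sigma> W)" if W: "W \<in> set (tree_blocks T)" for W
  proof -
    have "sorted_wrt (>) W" using T W by (simp add: bernardi_trees_iff)
    then have "sorted_wrt (<) (rev W)" by (simp add: sorted_wrt_rev)
    then have "distinct W" using strict_sorted_iff distinct_rev by blast
    then have "distinct (map \<sigma> W)"
      using \<sigma> by (simp add: distinct_map permutes_inj_on)
    then have "sorted_wrt (<) (sort (map \<sigma> W))"
      by (simp add: strict_sorted_iff)
    then show ?thesis by (simp add: act_word_def sorted_wrt_rev)
  qed
  ultimately show ?thesis using T by (simp add: bernardi_trees_iff tree_blocks_act_tree)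
qed

lemma act_tree_id_bernardi: "T \<in> bernardi_trees n \<Longrightarrow> act_tree id T = T"
  by (rule act_tree_id) (simp add: bernardi_trees_iff sorted_wrt_greater_imp_ge)

section \<open>Power sums and cycle types\<close>

lemma finite_sub_multisets: "finite {A. A \<subseteq># M}"
proof (induction M)
  case (add x M)
  have "{A. A \<subseteq># add_mset x M} \<subseteq> {A. A \<subseteq># M} \<union> add_mset x ` {A. A \<subseteq># M}"
  proof
    fix A assume A: "A \<in> {A. A \<subseteq># add_mset x M}"
    show "A \<in> {A. A \<subseteq># M} \<union> add_mset x ` {A. A \<subseteq># M}"
    proof (cases "x \<in># A")
      case True
      then obtain B where "A = add_mset x B" by (meson mset_add)
      with A show ?thesis by auto
    next
      case False
      with A have "A \<subseteq># M"
        by (metis diff_single_trivial mem_Collect_eq subset_eq_diff_conv add_mset_add_single)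
      then show ?thesis by simp
    qed
  qed
  with add show ?case using finite_subset by blast
qed simp

text \<open>\<open>p_partition\<close> takes the parts in increasing order. Listing the sets by
  cardinality gives the same list of factors, so the product can be indexed by the sets
  themselves.\<close>

lemma p_partition_eq_prod:
  assumes "finite \<O>"
  obtains os where "distinct os" "set os = \<O>"
    "p_partition (image_mset card (mset_set \<O>)) =
       (prod_series (map (\<lambda>B. power_sum (card B)) os) :: 'a::comm_semiring_1 series)"
proof -
  obtain xs where xs: "distinct xs" "set xs = \<O>" using assms finite_distinct_list by blast
  define os where "os = sort_key card xs"
  have "mset os = mset_set \<O>" unfolding os_def using xs by (simp add: mset_set_set flip: xs(2))
  then have "sort (map card os) = sorted_list_of_multiset (image_mset card (mset_set \<O>))"
    by (simp flip: sorted_list_of_multiset_mset)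
  moreover have "sort (map card os) = map card os"
    unfolding os_def by (simp add: sorted_sort_id)
  ultimately have "p_partition (image_mset card (mset_set \<O>)) =
      (prod_series (map (\<lambda>B. power_sum (card B)) os) :: 'a series)"
    by (simp add: p_partition_def comp_def flip: \<open>sort (map card os) = sorted_list_of_multiset _\<close>)
  moreover have "distinct os" "set os = \<O>" using xs by (simp_all add: os_def)
  ultimately show ?thesis using that by blast
qed

lemma replicate_mset_inject_index: "0 < k \<Longrightarrow> replicate_mset k i = replicate_mset k j \<longleftrightarrow> i = j"
  by (metis in_replicate_mset)

lemma finite_PiE_sum_replicate_mset:
  assumes "finite A" "\<And>B. B \<in> A \<Longrightarrow> 0 < card B"
  shows "finite {g \<in> A \<rightarrow>\<^sub>E {0<..}. (\<Sum>B\<in>A. replicate_mset (card B) (g B)) = M}"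
proof (rule finite_subset)
  show "{g \<in> A \<rightarrow>\<^sub>E {0<..}. (\<Sum>B\<in>A. replicate_mset (card B) (g B)) = M} \<subseteq> A \<rightarrow>\<^sub>E set_mset M"
  proof (intro subsetI PiE_I)
    fix g B assume g: "g \<in> {g \<in> A \<rightarrow>\<^sub>E {0<..}. (\<Sum>B\<in>A. replicate_mset (card B) (g B)) = M}" and B: "B \<in> A"
    then have "0 < card B" using assms(2) by simp
    moreover have "replicate_mset (card B) (g B) \<subseteq># M"
      using g assms(1) B by (auto simp: sum.remove)
    ultimately show "g B \<in># M" by (auto dest!: set_mset_mono)
  qed auto
  show "finite (A \<rightarrow>\<^sub>E set_mset M)" using assms(1) by (intro finite_PiE) auto
qed

text \<open>Expanding the product picks one monomial from each power sum, that is, one variable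
  index \<open>g B\<close> for each \<open>B\<close>. Positive cardinality makes the index
  recoverable from the monomial.\<close>

lemma prod_power_sum_eq_card:
  assumes "distinct os" "\<And>B. B \<in> set os \<Longrightarrow> 0 < card B"
  shows "prod_series (map (\<lambda>B. power_sum (card B)) os) M =
    (of_nat (card {g \<in> set os \<rightarrow>\<^sub>E {0<..}. (\<Sum>B\<in>set os. replicate_mset (card B) (g B)) = M}) :: 'a::comm_semiring_1)"
  using assms
proof (induction os arbitrary: M)
  case Nil
  have "{g \<in> {} \<rightarrow>\<^sub>E {0::nat<..}. {#} = M} = (if M = {#} then {\<lambda>_. undefined} else {})" by auto
  then show ?case by (auto simp: prod_series_def one_series_def)
next
  case (Cons B os)
  have B: "B \<notin> set os" "0 < card B" using Cons.prems by auto
  define G where "G A M = {g \<in> A \<rightarrow>\<^sub>E {0<..}. (\<Sum>B\<in>A. replicate_mset (card B) (g B)) = M}"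
    for A :: "'b set set" and M :: "nat multiset"
  have fin: "finite (G (set os) M)" for M
    unfolding G_def using Cons.prems by (intro finite_PiE_sum_replicate_mset) auto
  define I where "I = {i. 0 < i \<and> replicate_mset (card B) i \<subseteq># M}"
  have "I \<subseteq> set_mset M"
    using B(2) by (auto simp: I_def dest!: set_mset_mono)
  then have finI: "finite I" using finite_subset by blast
  have "prod_series (map (\<lambda>B. power_sum (card B)) (B # os)) M =
      (\<Sum>A | A \<subseteq># M. of_bool (\<exists>i>0. A = replicate_mset (card B) i) * of_nat (card (G (set os) (M - A))) :: 'a)"
  proof -
    have "prod_series (map (\<lambda>B. power_sum (card B)) os) N = (of_nat (card (G (set os) N)) :: 'a)" for N
      unfolding G_def using Cons.prems by (intro Cons.IH) auto
    then show ?thesis by (simp add: prod_series_def times_series_def power_sum_def)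
  qed
  \<comment> \<open>Only a pure power of one variable can come from the factor of
    \<open>B\<close>.\<close>
  also have "\<dots> = (\<Sum>A\<in>replicate_mset (card B) ` I. of_nat (card (G (set os) (M - A))))"
  proof (rule sum.mono_neutral_cong_right)
    show "replicate_mset (card B) ` I \<subseteq> {A. A \<subseteq># M}" by (auto simp: I_def)
    show "\<forall>A\<in>{A. A \<subseteq># M} - replicate_mset (card B) ` I.
        of_bool (\<exists>i>0. A = replicate_mset (card B) i) * of_nat (card (G (set os) (M - A))) = (0 :: 'a)"
    proof
      fix A assume A: "A \<in> {A. A \<subseteq># M} - replicate_mset (card B) ` I"
      have "\<not> (\<exists>i>0. A = replicate_mset (card B) i)"
      proof
        assume "\<exists>i>0. A = replicate_mset (card B) i"
        then obtain i where "0 < i" "A = replicate_mset (card B) i" by blast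
        with A show False by (auto simp: I_def)
      qed
      then show "of_bool (\<exists>i>0. A = replicate_mset (card B) i) * of_nat (card (G (set os) (M - A))) = (0 :: 'a)"
        by (simp only: of_bool_eq mult_zero_left)
    qed
    show "of_bool (\<exists>i>0. A = replicate_mset (card B) i) * of_nat (card (G (set os) (M - A))) =
        (of_nat (card (G (set os) (M - A))) :: 'a)" if "A \<in> replicate_mset (card B) ` I" for A
    proof -
      have "\<exists>i>0. A = replicate_mset (card B) i" using that by (auto simp: I_def)
      then show ?thesis by (simp only: of_bool_eq mult_1_left)
    qed
  qed (rule finite_sub_multisets)
  also have "\<dots> = (\<Sum>i\<in>I. of_nat (card (G (set os) (M - replicate_mset (card B) i))))"
    by (subst sum.reindex) (auto simp: inj_on_def replicate_mset_inject_index[OF B(2)])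
  also have "\<dots> = of_nat (card (SIGMA i:I. G (set os) (M - replicate_mset (card B) i)))"
    using finI fin by (subst card_SigmaI) auto
  also have "card (SIGMA i:I. G (set os) (M - replicate_mset (card B) i)) = card (G (set (B # os)) M)"
  proof (rule bij_betw_same_card[OF bij_betw_byWitness[where f = "\<lambda>(i, g). g(B := i)"
          and f' = "\<lambda>g. (g B, g(B := undefined))"]])
    have upd: "(\<Sum>C\<in>set os. replicate_mset (card C) ((g(B := i)) C)) = (\<Sum>C\<in>set os. replicate_mset (card C) (g C))" for g i
      using B(1) by (intro sum.cong) auto
    show "\<forall>a\<in>SIGMA i:I. G (set os) (M - replicate_mset (card B) i).
        (case (case a of (i, g) \<Rightarrow> g(B := i)) of g \<Rightarrow> (g B, g(B := undefined))) = a"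
      using B(1) by (auto simp: G_def PiE_def extensional_def)
    show "\<forall>g\<in>G (set (B # os)) M. (case (g B, g(B := undefined)) of (i, g) \<Rightarrow> g(B := i)) = g"
      by auto
    show "(\<lambda>(i, g). g(B := i)) ` (SIGMA i:I. G (set os) (M - replicate_mset (card B) i)) \<subseteq> G (set (B # os)) M"
    proof (intro subsetI, elim imageE SigmaE)
      fix z y i g assume z: "z = (case y of (i, g) \<Rightarrow> g(B := i))" "y = (i, g)"
        and i: "i \<in> I" and g: "g \<in> G (set os) (M - replicate_mset (card B) i)"
      have "g(B := i) \<in> insert B (set os) \<rightarrow>\<^sub>E {0<..}"
        using i g by (intro PiE_fun_upd) (auto simp: G_def I_def)
      moreover have "(\<Sum>C\<in>set (B # os). replicate_mset (card C) ((g(B := i)) C)) =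
          replicate_mset (card B) i + (\<Sum>C\<in>set os. replicate_mset (card C) (g C))"
        using B(1) upd[of g i] by simp
      moreover have "replicate_mset (card B) i + (M - replicate_mset (card B) i) = M"
        using i by (simp add: I_def)
      ultimately show "z \<in> G (set (B # os)) M" using z g by (simp add: G_def)
    qed
    show "(\<lambda>g. (g B, g(B := undefined))) ` G (set (B # os)) M
        \<subseteq> (SIGMA i:I. G (set os) (M - replicate_mset (card B) i))"
    proof (intro subsetI, elim imageE)
      fix z g assume z: "z = (g B, g(B := undefined))" and g: "g \<in> G (set (B # os)) M"
      then have sum: "replicate_mset (card B) (g B) + (\<Sum>C\<in>set os. replicate_mset (card C) (g C)) = M"
        using B(1) by (simp add: G_def)
      have "g B \<in> I" using g sum by (auto simp: I_def G_def)
      moreover have "g(B := undefined) \<in> G (set os) (M - replicate_mset (card B) (g B))"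
      proof -
        have "g(B := undefined) \<in> set os \<rightarrow>\<^sub>E {0<..}"
          using g by (intro fun_upd_in_PiE[OF B(1)]) (simp add: G_def)
        with sum[symmetric] upd[of g undefined] show ?thesis by (simp add: G_def)
      qed
      ultimately show "z \<in> (SIGMA i:I. G (set os) (M - replicate_mset (card B) i))" using z by simp
    qed
  qed
  finally show ?case by (simp add: G_def)
qed

text \<open>The labelings of \<open>{1..n}\<close> by variables with monomial \<open>M\<close>;
  extensional, so that each is counted once.\<close>

definition words_of_content :: "nat \<Rightarrow> nat multiset \<Rightarrow> (nat \<Rightarrow> nat) set" where
  "words_of_content n M = {f \<in> {1..n} \<rightarrow>\<^sub>E {0<..}. image_mset f (mset_set {1..n}) = M}"

lemma finite_words_of_content: "finite (words_of_content n M)"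
proof (rule finite_subset)
  show "words_of_content n M \<subseteq> {1..n} \<rightarrow>\<^sub>E set_mset M"
    by (auto simp: words_of_content_def)
  show "finite ({1..n} \<rightarrow>\<^sub>E set_mset M)" by (intro finite_PiE) auto
qed

text \<open>A labeling fixed by \<open>\<sigma>\<close> is constant on cycles and so amounts to a
  choice of one variable per cycle; a cycle of length k contributes the k-th power of its
  variable.\<close>

lemma p_partition_cycle_type:
  assumes \<sigma>: "\<sigma> permutes {1..n}"
  shows "p_partition (cycle_type n \<sigma>) M =
    (of_nat (card {f \<in> words_of_content n M. \<forall>i\<in>{1..n}. f (\<sigma> i) = f i}) :: 'a::comm_semiring_1)"
proof -
  define \<O> where "\<O> = Orbits.orbit \<sigma> ` {1..n}"
  have perm: "permutation \<sigma>" using \<sigma> by (auto simp: permutation_permutes)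
  have self: "i \<in> Orbits.orbit \<sigma> i" for i
    by (rule permutation_self_in_orbit[OF perm])
  have cyc: "Orbits.orbit \<sigma> i = Orbits.orbit \<sigma> j" if "i \<in> Orbits.orbit \<sigma> j" for i j
    using orbit_cyclic_eq3[OF cyclic_on_orbit'[OF perm] that] .
  have sub: "Orbits.orbit \<sigma> i \<subseteq> {1..n}" if "i \<in> {1..n}" for i
    by (rule permutes_orbit_subset[OF \<sigma> that])
  have \<O>: "finite \<O>" "\<And>B. B \<in> \<O> \<Longrightarrow> finite B \<and> B \<noteq> {} \<and> B \<subseteq> {1..n}"
  proof -
    show "finite \<O>" by (simp add: \<O>_def)
    fix B assume "B \<in> \<O>"
    then obtain i where "i \<in> {1..n}" "B = Orbits.orbit \<sigma> i" by (auto simp: \<O>_def)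
    with self[of i] sub[of i] show "finite B \<and> B \<noteq> {} \<and> B \<subseteq> {1..n}"
      by (metis empty_iff finite_atLeastAtMost finite_subset)
  qed
  have disj: "disjoint \<O>"
  proof (rule disjointI)
    fix a b assume "a \<in> \<O>" "b \<in> \<O>" "a \<noteq> b"
    then obtain i j where "a = Orbits.orbit \<sigma> i" "b = Orbits.orbit \<sigma> j" by (auto simp: \<O>_def)
    with \<open>a \<noteq> b\<close> show "a \<inter> b = {}" using cyc by blast
  qed
  have Un: "\<Union>\<O> = {1..n}" using self sub unfolding \<O>_def by blast
  obtain os where os: "distinct os" "set os = \<O>"
    "p_partition (image_mset card (mset_set \<O>)) = prod_series (map (\<lambda>B. power_sum (card B) :: 'a series) os)"
    using p_partition_eq_prod[OF \<O>(1), where ?'a = 'a] by metis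
  \<comment> \<open>A chosen element of each cycle turns a labeling of points back into a labeling
    of cycles.\<close>
  have some: "(SOME i. i \<in> B) \<in> B" "(SOME i. i \<in> B) \<in> {1..n}" "Orbits.orbit \<sigma> (SOME i. i \<in> B) = B"
    if "B \<in> \<O>" for B
  proof -
    show in_B: "(SOME i. i \<in> B) \<in> B" using \<O>(2)[OF that] by (simp add: some_in_eq)
    then show "(SOME i. i \<in> B) \<in> {1..n}" using \<O>(2)[OF that] by blast
    from that obtain j where "B = Orbits.orbit \<sigma> j" by (auto simp: \<O>_def)
    with in_B cyc show "Orbits.orbit \<sigma> (SOME i. i \<in> B) = B" by metis
  qed
  have const: "f j = f i" if "\<forall>i\<in>{1..n}. f (\<sigma> i) = f i" "j \<in> Orbits.orbit \<sigma> i" "i \<in> {1..n}"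
    for f :: "nat \<Rightarrow> nat" and i j
    using that(2)
  proof induction
    case base
    show ?case using that by simp
  next
    case (step j)
    with sub[OF that(3)] that(1) have "f (\<sigma> j) = f j" by blast
    with step.IH show ?case by simp
  qed
  define G where "G = {g \<in> \<O> \<rightarrow>\<^sub>E {0<..}. (\<Sum>B\<in>\<O>. replicate_mset (card B) (g B)) = M}"
  have "p_partition (cycle_type n \<sigma>) M = (of_nat (card G) :: 'a)"
    unfolding cycle_type_def \<O>_def[symmetric] os(3) G_def
    using prod_power_sum_eq_card[where os = os and M = M] os(1,2) \<O>(2) by (simp add: card_gt_0_iff)
  also have "card G = card {f \<in> words_of_content n M. \<forall>i\<in>{1..n}. f (\<sigma> i) = f i}"
  proof (rule bij_betw_same_card[OF bij_betw_byWitness[where f = "\<lambda>g. \<lambda>i\<in>{1..n}. g (Orbits.orbit \<sigma> i)"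
          and f' = "\<lambda>f. \<lambda>B\<in>\<O>. f (SOME i. i \<in> B)"]])
    have content: "image_mset f (mset_set {1..n}) = (\<Sum>B\<in>\<O>. replicate_mset (card B) (g B))"
      if eq: "\<And>i. i \<in> {1..n} \<Longrightarrow> f i = g (Orbits.orbit \<sigma> i)" for f g :: "_ \<Rightarrow> nat"
    proof -
      have "image_mset f (mset_set {1..n}) = (\<Sum>i\<in>\<Union>\<O>. {#f i#})"
        by (simp add: Un sum_unfold_sum_mset)
      also have "\<dots> = (\<Sum>B\<in>\<O>. \<Sum>i\<in>B. {#f i#})"
        using \<O> disj by (subst sum.Union_disjoint) (auto simp: disjoint_def)
      also have "\<dots> = (\<Sum>B\<in>\<O>. replicate_mset (card B) (g B))"
      proof (rule sum.cong)
        fix B assume B: "B \<in> \<O>"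
        then obtain j where j: "B = Orbits.orbit \<sigma> j" by (auto simp: \<O>_def)
        have "f i = g B" if "i \<in> B" for i
        proof -
          have "f i = g (Orbits.orbit \<sigma> i)" using that \<O>(2)[OF B] by (intro eq) blast
          also have "Orbits.orbit \<sigma> i = B" using cyc[of i j] that j by simp
          finally show ?thesis .
        qed
        then have "(\<Sum>i\<in>B. {#f i#}) = (\<Sum>i\<in>B. {#g B#})" by simp
        also have "\<dots> = replicate_mset (card B) (g B)"
        proof -
          have "(\<Sum>i\<in>C. {#g B#}) = replicate_mset (card C) (g B)" if "finite C" for C :: "nat set"
            using that by (induction C rule: finite_induct) auto
          then show ?thesis using \<O>(2)[OF B] by blast
        qed
        finally show "(\<Sum>i\<in>B. {#f i#}) = replicate_mset (card B) (g B)" .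
      qed simp
      finally show ?thesis .
    qed
    show "\<forall>g\<in>G. (\<lambda>f. \<lambda>B\<in>\<O>. f (SOME i. i \<in> B)) (\<lambda>i\<in>{1..n}. g (Orbits.orbit \<sigma> i)) = g"
    proof (intro ballI ext)
      fix g B assume g: "g \<in> G"
      show "(\<lambda>B\<in>\<O>. (\<lambda>i\<in>{1..n}. g (Orbits.orbit \<sigma> i)) (SOME i. i \<in> B)) B = g B"
        using g some[of B] PiE_arb[of g \<O> "\<lambda>_. {0<..}" B] by (cases "B \<in> \<O>") (simp_all add: G_def)
    qed
    show "\<forall>f\<in>{f \<in> words_of_content n M. \<forall>i\<in>{1..n}. f (\<sigma> i) = f i}.
        (\<lambda>i\<in>{1..n}. (\<lambda>B\<in>\<O>. f (SOME i. i \<in> B)) (Orbits.orbit \<sigma> i)) = f"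
    proof (intro ballI ext)
      fix f i assume f: "f \<in> {f \<in> words_of_content n M. \<forall>i\<in>{1..n}. f (\<sigma> i) = f i}"
      show "(\<lambda>i\<in>{1..n}. (\<lambda>B\<in>\<O>. f (SOME i. i \<in> B)) (Orbits.orbit \<sigma> i)) i = f i"
      proof (cases "i \<in> {1..n}")
        case True
        then have O: "Orbits.orbit \<sigma> i \<in> \<O>" by (simp add: \<O>_def)
        have "f (SOME j. j \<in> Orbits.orbit \<sigma> i) = f i"
          using f by (intro const[OF _ some(1)[OF O] True]) simp
        with True O show ?thesis by simp
      next
        case False
        with f show ?thesis
          using PiE_arb[of f "{1..n}" "\<lambda>_. {0<..}" i] by (auto simp: words_of_content_def)
      qed
    qed
    show "(\<lambda>g. \<lambda>i\<in>{1..n}. g (Orbits.orbit \<sigma> i)) ` G \<subseteq> {f \<in> words_of_content n M. \<forall>i\<in>{1..n}. f (\<sigma> i) = f i}"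
    proof (intro subsetI, elim imageE)
      fix f g assume f: "f = (\<lambda>i\<in>{1..n}. g (Orbits.orbit \<sigma> i))" and g: "g \<in> G"
      have "image_mset f (mset_set {1..n}) = M"
        using content[of f g] f g by (simp add: G_def)
      moreover have "f \<in> {1..n} \<rightarrow>\<^sub>E {0<..}"
        unfolding f using g by (intro PiE_I) (auto simp: G_def \<O>_def)
      moreover have "f (\<sigma> i) = f i" if "i \<in> {1..n}" for i
        using cyc[OF orbit.base[of \<sigma> i]] that permutes_in_image[OF \<sigma>, of i] by (simp add: f)
      ultimately show "f \<in> {f \<in> words_of_content n M. \<forall>i\<in>{1..n}. f (\<sigma> i) = f i}"
        by (simp add: words_of_content_def)
    qed
    show "(\<lambda>f. \<lambda>B\<in>\<O>. f (SOME i. i \<in> B)) ` {f \<in> words_of_content n M. \<forall>i\<in>{1..n}. f (\<sigma> i) = f i} \<subseteq> G"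
    proof (intro subsetI, elim imageE)
      fix f g assume g: "g = (\<lambda>B\<in>\<O>. f (SOME i. i \<in> B))"
        and f: "f \<in> {f \<in> words_of_content n M. \<forall>i\<in>{1..n}. f (\<sigma> i) = f i}"
      have "f i = g (Orbits.orbit \<sigma> i)" if i: "i \<in> {1..n}" for i
      proof -
        have O: "Orbits.orbit \<sigma> i \<in> \<O>" using i by (simp add: \<O>_def)
        have "f (SOME j. j \<in> Orbits.orbit \<sigma> i) = f i"
          using f by (intro const[OF _ some(1)[OF O] i]) simp
        with O g show ?thesis by simp
      qed
      then have "(\<Sum>B\<in>\<O>. replicate_mset (card B) (g B)) = M"
        using content[of f g] f by (simp add: words_of_content_def)
      moreover have "g \<in> \<O> \<rightarrow>\<^sub>E {0<..}"
        unfolding g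
      proof (intro PiE_I)
        fix B assume "B \<in> \<O>"
        then show "(\<lambda>B\<in>\<O>. f (SOME i. i \<in> B)) B \<in> {0<..}"
          using f PiE_mem[of f "{1..n}" "\<lambda>_. {0<..}", OF _ some(2)] by (simp add: words_of_content_def)
      qed simp
      ultimately show "g \<in> G" by (simp add: G_def)
    qed
  qed
  finally show ?thesis .
qed

section \<open>Orbits of labeled Bernardi trees\<close>

lemma preorder_word_map_tree: "preorder_word (map_tree f T) = map f (preorder_word T)"
  by (induction T) auto

lemma drift_less_size: "(d, v) \<in> set (drift_list T) \<Longrightarrow> d < size T"
  by (induction T arbitrary: d) force+

text \<open>\<open>drift_list\<close> embeds these trees into the lists of length \<open>n\<close>
  over a finite alphabet, since drifts stay below the size.\<close>

lemma finite_trees: "finite A \<Longrightarrow> finite {T. size T = n \<and> set_tree T \<subseteq> A}"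
proof -
  assume A: "finite A"
  have "drift_list ` {T. size T = n \<and> set_tree T \<subseteq> A} \<subseteq> {xs. set xs \<subseteq> {..<n} \<times> A \<and> length xs = n}"
    using drift_less_size snd_drift_list_in_set_tree by fastforce
  moreover have "finite {xs. set xs \<subseteq> {..<n} \<times> A \<and> length xs = n}"
    using A by (intro finite_lists_length_eq) auto
  moreover have "inj_on drift_list {T. size T = n \<and> set_tree T \<subseteq> A}"
    by (auto simp: inj_on_def drift_list_inject)
  ultimately show ?thesis using finite_subset finite_imageD by blast
qed

lemma finite_bernardi_trees: "finite (bernardi_trees n)"
  by (rule finite_subset[OF _ finite_trees[of "{1..n}" n]]) (auto simp: bernardi_trees_def)

text \<open>The inverse permutation supplies the inverse map, so closure, identity and composition
  already give bijections; \<open>restrict\<close> makes them elements of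
  \<open>BijGroup\<close>.\<close>

lemma group_action_sym_groupI:
  assumes closed: "\<And>\<sigma> x. \<sigma> permutes {1..n} \<Longrightarrow> x \<in> E \<Longrightarrow> act \<sigma> x \<in> E"
    and id: "\<And>x. x \<in> E \<Longrightarrow> act id x = x"
    and comp: "\<And>\<sigma> \<tau> x. \<sigma> permutes {1..n} \<Longrightarrow> \<tau> permutes {1..n} \<Longrightarrow> x \<in> E \<Longrightarrow>
      act (\<sigma> \<circ> \<tau>) x = act \<sigma> (act \<tau> x)"
  shows "group_action (sym_group n) E (\<lambda>\<sigma>. restrict (act \<sigma>) E)"
proof -
  have bij: "restrict (act \<sigma>) E \<in> Bij E" if \<sigma>: "\<sigma> permutes {1..n}" for \<sigma>
  proof -
    note inv = permutes_inv[OF \<sigma>]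
    have "bij_betw (act \<sigma>) E E"
    proof (rule bij_betw_byWitness[where f' = "act (inv_into UNIV \<sigma>)"])
      show "\<forall>x\<in>E. act (inv_into UNIV \<sigma>) (act \<sigma> x) = x"
        using comp[OF inv \<sigma>] id permutes_inv_o(2)[OF \<sigma>] by simp
      show "\<forall>x\<in>E. act \<sigma> (act (inv_into UNIV \<sigma>) x) = x"
        using comp[OF \<sigma> inv] id permutes_inv_o(1)[OF \<sigma>] by simp
    qed (use closed \<sigma> inv in auto)
    then show ?thesis by (simp add: Bij_def bij_betw_cong[of E "restrict (act \<sigma>) E" "act \<sigma>"])
  qed
  have "(\<lambda>\<sigma>. restrict (act \<sigma>) E) \<in> hom (sym_group n) (BijGroup E)"
  proof (rule homI)
    fix \<sigma> \<tau> assume "\<sigma> \<in> carrier (sym_group n)" "\<tau> \<in> carrier (sym_group n)"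
    then have st: "\<sigma> permutes {1..n}" "\<tau> permutes {1..n}" by (auto simp: sym_group_def)
    then show "restrict (act (\<sigma> \<otimes>\<^bsub>sym_group n\<^esub> \<tau>)) E =
        restrict (act \<sigma>) E \<otimes>\<^bsub>BijGroup E\<^esub> restrict (act \<tau>) E"
      using bij comp closed by (auto simp: BijGroup_def sym_group_def compose_def restrict_def)
  qed (use bij in \<open>auto simp: BijGroup_def sym_group_def\<close>)
  then show ?thesis
    unfolding group_action_def group_hom_def group_hom_axioms_def
    by (simp add: sym_group_is_group group_BijGroup)
qed

lemma bernardi_group_action: "group_action (sym_group n) (bernardi_trees n) (bernardi_action n)"
  unfolding bernardi_action_def
  by (rule group_action_sym_groupI)
    (simp_all add: act_tree_in_bernardi_trees act_tree_id_bernardi act_tree_comp)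

lemma bernardi_graded_action: "graded_action n (bernardi_trees n) right_edges (bernardi_action n)"
  unfolding graded_action_def
  using bernardi_group_action by (auto simp: bernardi_action_def)

text \<open>The semistandard counterpart of Bernardi trees. They will be exactly the trees
  \<open>act_tree f T\<close> with \<open>T\<close> a Bernardi tree and \<open>f\<close> a labeling
  of content \<open>M\<close>.\<close>

definition weakly_decreasing_trees :: "nat \<Rightarrow> nat multiset \<Rightarrow> nat tree set" where
  "weakly_decreasing_trees n M = {T. size T = n \<and> mset (preorder_word T) = M \<and> 0 \<notin># M \<and>
     (\<forall>W\<in>set (tree_blocks T). sorted_wrt (\<ge>) W)}"

lemma set_tree_bernardi: "T \<in> bernardi_trees n \<Longrightarrow> set_tree T = {1..n}"
  by (simp add: bernardi_trees_def)

lemma mset_map_eq_imp_ex_rearrangement: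
  assumes "mset (map f W) = mset (map g W')"
  obtains V where "mset V = mset W'" "map g V = map f W"
proof -
  obtain p where p: "p permutes {..<length (map g W')}" "permute_list p (map g W') = map f W"
    using mset_eq_permutation[OF assms] .
  then have "map g (permute_list p W') = map f W"
    by (simp add: permute_list_map)
  moreover have "mset (permute_list p W') = mset W'"
    using p(1) by (intro mset_permute_list) simp
  ultimately show ?thesis using that by blast
qed

text \<open>Equality of the sorted images says that corresponding blocks have the same multiset of
  values under \<open>f\<close> and \<open>g\<close>. Each block of \<open>T'\<close> can be
  rearranged so that the values match letter by letter; reading both words in parallel then defines
  \<open>\<sigma>\<close>.\<close>

lemma act_tree_eq_imp_same_orbit:
  assumes T: "T \<in> bernardi_trees n" and T': "T' \<in> bernardi_trees n"
    and eq: "act_tree f T = act_tree g T'"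
  obtains \<sigma> where "\<sigma> permutes {1..n}" "act_tree \<sigma> T = T'" "\<And>i. i \<in> {1..n} \<Longrightarrow> g (\<sigma> i) = f i"
proof -
  let ?ws = "tree_blocks T" and ?ws' = "tree_blocks T'"
  have shape: "shape T = shape T'" using arg_cong[OF eq, of shape] by simp
  have blocks: "map (act_word f) ?ws = map (act_word g) ?ws'"
    using arg_cong[OF eq, of tree_blocks] by (simp add: tree_blocks_act_tree)
  have len: "length ?ws = length ?ws'" using arg_cong[OF blocks, of length] by simp
  have "\<exists>V. mset V = mset (?ws' ! j) \<and> map g V = map f (?ws ! j)" if "j < length ?ws" for j
  proof -
    have "act_word f (?ws ! j) = act_word g (?ws' ! j)"
      using arg_cong[OF blocks, of "\<lambda>xs. xs ! j"] that len by simp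
    from arg_cong[OF this, of mset] have "mset (map f (?ws ! j)) = mset (map g (?ws' ! j))" by simp
    then show ?thesis by (rule mset_map_eq_imp_ex_rearrangement) blast
  qed
  then have "\<forall>j. \<exists>V. j < length ?ws \<longrightarrow> mset V = mset (?ws' ! j) \<and> map g V = map f (?ws ! j)"
    by blast
  from choice[OF this] obtain V
    where V: "\<And>j. j < length ?ws \<Longrightarrow> mset (V j) = mset (?ws' ! j) \<and> map g (V j) = map f (?ws ! j)"
    by blast
  define vs where "vs = map V [0..<length ?ws]"
  have vs: "length vs = length ?ws" "map mset vs = map mset ?ws'" "map (map g) vs = map (map f) ?ws"
  proof -
    show "length vs = length ?ws" by (simp add: vs_def)
    show "map mset vs = map mset ?ws'"
      by (rule nth_equalityI) (simp_all add: vs_def V len)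
    show "map (map g) vs = map (map f) ?ws"
      by (rule nth_equalityI) (simp_all add: vs_def V)
  qed
  have lens: "map length vs = map length ?ws"
    using arg_cong[OF vs(3), of "map length"] by (simp add: comp_def)
  let ?u = "preorder_word T" and ?v = "concat vs"
  have mv: "mset ?v = mset (preorder_word T')"
    using vs(2) by (metis concat_tree_blocks mset_concat)
  have n: "length ?u = n" "distinct ?u" "set ?u = {1..n}" using T by (auto simp: bernardi_trees_def)
  have v: "length ?v = n" "distinct ?v" "set ?v = {1..n}"
  proof -
    show "length ?v = n"
      using mset_eq_length[OF mv] T' by (simp add: bernardi_trees_def)
    show "distinct ?v"
      using mset_eq_imp_distinct_iff[OF mv] T' by (simp add: bernardi_trees_def)
    show "set ?v = {1..n}"
      using mset_eq_setD[OF mv] T' by (simp add: bernardi_trees_def)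
  qed
  \<comment> \<open>The letter of \<open>T\<close> at each position goes to the letter of the
    rearranged word at the same position.\<close>
  define \<sigma> where "\<sigma> i = (if i \<in> {1..n} then the (map_of (zip ?u ?v) i) else i)" for i
  have \<sigma>_nth: "\<sigma> (?u ! k) = ?v ! k" if "k < n" for k
  proof -
    have "map_of (zip ?u ?v) (?u ! k) = Some (?v ! k)"
      using n v that by (intro map_of_zip_nth) auto
    moreover have "?u ! k \<in> {1..n}" using n that nth_mem by blast
    ultimately show ?thesis by (simp add: \<sigma>_def)
  qed
  then have "map \<sigma> ?u = ?v" using n v by (intro nth_equalityI) auto
  have "\<sigma> permutes {1..n}"
  proof (rule bij_imp_permutes)
    have "\<sigma> ` {1..n} = {1..n}"
      using \<open>map \<sigma> ?u = ?v\<close> n(3) v(3) by (metis list.set_map)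
    moreover from this have "inj_on \<sigma> {1..n}" by (intro eq_card_imp_inj_on) auto
    ultimately show "bij_betw \<sigma> {1..n} {1..n}" by (simp add: bij_betw_def)
  qed (auto simp: \<sigma>_def)
  moreover have map_blocks: "map (map \<sigma>) ?ws = vs"
  proof -
    have "concat (map (map \<sigma>) ?ws) = concat vs"
      using \<open>map \<sigma> ?u = ?v\<close> by (metis concat_tree_blocks map_concat)
    moreover have "map length (map (map \<sigma>) ?ws) = map length vs"
      using lens by (simp add: comp_def)
    ultimately show ?thesis by (metis factor_word_concat)
  qed
  moreover have "act_tree \<sigma> T = T'"
  proof (rule tree_eqI_blocks)
    show "tree_blocks (act_tree \<sigma> T) = ?ws'"
    proof (rule nth_equalityI)
      fix j assume "j < length (tree_blocks (act_tree \<sigma> T))"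
      then have j: "j < length ?ws" by (simp add: tree_blocks_act_tree)
      \<comment> \<open>Sorting undoes the rearrangement, because the blocks of \<open>T'\<close>
        are decreasing.\<close>
      have "act_word \<sigma> (?ws ! j) = ?ws' ! j"
      proof (rule act_word_eqI)
        have "sorted_wrt (>) (?ws' ! j)"
          using T' j len by (simp add: bernardi_trees_iff)
        then show "sorted_wrt (\<ge>) (?ws' ! j)" by (rule sorted_wrt_greater_imp_ge)
        have "map \<sigma> (?ws ! j) = V j"
          using arg_cong[OF map_blocks, of "\<lambda>xs. xs ! j"] j by (simp add: vs_def)
        with V[OF j] show "mset (?ws' ! j) = image_mset \<sigma> (mset (?ws ! j))" by (metis mset_map)
      qed
      with j show "tree_blocks (act_tree \<sigma> T) ! j = ?ws' ! j" by (simp add: tree_blocks_act_tree)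
    qed (simp add: tree_blocks_act_tree len)
  qed (simp add: shape)
  moreover have "g (\<sigma> i) = f i" if i: "i \<in> {1..n}" for i
  proof -
    obtain k where k: "k < n" "?u ! k = i" using n i by (metis in_set_conv_nth)
    have "map g ?v = map f ?u"
      using vs(3) by (metis concat_tree_blocks map_concat)
    from arg_cong[OF this, of "\<lambda>xs. xs ! k"] show ?thesis
      using k n v \<sigma>_nth[of k] by simp
  qed
  ultimately show ?thesis using that by blast
qed

lemma sorted_wrt_concatD: "sorted_wrt R (concat ws) \<Longrightarrow> W \<in> set ws \<Longrightarrow> sorted_wrt R W"
  by (induction ws) (auto simp: sorted_wrt_append)

text \<open>Labeling the shape of \<open>Z\<close> by n, ..., 1 in preorder makes the whole word
  decreasing, hence every block. With \<open>f\<close> sending each new label to the old one, the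
  images of the blocks are those of \<open>Z\<close>, which are already sorted.\<close>

lemma ex_standardization:
  assumes Z: "Z \<in> weakly_decreasing_trees n M"
  obtains T f where "T \<in> bernardi_trees n" "f \<in> words_of_content n M" "act_tree f T = Z"
    "right_edges T = right_edges Z"
proof -
  let ?w = "preorder_word Z"
  have size: "size Z = n" and M: "mset ?w = M" "0 \<notin># M"
    and sorted: "\<And>W. W \<in> set (tree_blocks Z) \<Longrightarrow> sorted_wrt (\<ge>) W"
    using Z by (auto simp: weakly_decreasing_trees_def)
  obtain T where T: "shape T = shape Z" "preorder_word T = rev [1..<Suc n]"
  proof -
    have "length (rev [1..<Suc n]) = size Z" by (simp add: size del: upt_Suc)
    from ex_tree_preorder_word[OF this] show ?thesis using that by blast
  qed
  \<comment> \<open>The label \<open>i\<close> stands at preorder position \<open>n - i\<close>,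
    counted from 0.\<close>
  define f where "f = (\<lambda>i\<in>{1..n}. ?w ! (n - i))"
  have "map f (rev [1..<Suc n]) = ?w"
    by (rule nth_equalityI) (auto simp: size f_def rev_nth simp del: upt_Suc)
  then have "preorder_word (map_tree f T) = ?w"
    by (simp only: preorder_word_map_tree T(2))
  moreover have "shape (map_tree f T) = shape Z"
    using T(1) by (simp add: tree.map_comp comp_def)
  ultimately have map_T: "map_tree f T = Z"
    by (rule tree_eqI[rotated])
  have "T \<in> bernardi_trees n"
  proof -
    have "sorted_wrt (>) (rev [1..<Suc n])" by (simp add: sorted_wrt_rev del: upt_Suc)
    then have "sorted_wrt (>) (concat (tree_blocks T))" using T(2) by (simp del: upt_Suc)
    then have "\<forall>W\<in>set (tree_blocks T). sorted_wrt (>) W" by (blast intro: sorted_wrt_concatD)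
    moreover have "mset (preorder_word T) = mset_set {1..n}"
      by (simp add: T(2) atLeastLessThanSuc_atLeastAtMost del: upt_Suc)
    ultimately show ?thesis by (simp add: bernardi_trees_iff)
  qed
  moreover have "f \<in> words_of_content n M"
  proof -
    have img: "image_mset f (mset_set {1..n}) = M"
      using arg_cong[OF \<open>map f (rev [1..<Suc n]) = ?w\<close>, of mset] M
      by (simp add: atLeastLessThanSuc_atLeastAtMost del: upt_Suc)
    moreover have "f i > 0" if "i \<in> {1..n}" for i
    proof -
      have "f i \<in># M" unfolding img[symmetric] using that by simp
      with M(2) show ?thesis by (metis gr0I)
    qed
    ultimately have "f \<in> {1..n} \<rightarrow>\<^sub>E {0<..}" by (intro PiE_I) (auto simp: f_def)
    with img show ?thesis by (simp add: words_of_content_def)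
  qed
  moreover have "act_tree f T = Z"
  proof (rule tree_eqI_blocks)
    have blocks: "tree_blocks Z = map (map f) (tree_blocks T)"
      using map_T tree_blocks_map_tree by metis
    have "act_word f W = map f W" if "W \<in> set (tree_blocks T)" for W
      using sorted that by (intro act_word_eqI) (auto simp: blocks)
    then show "tree_blocks (act_tree f T) = tree_blocks Z"
      by (simp add: tree_blocks_act_tree blocks)
  qed (simp add: T)
  moreover have "right_edges T = right_edges Z"
    using T(1) by (metis right_edges_map_tree)
  ultimately show ?thesis using that by blast
qed

section \<open>Counting orbits by Burnside's lemma\<close>

definition labeling_action :: "nat \<Rightarrow> (nat \<Rightarrow> nat) \<Rightarrow> nat tree \<times> (nat \<Rightarrow> nat) \<Rightarrow> nat tree \<times> (nat \<Rightarrow> nat)" where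
  "labeling_action n \<sigma> e = (act_tree \<sigma> (fst e), \<lambda>i\<in>{1..n}. snd e (inv_into UNIV \<sigma> i))"

lemma words_of_content_permute:
  assumes \<sigma>: "\<sigma> permutes {1..n}" and f: "f \<in> words_of_content n M"
  shows "(\<lambda>i\<in>{1..n}. f (inv_into UNIV \<sigma> i)) \<in> words_of_content n M"
proof -
  let ?i = "inv_into UNIV \<sigma>" and ?g = "\<lambda>i\<in>{1..n}. f (inv_into UNIV \<sigma> i)"
  have inv: "?i permutes {1..n}" by (rule permutes_inv[OF \<sigma>])
  have "image_mset ?g (mset_set {1..n}) = image_mset f (image_mset ?i (mset_set {1..n}))"
    by (auto simp: image_mset.compositionality intro!: image_mset_cong)
  also have "image_mset ?i (mset_set {1..n}) = mset_set {1..n}"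
    using inv by (simp add: image_mset_mset_set permutes_inj_on permutes_image)
  also have "image_mset f (mset_set {1..n}) = M"
    using f by (simp add: words_of_content_def)
  finally have "image_mset ?g (mset_set {1..n}) = M" .
  moreover have "?g \<in> {1..n} \<rightarrow>\<^sub>E {0<..}"
  proof (rule PiE_I)
    fix i assume "i \<in> {1..n}"
    then have "?i i \<in> {1..n}" using permutes_in_image[OF inv] by simp
    then have "f (?i i) \<in> {0<..}"
      using f PiE_mem[of f "{1..n}" "\<lambda>_. {0<..}" "?i i"] by (simp add: words_of_content_def)
    with \<open>i \<in> {1..n}\<close> show "?g i \<in> {0<..}" by simp
  qed auto
  ultimately show ?thesis by (simp add: words_of_content_def)
qed

lemma labeling_group_action:
  fixes n k M
  defines "E \<equiv> {T \<in> bernardi_trees n. right_edges T = k} \<times> words_of_content n M"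
  shows "group_action (sym_group n) E (\<lambda>\<sigma>. restrict (labeling_action n \<sigma>) E)"
proof (rule group_action_sym_groupI)
  fix \<sigma> e assume \<sigma>: "\<sigma> permutes {1..n}" and "e \<in> E"
  then have "fst e \<in> bernardi_trees n" "right_edges (fst e) = k" "snd e \<in> words_of_content n M"
    by (auto simp: E_def)
  with act_tree_in_bernardi_trees[OF _ \<sigma>] words_of_content_permute[OF \<sigma>]
  show "labeling_action n \<sigma> e \<in> E"
    unfolding E_def labeling_action_def by (simp only: mem_Sigma_iff mem_Collect_eq right_edges_act_tree)
next
  fix e assume e: "e \<in> E"
  then have "(\<lambda>i\<in>{1..n}. snd e i) = snd e"
    by (auto simp: E_def words_of_content_def PiE_iff extensional_restrict)
  with e show "labeling_action n id e = e"
    by (auto simp: E_def labeling_action_def act_tree_id_bernardi inv_id prod_eq_iff)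
next
  fix \<sigma> \<tau> e assume \<sigma>: "\<sigma> permutes {1..n}" and \<tau>: "\<tau> permutes {1..n}" and "e \<in> E"
  have "inv_into UNIV (\<sigma> \<circ> \<tau>) = inv_into UNIV \<tau> \<circ> inv_into UNIV \<sigma>"
    using \<sigma> \<tau> by (intro o_inv_distrib permutes_bij)
  moreover have "inv_into UNIV \<sigma> i \<in> {1..n}" if "i \<in> {1..n}" for i
    using permutes_in_image[OF permutes_inv[OF \<sigma>]] that by simp
  ultimately show "labeling_action n (\<sigma> \<circ> \<tau>) e = labeling_action n \<sigma> (labeling_action n \<tau> e)"
    by (auto simp: labeling_action_def act_tree_comp fun_eq_iff)
qed

text \<open>The inverse permutation in the labeling cancels the permutation applied to the tree.
  Hence the relabeled tree is an invariant of the orbit.\<close>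

lemma act_tree_labeling_action:
  assumes \<sigma>: "\<sigma> permutes {1..n}" and T: "T \<in> bernardi_trees n"
  shows "act_tree (\<lambda>i\<in>{1..n}. f (inv_into UNIV \<sigma> i)) (act_tree \<sigma> T) = act_tree f T"
proof -
  have "act_tree (\<lambda>i\<in>{1..n}. f (inv_into UNIV \<sigma> i)) (act_tree \<sigma> T)
      = act_tree (f \<circ> inv_into UNIV \<sigma>) (act_tree \<sigma> T)"
    using set_tree_bernardi[OF act_tree_in_bernardi_trees[OF T \<sigma>]] by (intro act_tree_cong) simp
  also have "\<dots> = act_tree f T"
    by (simp add: act_tree_comp comp_assoc permutes_inv_o(2)[OF \<sigma>])
  finally show ?thesis .
qed

lemma act_tree_in_weakly_decreasing_trees:
  assumes "T \<in> bernardi_trees n" "f \<in> words_of_content n M"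
  shows "act_tree f T \<in> weakly_decreasing_trees n M"
proof -
  have "image_mset f (mset_set {1..n}) = M" "f \<in> {1..n} \<rightarrow>\<^sub>E {0<..}"
    using assms(2) by (auto simp: words_of_content_def)
  moreover from this have "0 \<notin># M" by (fastforce simp: PiE_iff)
  moreover have "size T = n" using assms(1) by (simp add: bernardi_trees_def)
  ultimately show ?thesis
    using assms(1) unfolding weakly_decreasing_trees_def
    by (auto simp: bernardi_trees_iff tree_blocks_act_tree sorted_wrt_act_word)
qed

text \<open>The map sending \<open>(T, f)\<close> to \<open>act_tree f T\<close> is constant on
  orbits, separates them and is onto, so the trees on the left count the orbits. A pair is fixed by
  a permutation exactly when both components are, whence the product.\<close>

lemma card_weakly_decreasing_trees_burnside:
  "card {Z \<in> weakly_decreasing_trees n M. right_edges Z = k} * fact n =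
     (\<Sum>\<sigma>\<in>carrier (sym_group n). card {T \<in> bernardi_trees n. right_edges T = k \<and> act_tree \<sigma> T = T} *
        card {f \<in> words_of_content n M. \<forall>i\<in>{1..n}. f (\<sigma> i) = f i})"
proof -
  define E where "E = {T \<in> bernardi_trees n. right_edges T = k} \<times> words_of_content n M"
  define \<phi> where "\<phi> \<sigma> = restrict (labeling_action n \<sigma>) E" for \<sigma>
  interpret group_action "sym_group n" E \<phi>
    unfolding \<phi>_def E_def by (rule labeling_group_action)
  define \<Phi> where "\<Phi> e = act_tree (snd e) (fst e)" for e :: "nat tree \<times> (nat \<Rightarrow> nat)"
  let ?W = "{Z \<in> weakly_decreasing_trees n M. right_edges Z = k}"
  have carrier: "carrier (sym_group n) = {\<sigma>. \<sigma> permutes {1..n}}" by (simp add: sym_group_def)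
  have order: "order (sym_group n) = fact n"
    unfolding order_def carrier by (rule card_permutations) simp_all
  have finE: "finite E"
    unfolding E_def using finite_bernardi_trees finite_words_of_content by auto
  have fibre: "orbit (sym_group n) \<phi> e = {e' \<in> E. \<Phi> e' = \<Phi> e}" if e: "e \<in> E" for e
  proof (intro equalityI subsetI)
    fix e' assume "e' \<in> orbit (sym_group n) \<phi> e"
    then obtain \<sigma> where \<sigma>: "\<sigma> \<in> carrier (sym_group n)" "e' = \<phi> \<sigma> e"
      unfolding orbit_def by blast
    then have "e' \<in> E" using element_image[OF \<sigma>(1) e] by simp
    moreover have "\<Phi> e' = \<Phi> e"
      using \<sigma> e act_tree_labeling_action[of \<sigma> n "fst e" "snd e"]
      by (auto simp: carrier \<phi>_def \<Phi>_def E_def labeling_action_def)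
    ultimately show "e' \<in> {e' \<in> E. \<Phi> e' = \<Phi> e}" by simp
  next
    fix e' assume "e' \<in> {e' \<in> E. \<Phi> e' = \<Phi> e}"
    then have e': "e' \<in> E" "act_tree (snd e) (fst e) = act_tree (snd e') (fst e')"
      by (simp_all add: \<Phi>_def)
    have "fst e \<in> bernardi_trees n" "fst e' \<in> bernardi_trees n" using e e'(1) by (auto simp: E_def)
    from act_tree_eq_imp_same_orbit[OF this e'(2)] obtain \<sigma> where
      \<sigma>: "\<sigma> permutes {1..n}" "act_tree \<sigma> (fst e) = fst e'"
        "\<And>i. i \<in> {1..n} \<Longrightarrow> snd e' (\<sigma> i) = snd e i" by blast
    have "(\<lambda>i\<in>{1..n}. snd e (inv_into UNIV \<sigma> i)) = snd e'"
    proof (rule ext)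
      fix i
      show "(\<lambda>i\<in>{1..n}. snd e (inv_into UNIV \<sigma> i)) i = snd e' i"
      proof (cases "i \<in> {1..n}")
        case True
        then have "inv_into UNIV \<sigma> i \<in> {1..n}"
          using permutes_in_image[OF permutes_inv[OF \<sigma>(1)]] by simp
        from \<sigma>(3)[OF this] show ?thesis
          using True permutes_inverses(1)[OF \<sigma>(1), of i] by simp
      next
        case False
        with e'(1) show ?thesis
          using PiE_arb[of "snd e'" "{1..n}" "\<lambda>_. {0<..}" i] by (auto simp: E_def words_of_content_def)
      qed
    qed
    then have "\<phi> \<sigma> e = e'"
      using e \<sigma>(2) by (simp add: \<phi>_def labeling_action_def)
    then show "e' \<in> orbit (sym_group n) \<phi> e"
      unfolding orbit_def carrier using \<sigma>(1) by blast
  qed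
  have "card ?W = card (orbits (sym_group n) E \<phi>)"
  proof (rule bij_betw_same_card[of "\<lambda>Z. {e \<in> E. \<Phi> e = Z}"])
    have \<Phi>_in: "\<Phi> e \<in> ?W" if "e \<in> E" for e
      using that act_tree_in_weakly_decreasing_trees by (auto simp: E_def \<Phi>_def)
    have surj: "\<exists>e\<in>E. \<Phi> e = Z" if "Z \<in> ?W" for Z
    proof -
      from that have "Z \<in> weakly_decreasing_trees n M" by simp
      from ex_standardization[OF this] obtain T f where "T \<in> bernardi_trees n"
        "f \<in> words_of_content n M" "act_tree f T = Z" "right_edges T = right_edges Z" .
      with that show ?thesis by (intro bexI[of _ "(T, f)"]) (auto simp: E_def \<Phi>_def)
    qed
    show "bij_betw (\<lambda>Z. {e \<in> E. \<Phi> e = Z}) ?W (orbits (sym_group n) E \<phi>)"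
    proof (rule bij_betwI')
      fix Z Z' assume "Z \<in> ?W" "Z' \<in> ?W"
      then show "{e \<in> E. \<Phi> e = Z} = {e \<in> E. \<Phi> e = Z'} \<longleftrightarrow> Z = Z'"
        using surj[of Z] by blast
    next
      fix Z assume "Z \<in> ?W"
      with surj obtain e where "e \<in> E" "\<Phi> e = Z" by blast
      with fibre[of e] show "{e \<in> E. \<Phi> e = Z} \<in> orbits (sym_group n) E \<phi>"
        unfolding orbits_def by blast
    next
      fix \<O> assume "\<O> \<in> orbits (sym_group n) E \<phi>"
      then obtain e where "e \<in> E" "\<O> = orbit (sym_group n) \<phi> e" unfolding orbits_def by blast
      with fibre[of e] \<Phi>_in[of e] show "\<exists>Z\<in>?W. \<O> = {e \<in> E. \<Phi> e = Z}" by blast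
    qed
  qed
  moreover have "finite (carrier (sym_group n))"
    unfolding carrier by (simp add: finite_permutations)
  ultimately have "card ?W * fact n = (\<Sum>\<sigma>\<in>carrier (sym_group n). card (invariants E \<phi> \<sigma>))"
    using burnside finE order by simp
  also have "\<dots> = (\<Sum>\<sigma>\<in>carrier (sym_group n). card {T \<in> bernardi_trees n. right_edges T = k \<and> act_tree \<sigma> T = T} *
        card {f \<in> words_of_content n M. \<forall>i\<in>{1..n}. f (\<sigma> i) = f i})"
  proof (rule sum.cong)
    fix \<sigma> assume "\<sigma> \<in> carrier (sym_group n)"
    then have \<sigma>: "\<sigma> permutes {1..n}" by (simp add: carrier)
    have fixed_iff: "(\<lambda>i\<in>{1..n}. f (inv_into UNIV \<sigma> i)) = f \<longleftrightarrow> (\<forall>i\<in>{1..n}. f (\<sigma> i) = f i)"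
      if f: "f \<in> words_of_content n M" for f
    proof
      assume *: "(\<lambda>i\<in>{1..n}. f (inv_into UNIV \<sigma> i)) = f"
      show "\<forall>i\<in>{1..n}. f (\<sigma> i) = f i"
      proof
        fix i assume "i \<in> {1..n}"
        then have "\<sigma> i \<in> {1..n}" using permutes_in_image[OF \<sigma>] by simp
        with fun_cong[OF *, of "\<sigma> i"] show "f (\<sigma> i) = f i"
          using permutes_inverses(2)[OF \<sigma>, of i] by simp
      qed
    next
      assume *: "\<forall>i\<in>{1..n}. f (\<sigma> i) = f i"
      show "(\<lambda>i\<in>{1..n}. f (inv_into UNIV \<sigma> i)) = f"
      proof (rule ext)
        fix i
        show "(\<lambda>i\<in>{1..n}. f (inv_into UNIV \<sigma> i)) i = f i"
        proof (cases "i \<in> {1..n}")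
          case True
          then have "inv_into UNIV \<sigma> i \<in> {1..n}"
            using permutes_in_image[OF permutes_inv[OF \<sigma>]] by simp
          from bspec[OF * this] True show ?thesis
            using permutes_inverses(1)[OF \<sigma>, of i] by simp
        next
          case False
          with f show ?thesis
            using PiE_arb[of f "{1..n}" "\<lambda>_. {0<..}" i] by (auto simp: words_of_content_def)
        qed
      qed
    qed
    have "invariants E \<phi> \<sigma> = {T \<in> bernardi_trees n. right_edges T = k \<and> act_tree \<sigma> T = T} \<times>
        {f \<in> words_of_content n M. \<forall>i\<in>{1..n}. f (\<sigma> i) = f i}"
    proof (rule Set.set_eqI)
      fix e :: "nat tree \<times> (nat \<Rightarrow> nat)"
      obtain T f where e: "e = (T, f)" by (cases e)
      have "e \<in> invariants E \<phi> \<sigma> \<longleftrightarrow> T \<in> bernardi_trees n \<and> right_edges T = k \<and> f \<in> words_of_content n M \<and>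
          act_tree \<sigma> T = T \<and> (\<lambda>i\<in>{1..n}. f (inv_into UNIV \<sigma> i)) = f"
        unfolding invariants_def \<phi>_def e E_def labeling_action_def
        by (auto simp del: atLeastAtMost_iff)
      then show "e \<in> invariants E \<phi> \<sigma> \<longleftrightarrow> e \<in> {T \<in> bernardi_trees n. right_edges T = k \<and> act_tree \<sigma> T = T} \<times>
        {f \<in> words_of_content n M. \<forall>i\<in>{1..n}. f (\<sigma> i) = f i}"
        using fixed_iff[of f] unfolding e by blast
    qed
    then show "card (invariants E \<phi> \<sigma>) = card {T \<in> bernardi_trees n. right_edges T = k \<and> act_tree \<sigma> T = T} *
        card {f \<in> words_of_content n M. \<forall>i\<in>{1..n}. f (\<sigma> i) = f i}"
      by (simp add: card_cartesian_product)
  qed simp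
  finally show ?thesis .
qed

section \<open>Characters and Frobenius characteristics\<close>

lemma perm_character_eq_card:
  assumes "finite X"
  shows "perm_character X \<phi> \<sigma> = of_nat (card {x \<in> X. \<phi> \<sigma> x = x})"
proof -
  have "(\<Sum>x' | x' \<in> X \<and> \<phi> \<sigma> x' = x. indicator {x} x') = (of_bool (\<phi> \<sigma> x = x) :: complex)"
    if "x \<in> X" for x
  proof -
    have "(\<Sum>x' | x' \<in> X \<and> \<phi> \<sigma> x' = x. indicator {x} x') =
        (\<Sum>x'\<in>{x'. x' \<in> X \<and> \<phi> \<sigma> x' = x}. if x' = x then 1 else 0 :: complex)"
      by (intro sum.cong) (auto simp: indicator_def)
    also have "\<dots> = of_bool (\<phi> \<sigma> x = x)"
      using assms that by (subst sum.delta) auto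
    finally show ?thesis .
  qed
  then have "perm_character X \<phi> \<sigma> = (\<Sum>x\<in>X. of_bool (\<phi> \<sigma> x = x))"
    by (simp add: perm_character_def perm_module_def)
  also have "\<dots> = of_nat (card {x \<in> X. \<phi> \<sigma> x = x})"
    using assms by (simp add: sum_of_bool_eq Int_def)
  finally show ?thesis .
qed

text \<open>The character counts fixed trees and the power sums count fixed labelings, so the
  defining sum is the one in Burnside's lemma and \<open>fact n\<close> cancels.\<close>

lemma frobenius_bernardi:
  "frobenius n (perm_character {T \<in> bernardi_trees n. right_edges T = k} (bernardi_action n)) M =
     of_nat (card {Z \<in> weakly_decreasing_trees n M. right_edges Z = k})"
proof -
  let ?X = "{T \<in> bernardi_trees n. right_edges T = k}"
  have "(\<Sum>\<sigma>\<in>carrier (sym_group n). perm_character ?X (bernardi_action n) \<sigma> * p_partition (cycle_type n \<sigma>) M) =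
      (\<Sum>\<sigma>\<in>carrier (sym_group n). of_nat (card {T \<in> bernardi_trees n. right_edges T = k \<and> act_tree \<sigma> T = T} *
        card {f \<in> words_of_content n M. \<forall>i\<in>{1..n}. f (\<sigma> i) = f i}))"
  proof (rule sum.cong)
    fix \<sigma> assume "\<sigma> \<in> carrier (sym_group n)"
    then have \<sigma>: "\<sigma> permutes {1..n}" by (simp add: sym_group_def)
    have "{x \<in> ?X. bernardi_action n \<sigma> x = x} = {T \<in> bernardi_trees n. right_edges T = k \<and> act_tree \<sigma> T = T}"
      by (auto simp: bernardi_action_def)
    then show "perm_character ?X (bernardi_action n) \<sigma> * p_partition (cycle_type n \<sigma>) M =
        of_nat (card {T \<in> bernardi_trees n. right_edges T = k \<and> act_tree \<sigma> T = T} *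
        card {f \<in> words_of_content n M. \<forall>i\<in>{1..n}. f (\<sigma> i) = f i})"
      using finite_bernardi_trees by (simp add: perm_character_eq_card p_partition_cycle_type[OF \<sigma>])
  qed simp
  also have "\<dots> = of_nat (card {Z \<in> weakly_decreasing_trees n M. right_edges Z = k} * fact n)"
    unfolding card_weakly_decreasing_trees_burnside by simp
  finally show ?thesis by (simp add: frobenius_def)
qed

lemma finite_weakly_decreasing_trees: "finite (weakly_decreasing_trees n M)"
  by (rule finite_subset[OF _ finite_trees[of "set_mset M" n]])
    (auto simp: weakly_decreasing_trees_def)

lemma graded_frobenius_bernardi:
  "graded_frobenius n (bernardi_trees n) right_edges (bernardi_action n) M =
     (\<Sum>Z\<in>weakly_decreasing_trees n M. qvar ^ right_edges Z)"
proof -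
  let ?K = "right_edges ` bernardi_trees n"
  have pow: "qvar ^ k = monom 1 k" for k by (simp add: qvar_def monom_power)
  \<comment> \<open>The graded characteristic sums over degrees of Bernardi trees only;
    standardization shows that no degree is missed.\<close>
  have "right_edges ` weakly_decreasing_trees n M \<subseteq> ?K"
  proof (rule image_subsetI)
    fix Z assume "Z \<in> weakly_decreasing_trees n M"
    from ex_standardization[OF this] obtain T where "T \<in> bernardi_trees n" "right_edges T = right_edges Z"
      by metis
    then show "right_edges Z \<in> ?K" by (metis imageI)
  qed
  then have "(\<Sum>Z\<in>weakly_decreasing_trees n M. qvar ^ right_edges Z) =
      (\<Sum>k\<in>?K. \<Sum>Z | Z \<in> weakly_decreasing_trees n M \<and> right_edges Z = k. qvar ^ right_edges Z)"
    using finite_bernardi_trees finite_weakly_decreasing_trees by (intro sum.group[symmetric]) auto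
  also have "\<dots> = (\<Sum>k\<in>?K. monom (of_nat (card {Z \<in> weakly_decreasing_trees n M. right_edges Z = k})) k)"
    by (intro sum.cong) (simp_all add: pow smult_monom of_nat_poly)
  finally show ?thesis by (simp add: graded_frobenius_def frobenius_bernardi)
qed

section \<open>Generating functions of trees\<close>

definition tree_gf :: "('a tree \<Rightarrow> 'k::comm_ring_1) \<Rightarrow> 'a tree set \<Rightarrow> 'k fps" where
  "tree_gf w C = Abs_fps (\<lambda>n. \<Sum>T | T \<in> C \<and> size T = n. w T)"

definition finite_by_size :: "'a tree set \<Rightarrow> bool" where
  "finite_by_size C \<longleftrightarrow> (\<forall>n. finite {T. T \<in> C \<and> size T = n})"

lemma finite_by_size_labels: "finite A \<Longrightarrow> (\<And>T. T \<in> C \<Longrightarrow> set_tree T \<subseteq> A) \<Longrightarrow> finite_by_size C"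
  unfolding finite_by_size_def by (blast intro: finite_subset[OF _ finite_trees])

lemma tree_gf_Un:
  assumes "finite_by_size C" "finite_by_size D" "C \<inter> D = {}"
  shows "tree_gf w (C \<union> D) = tree_gf w C + tree_gf w D"
proof (rule fps_ext)
  fix n
  have "{T. T \<in> C \<union> D \<and> size T = n} = {T. T \<in> C \<and> size T = n} \<union> {T. T \<in> D \<and> size T = n}" by auto
  then show "fps_nth (tree_gf w (C \<union> D)) n = fps_nth (tree_gf w C + tree_gf w D) n"
    using assms unfolding tree_gf_def finite_by_size_def
    by (simp only: fps_nth_Abs_fps fps_add_nth) (subst sum.union_disjoint, auto)
qed

lemma tree_gf_Leaf: "tree_gf w {\<langle>\<rangle>} = fps_const (w \<langle>\<rangle>)"
proof (rule fps_ext)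
  fix n
  have *: "{T. T \<in> {\<langle>\<rangle>} \<and> size T = n} = (if n = 0 then {\<langle>\<rangle>} else {})" by auto
  show "fps_nth (tree_gf w {\<langle>\<rangle>}) n = fps_nth (fps_const (w \<langle>\<rangle>)) n"
    unfolding tree_gf_def fps_nth_Abs_fps * by simp
qed

lemma tree_gf_cong:
  "(\<And>T. T \<in> C \<Longrightarrow> w T = w' T) \<Longrightarrow> tree_gf w C = tree_gf w' C"
  unfolding tree_gf_def by (intro arg_cong[of _ _ Abs_fps] ext sum.cong) auto

lemma tree_gf_const_mult: "tree_gf (\<lambda>T. c * w T) C = fps_const c * tree_gf w C"
  by (rule fps_ext) (simp add: tree_gf_def sum_distrib_left)

text \<open>Decomposition at the root, which accounts for \<open>c * fps_X\<close>. Two weights are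
  allowed because the right subtree will also carry the edge leading to it.\<close>

lemma tree_gf_Node:
  assumes "finite_by_size C" "finite_by_size D"
    and w: "\<And>l r. l \<in> C \<Longrightarrow> r \<in> D \<Longrightarrow> w \<langle>l, a, r\<rangle> = c * w1 l * w2 r"
  shows "tree_gf w {\<langle>l, a, r\<rangle> | l r. l \<in> C \<and> r \<in> D} = fps_const c * fps_X * tree_gf w1 C * tree_gf w2 D"
proof (rule fps_ext)
  fix n
  let ?S = "{\<langle>l, a, r\<rangle> | l r. l \<in> C \<and> r \<in> D}"
  show "fps_nth (tree_gf w ?S) n = fps_nth (fps_const c * fps_X * tree_gf w1 C * tree_gf w2 D) n"
  proof (cases n)
    case 0
    then have *: "{T. T \<in> ?S \<and> size T = n} = {}" by auto
    have "fps_nth (tree_gf w ?S) n = 0" unfolding tree_gf_def fps_nth_Abs_fps * by simp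
    with 0 show ?thesis by simp
  next
    case (Suc k)
    let ?C = "\<lambda>i. {T. T \<in> C \<and> size T = i}" and ?D = "\<lambda>i. {T. T \<in> D \<and> size T = i}"
    have fin: "finite (?C i)" "finite (?D i)" for i using assms by (simp_all add: finite_by_size_def)
    have "(\<Sum>T | T \<in> ?S \<and> size T = n. w T) =
        (\<Sum>(i, l, r)\<in>(SIGMA i:{0..k}. ?C i \<times> ?D (k - i)). c * (w1 l * w2 r))"
      by (rule sum.reindex_bij_witness[of _ "\<lambda>(i, l, r). \<langle>l, a, r\<rangle>" "\<lambda>T. (size (left T), left T, right T)"])
        (auto simp: Suc w mult.assoc)
    also have "\<dots> = (\<Sum>i=0..k. \<Sum>(l, r)\<in>?C i \<times> ?D (k - i). c * (w1 l * w2 r))"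
      using fin by (subst sum.Sigma) auto
    also have "\<dots> = (\<Sum>i=0..k. c * ((\<Sum>l\<in>?C i. w1 l) * (\<Sum>r\<in>?D (k - i). w2 r)))"
      by (intro sum.cong refl, subst sum_product, subst sum.cartesian_product, subst sum_distrib_left)
        (simp only: split_def)
    also have "\<dots> = c * fps_nth (tree_gf w1 C * tree_gf w2 D) k"
      by (simp add: fps_mult_nth tree_gf_def sum_distrib_left)
    also have "\<dots> = fps_nth (fps_const c * (fps_X * (tree_gf w1 C * tree_gf w2 D))) n"
      using Suc by simp
    finally show ?thesis by (simp add: tree_gf_def mult.assoc)
  qed
qed

text \<open>The quantity \<open>R (Suc i) + q * L i\<close> does not depend on \<open>i\<close>; this is \<open>1 + q * L m\<close>.
  Hence \<open>L (i - 1) * R (Suc i) = L i * R i * (1 - x i * (1 + q * L m))\<close>, and these relations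
  telescope.\<close>

lemma binary_search_system:
  fixes L R x :: "nat \<Rightarrow> 'a::idom"
  assumes L0: "L 0 = 1" and Rm: "R (Suc m) = 1"
    and L: "\<And>i. i < m \<Longrightarrow> L (Suc i) = L i + x (Suc i) * L (Suc i) * R (Suc i)"
    and R: "\<And>i. i < m \<Longrightarrow> R (Suc i) = R (Suc (Suc i)) + q * (x (Suc i) * L (Suc i) * R (Suc i))"
    and nz: "\<And>i. i \<le> m \<Longrightarrow> L i \<noteq> 0"
  shows "L m * (1 + q * L m - q) * (\<Prod>i=1..m. 1 - x i * (1 + q * L m)) = 1"
proof -
  define U where "U = 1 + q * L m"
  have step: "R (Suc (Suc i)) + q * L (Suc i) = R (Suc i) + q * L i" if "i < m" for i
    using L[OF that] R[OF that] by (metis add.assoc add.commute distrib_left)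
  have const: "R (Suc i) + q * L i = R 1 + q" if "i \<le> m" for i
    using that by (induction i) (simp_all add: L0 step)
  have U: "R (Suc i) + q * L i = U" if "i \<le> m" for i
    using const[OF that] const[of m] by (simp add: U_def Rm)
  have rel: "L (Suc i) * R (Suc i) * (1 - x (Suc i) * U) = L i * R (Suc (Suc i))" if "i < m" for i
  proof -
    let ?y = "x (Suc i)" and ?l = "L (Suc i)" and ?r = "R (Suc i)"
    have l: "L i = ?l - ?y * ?l * ?r" using L[OF that] by (simp add: algebra_simps)
    have r: "R (Suc (Suc i)) = ?r - q * (?y * ?l * ?r)" using R[OF that] by (simp add: algebra_simps)
    have U': "U = ?r - q * (?y * ?l * ?r) + q * ?l" using U[of "Suc i"] that r by simp
    show ?thesis unfolding l r U' by (simp add: algebra_simps)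
  qed
  have "L k * R 1 * (\<Prod>i=1..k. 1 - x i * U) = R (Suc k)" if "k \<le> m" for k
    using that
  proof (induction k)
    case 0
    show ?case by (simp add: L0)
  next
    case (Suc k)
    let ?P = "\<Prod>i=1..k. 1 - x i * U"
    have IH: "L k * R 1 * ?P = R (Suc k)" using Suc by simp
    \<comment> \<open>The extra factor \<open>L k\<close> makes the induction hypothesis and the
      relation for \<open>k\<close> applicable; it is nonzero and is cancelled at the end.\<close>
    have "L k * (L (Suc k) * R 1 * (\<Prod>i=1..Suc k. 1 - x i * U)) =
        L (Suc k) * (L k * R 1 * ?P) * (1 - x (Suc k) * U)"
      by (simp add: algebra_simps)
    also have "\<dots> = L k * R (Suc (Suc k))"
      unfolding IH using rel[of k] Suc.prems by simp
    finally show ?case using nz[of k] Suc.prems by simp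
  qed
  from this[of m] have "L m * R 1 * (\<Prod>i=1..m. 1 - x i * U) = 1" by (simp add: Rm)
  moreover have "R 1 = U - q" using U[of 0] by (simp add: L0 algebra_simps)
  ultimately show ?thesis by (simp add: U_def)
qed

text \<open>The recursion is affine in \<open>S\<close>. The combination
  \<open>Z i = S i * U - q * S m\<close> makes it homogeneous: the increment of \<open>S\<close> is
  \<open>x (Suc i) * Z (Suc i)\<close>, so \<open>Z (Suc i) * (1 - x (Suc i) * U) = Z i\<close>. The
  product telescopes between \<open>Z 0 = 1\<close> and \<open>Z m = S m * (U - q)\<close>.\<close>

lemma decreasing_system:
  fixes S x :: "nat \<Rightarrow> 'a::idom"
  assumes S0: "S 0 = 1"
    and S: "\<And>i. i < m \<Longrightarrow> S (Suc i) = S i + x (Suc i) * (S (Suc i) * (1 + q * S m) - q * S m)"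
  shows "S m * (1 + q * S m - q) * (\<Prod>i=1..m. 1 - x i * (1 + q * S m)) = 1"
proof -
  define U where "U = 1 + q * S m"
  define Z where "Z i = S i * U - q * S m" for i
  have step: "Z (Suc i) * (1 - x (Suc i) * U) = Z i" if "i < m" for i
  proof -
    have "Z (Suc i) - Z i = U * (S (Suc i) - S i)" by (simp add: Z_def algebra_simps)
    also have "S (Suc i) - S i = x (Suc i) * Z (Suc i)"
      using S[OF that] unfolding Z_def U_def by (metis add_diff_cancel_left')
    finally show ?thesis by (simp add: algebra_simps)
  qed
  have "Z k * (\<Prod>i=1..k. 1 - x i * U) = 1" if "k \<le> m" for k
    using that
  proof (induction k)
    case 0
    show ?case by (simp add: Z_def S0 U_def)
  next
    case (Suc k)
    have "Z (Suc k) * (\<Prod>i=1..Suc k. 1 - x i * U) =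
        (Z (Suc k) * (1 - x (Suc k) * U)) * (\<Prod>i=1..k. 1 - x i * U)"
      by (simp add: mult.assoc mult.left_commute mult.commute)
    also have "\<dots> = Z k * (\<Prod>i=1..k. 1 - x i * U)"
      using step[of k] Suc.prems by simp
    also have "\<dots> = 1" using Suc by simp
    finally show ?case .
  qed
  from this[of m] show ?thesis by (simp add: Z_def U_def algebra_simps)
qed

text \<open>Subtracting the equations leaves \<open>F - G\<close> times a series \<open>V\<close>.
  The two products differ by a multiple of \<open>fps_X * (F - G)\<close>, which contributes nothing
  to the constant term of \<open>V\<close>; that term is \<open>1 + fps_nth q 0\<close>, so
  \<open>V\<close> is nonzero and can be cancelled.\<close>

lemma functional_equation_unique:
  fixes F G :: "'k::idom fps"
  assumes F: "F * (1 + q * F - q) * (\<Prod>i\<in>I. 1 - c i * fps_X * (1 + q * F)) = 1"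
    and G: "G * (1 + q * G - q) * (\<Prod>i\<in>I. 1 - c i * fps_X * (1 + q * G)) = 1"
    and "finite I" "fps_nth F 0 = 1" "fps_nth G 0 = 1" "1 + fps_nth q 0 \<noteq> 0"
  shows "F = G"
proof -
  define \<Phi> where "\<Phi> J H = (\<Prod>i\<in>J. 1 - c i * fps_X * (1 + q * H))" for J H
  have "\<exists>E. \<Phi> J F - \<Phi> J G = fps_X * (F - G) * E" if "finite J" for J
    using that
  proof (induction J)
    case empty
    show ?case by (intro exI[of _ 0]) (simp add: \<Phi>_def)
  next
    case (insert j J)
    then obtain E where E: "\<Phi> J F - \<Phi> J G = fps_X * (F - G) * E" by blast
    have "\<Phi> (insert j J) F - \<Phi> (insert j J) G =
        (1 - c j * fps_X * (1 + q * F)) * (\<Phi> J F - \<Phi> J G) - c j * fps_X * q * (F - G) * \<Phi> J G"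
      using insert.hyps by (simp add: \<Phi>_def algebra_simps)
    also have "\<dots> = fps_X * (F - G) * ((1 - c j * fps_X * (1 + q * F)) * E - c j * q * \<Phi> J G)"
      unfolding E by (simp add: algebra_simps)
    finally show ?case by blast
  qed
  with \<open>finite I\<close> obtain E where E: "\<Phi> I F - \<Phi> I G = fps_X * (F - G) * E" by blast
  define V where "V = (1 - q + q * (F + G)) * \<Phi> I F + G * (1 + q * G - q) * (fps_X * E)"
  have "(F - G) * V = F * (1 + q * F - q) * \<Phi> I F - G * (1 + q * G - q) * \<Phi> I F
      + G * (1 + q * G - q) * (fps_X * (F - G) * E)"
    by (simp add: V_def algebra_simps)
  also have "\<dots> = F * (1 + q * F - q) * \<Phi> I F - G * (1 + q * G - q) * \<Phi> I G"
    unfolding E[symmetric] by (simp add: algebra_simps)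
  also have "\<dots> = 0" using F G by (simp add: \<Phi>_def)
  finally have "(F - G) * V = 0" .
  moreover have "fps_nth V 0 = 1 + fps_nth q 0"
  proof -
    have "fps_nth (\<Phi> I F) 0 = 1"
      using \<open>finite I\<close> unfolding \<Phi>_def by (induction I rule: finite_induct) simp_all
    then show ?thesis using assms by (simp add: V_def algebra_simps)
  qed
  then have "V \<noteq> 0" using assms by auto
  ultimately show ?thesis by simp
qed

section \<open>The equations for the two families of trees\<close>

definition edge_var :: "nat multiset \<Rightarrow>\<^sub>0 complex poly" where
  "edge_var = Poly_Mapping.single 0 qvar"

definition label_var :: "nat \<Rightarrow> nat multiset \<Rightarrow>\<^sub>0 complex poly" where
  "label_var i = Poly_Mapping.single {#i#} 1"

definition tree_weight :: "nat tree \<Rightarrow> nat multiset \<Rightarrow>\<^sub>0 complex poly" where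
  "tree_weight T = Poly_Mapping.single (mset (preorder_word T)) (qvar ^ right_edges T)"

text \<open>Weight of a right subtree together with the edge leading to it; an empty subtree has no
  such edge.\<close>

definition right_weight :: "nat tree \<Rightarrow> nat multiset \<Rightarrow>\<^sub>0 complex poly" where
  "right_weight T = (if T = \<langle>\<rangle> then 1 else edge_var * tree_weight T)"

lemma tree_weight_Leaf [simp]: "tree_weight \<langle>\<rangle> = 1"
  by (simp add: tree_weight_def flip: single_one zero_multiset_def)

lemma tree_weight_Node: "tree_weight \<langle>l, a, r\<rangle> = label_var a * tree_weight l * right_weight r"
  by (cases "r = \<langle>\<rangle>")
    (simp_all add: tree_weight_def right_weight_def label_var_def edge_var_def mult_single
      power_add mult_ac add_ac flip: single_one zero_multiset_def)

lemma fps_nth_tree_gf_0: "\<langle>\<rangle> \<in> C \<Longrightarrow> fps_nth (tree_gf w C) 0 = w \<langle>\<rangle>"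
proof -
  assume "\<langle>\<rangle> \<in> C"
  then have *: "{T. T \<in> C \<and> size T = 0} = {\<langle>\<rangle>}" by auto
  show ?thesis unfolding tree_gf_def fps_nth_Abs_fps * by simp
qed

lemma value_in_set_tree: "T \<noteq> \<langle>\<rangle> \<Longrightarrow> value T \<in> set_tree T"
  by (cases T) auto

text \<open>Absence of descents compares a node only with its children. So a tree with root label
  \<open>i\<close> is a left subtree that is empty or has root at most \<open>i\<close>, together
  with a right subtree that is empty or has root at least \<open>i\<close>. Admitting one more root
  label at a time gives the two recursions.\<close>

lemma search_tree_gf:
  fixes m :: nat
  defines "F \<equiv> tree_gf tree_weight {T. ldes T = 0 \<and> rdes T = 0 \<and> set_tree T \<subseteq> {1..m}}"
  shows "F * (1 + fps_const edge_var * F - fps_const edge_var) *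
    (\<Prod>i=1..m. 1 - fps_const (label_var i) * fps_X * (1 + fps_const edge_var * F)) = 1"
proof -
  define C where "C = {T. ldes T = 0 \<and> rdes T = 0 \<and> set_tree T \<subseteq> {1..m}}"
  define Ls where "Ls i = {T \<in> C. T = \<langle>\<rangle> \<or> value T \<le> i}" for i
  define Rs where "Rs i = {T \<in> C. T = \<langle>\<rangle> \<or> i \<le> value T}" for i
  define As where "As i = {T \<in> C. T \<noteq> \<langle>\<rangle> \<and> value T = i}" for i
  define L where "L i = tree_gf tree_weight (Ls i)" for i
  define R where "R i = tree_gf right_weight (Rs i)" for i
  define x where "x i = fps_const (label_var i) * fps_X" for i
  have val: "value T \<in> {1..m}" if "T \<in> C" "T \<noteq> \<langle>\<rangle>" for T
    using value_in_set_tree[OF that(2)] that(1) by (auto simp: C_def)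
  have leaf: "\<langle>\<rangle> \<in> C" by (simp add: C_def)
  have fin: "finite_by_size D" if "D \<subseteq> C" for D
    using that by (intro finite_by_size_labels[of "{1..m}"]) (auto simp: C_def)
  have sub: "Ls i \<subseteq> C" "Rs i \<subseteq> C" "As i \<subseteq> C" for i by (auto simp: Ls_def Rs_def As_def)
  have As: "As i = {\<langle>l, i, r\<rangle> | l r. l \<in> Ls i \<and> r \<in> Rs i}" if "i \<in> {1..m}" for i
  proof (intro equalityI subsetI)
    fix T assume T: "T \<in> As i"
    then obtain l r where "T = \<langle>l, i, r\<rangle>" by (cases T) (auto simp: As_def)
    with T show "T \<in> {\<langle>l, i, r\<rangle> | l r. l \<in> Ls i \<and> r \<in> Rs i}"
      by (auto simp: As_def Ls_def Rs_def C_def)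
  next
    fix T assume "T \<in> {\<langle>l, i, r\<rangle> | l r. l \<in> Ls i \<and> r \<in> Rs i}"
    then obtain l r where T: "T = \<langle>l, i, r\<rangle>" and lr: "l \<in> Ls i" "r \<in> Rs i" by blast
    from lr have "set_tree l \<subseteq> {1..m}" "set_tree r \<subseteq> {1..m}" by (simp_all add: Ls_def Rs_def C_def)
    with that T have "set_tree T \<subseteq> {1..m}" by simp
    with T lr show "T \<in> As i" by (auto simp: As_def Ls_def Rs_def C_def simp del: atLeastAtMost_iff)
  qed
  have A: "tree_gf tree_weight (As i) = x i * L i * R i" if "i \<in> {1..m}" for i
    unfolding As[OF that] L_def R_def x_def
    by (rule tree_gf_Node) (simp_all add: fin sub tree_weight_Node)
  have A': "tree_gf right_weight (As i) = fps_const edge_var * tree_gf tree_weight (As i)" for i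
    unfolding tree_gf_const_mult[symmetric]
    by (rule tree_gf_cong) (simp add: right_weight_def As_def)
  have "L m * (1 + fps_const edge_var * L m - fps_const edge_var) *
      (\<Prod>i=1..m. 1 - x i * (1 + fps_const edge_var * L m)) = 1"
  proof (rule binary_search_system)
    have "Ls 0 = {\<langle>\<rangle>}" using val leaf by (fastforce simp: Ls_def)
    then show "L 0 = 1" by (simp add: L_def tree_gf_Leaf)
    have "Rs (Suc m) = {\<langle>\<rangle>}" using val leaf by (fastforce simp: Rs_def)
    then show "R (Suc m) = 1" by (simp add: R_def tree_gf_Leaf right_weight_def)
  next
    fix i assume i: "i < m"
    have "Ls (Suc i) = Ls i \<union> As (Suc i)" by (auto simp: Ls_def As_def le_Suc_eq)
    moreover have "Ls i \<inter> As (Suc i) = {}" by (auto simp: Ls_def As_def)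
    ultimately have "L (Suc i) = L i + tree_gf tree_weight (As (Suc i))"
      unfolding L_def by (simp add: tree_gf_Un fin sub)
    then show "L (Suc i) = L i + x (Suc i) * L (Suc i) * R (Suc i)" using A[of "Suc i"] i by simp
    have "Rs (Suc i) = Rs (Suc (Suc i)) \<union> As (Suc i)" by (auto simp: Rs_def As_def Suc_le_eq)
    moreover have "Rs (Suc (Suc i)) \<inter> As (Suc i) = {}" by (auto simp: Rs_def As_def)
    ultimately have "R (Suc i) = R (Suc (Suc i)) + tree_gf right_weight (As (Suc i))"
      unfolding R_def by (simp add: tree_gf_Un fin sub)
    then show "R (Suc i) = R (Suc (Suc i)) + fps_const edge_var * (x (Suc i) * L (Suc i) * R (Suc i))"
      using A[of "Suc i"] A'[of "Suc i"] i by simp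
  next
    fix i
    have "fps_nth (L i) 0 = 1" unfolding L_def by (subst fps_nth_tree_gf_0) (simp_all add: Ls_def leaf)
    then show "L i \<noteq> 0" by auto
  qed
  moreover have "L m = F"
  proof -
    have "Ls m = C" using val by (fastforce simp: Ls_def)
    then show ?thesis by (simp add: L_def F_def C_def)
  qed
  ultimately show ?thesis by (simp add: x_def)
qed

text \<open>If the root \<open>i\<close> has a right child, only that child is compared with it and
  the left subtree is arbitrary, contributing \<open>F * q * (S i - 1)\<close> with \<open>q\<close>
  the edge variable. Otherwise the left subtree is empty or has root at most \<open>i\<close>,
  contributing \<open>S i\<close>.\<close>

lemma decreasing_tree_gf:
  fixes m :: nat
  defines "F \<equiv> tree_gf tree_weight {T. (\<forall>W\<in>set (tree_blocks T). sorted_wrt (\<ge>) W) \<and> set_tree T \<subseteq> {1..m}}"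
  shows "F * (1 + fps_const edge_var * F - fps_const edge_var) *
    (\<Prod>i=1..m. 1 - fps_const (label_var i) * fps_X * (1 + fps_const edge_var * F)) = 1"
proof -
  define wd where "wd T \<longleftrightarrow> (\<forall>W\<in>set (tree_blocks T). sorted_wrt (\<ge>) W)" for T :: "nat tree"
  have tr: "transp ((\<ge>) :: nat \<Rightarrow> nat \<Rightarrow> bool)" by (rule transpI) simp
  have wd_Leaf: "wd \<langle>\<rangle>" by (simp add: wd_def)
  have wd_Node: "wd \<langle>l, a, r\<rangle> \<longleftrightarrow>
      (if r \<noteq> \<langle>\<rangle> then value r \<le> a else l \<noteq> \<langle>\<rangle> \<longrightarrow> value l \<le> a) \<and> wd l \<and> wd r" for l a r
    unfolding wd_def sorted_tree_blocks_Node_iff[OF tr] by blast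
  define C where "C = {T. wd T \<and> set_tree T \<subseteq> {1..m}}"
  define Ss where "Ss i = {T \<in> C. T = \<langle>\<rangle> \<or> value T \<le> i}" for i
  define Ns where "Ns i = {T \<in> C. T \<noteq> \<langle>\<rangle> \<and> value T \<le> i}" for i
  define As where "As i = {T \<in> C. T \<noteq> \<langle>\<rangle> \<and> value T = i}" for i
  define S where "S i = tree_gf tree_weight (Ss i)" for i
  define x where "x i = fps_const (label_var i) * fps_X" for i
  have val: "value T \<in> {1..m}" if "T \<in> C" "T \<noteq> \<langle>\<rangle>" for T
    using value_in_set_tree[OF that(2)] that(1) by (auto simp: C_def)
  have leaf: "\<langle>\<rangle> \<in> C" by (simp add: C_def wd_Leaf)
  have fin: "finite_by_size D" if "D \<subseteq> C" for D
    using that by (intro finite_by_size_labels[of "{1..m}"]) (auto simp: C_def)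
  have sub: "Ss i \<subseteq> C" "Ns i \<subseteq> C" "As i \<subseteq> C" "{\<langle>\<rangle>} \<subseteq> C" for i
    using leaf by (auto simp: Ss_def Ns_def As_def)
  have "Ss m = C" using val by (fastforce simp: Ss_def)
  then have Sm: "S m = F" by (simp add: S_def F_def C_def wd_def)
  have SN: "S i = 1 + tree_gf tree_weight (Ns i)" for i
  proof -
    have "Ss i = {\<langle>\<rangle>} \<union> Ns i" using leaf by (auto simp: Ss_def Ns_def)
    moreover have "{\<langle>\<rangle>} \<inter> Ns i = {}" by (auto simp: Ns_def)
    ultimately have "S i = tree_gf tree_weight {\<langle>\<rangle>} + tree_gf tree_weight (Ns i)"
      unfolding S_def by (simp only: tree_gf_Un fin sub)
    then show ?thesis by (simp add: tree_gf_Leaf)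
  qed
  have A: "tree_gf tree_weight (As i) = x i * (S i * (1 + fps_const edge_var * F) - fps_const edge_var * F)"
    if i: "i \<in> {1..m}" for i
  proof -
    let ?P = "{\<langle>l, i, r\<rangle> | l r. l \<in> C \<and> r \<in> Ns i}" and ?Q = "{\<langle>l, i, r\<rangle> | l r. l \<in> Ss i \<and> r \<in> {\<langle>\<rangle>}}"
    have As: "As i = ?P \<union> ?Q"
    proof (intro equalityI subsetI)
      fix T assume T: "T \<in> As i"
      then obtain l r where "T = \<langle>l, i, r\<rangle>" by (cases T) (auto simp: As_def)
      with T show "T \<in> ?P \<union> ?Q"
        by (cases "r = \<langle>\<rangle>") (auto simp: As_def Ss_def Ns_def C_def wd_Node)
    next
      fix T assume *: "T \<in> ?P \<union> ?Q"
      then obtain l r where T: "T = \<langle>l, i, r\<rangle>" and "set_tree l \<subseteq> {1..m}" "set_tree r \<subseteq> {1..m}"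
        unfolding Ss_def Ns_def C_def by auto
      with i have "set_tree T \<subseteq> {1..m}" by simp
      with * T show "T \<in> As i"
        by (auto simp: As_def Ss_def Ns_def C_def wd_Node wd_Leaf simp del: atLeastAtMost_iff)
    qed
    have disj: "?P \<inter> ?Q = {}" by (auto simp: Ns_def)
    have "tree_gf tree_weight (As i) = tree_gf tree_weight ?P + tree_gf tree_weight ?Q"
      unfolding As using disj sub(3)[of i] unfolding As by (intro tree_gf_Un fin) auto
    also have "tree_gf tree_weight ?P = x i * tree_gf tree_weight C * tree_gf right_weight (Ns i)"
      unfolding x_def by (rule tree_gf_Node) (simp_all add: fin sub tree_weight_Node)
    also have "tree_gf right_weight (Ns i) = fps_const edge_var * tree_gf tree_weight (Ns i)"
      unfolding tree_gf_const_mult[symmetric]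
      by (rule tree_gf_cong) (simp add: right_weight_def Ns_def)
    also have "tree_gf tree_weight (Ns i) = S i - 1" by (simp add: SN)
    also have "tree_gf tree_weight C = F" by (simp add: F_def C_def wd_def)
    also have "tree_gf tree_weight ?Q = x i * S i * tree_gf right_weight {\<langle>\<rangle>}"
      unfolding x_def S_def by (rule tree_gf_Node) (simp_all add: fin sub leaf tree_weight_Node)
    also have "tree_gf right_weight {\<langle>\<rangle>} = 1" by (simp add: tree_gf_Leaf right_weight_def)
    finally show ?thesis by (simp add: algebra_simps)
  qed
  have "S m * (1 + fps_const edge_var * S m - fps_const edge_var) *
      (\<Prod>i=1..m. 1 - x i * (1 + fps_const edge_var * S m)) = 1"
  proof (rule decreasing_system)
    have "Ss 0 = {\<langle>\<rangle>}" using val leaf by (fastforce simp: Ss_def)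
    then show "S 0 = 1" by (simp add: S_def tree_gf_Leaf)
  next
    fix i assume i: "i < m"
    have "Ss (Suc i) = Ss i \<union> As (Suc i)" by (auto simp: Ss_def As_def le_Suc_eq)
    moreover have "Ss i \<inter> As (Suc i) = {}" by (auto simp: Ss_def As_def)
    ultimately have "S (Suc i) = S i + tree_gf tree_weight (As (Suc i))"
      unfolding S_def by (simp add: tree_gf_Un fin sub)
    then show "S (Suc i) = S i + x (Suc i) * (S (Suc i) * (1 + fps_const edge_var * S m) - fps_const edge_var * S m)"
      using A[of "Suc i"] i unfolding Sm by simp
  qed
  then show ?thesis by (simp add: x_def Sm)
qed

lemma edge_var_neq_minus_one: "1 + edge_var \<noteq> 0"
proof
  assume *: "1 + edge_var = 0"
  have "Poly_Mapping.lookup (1 + edge_var) 0 = 1 + qvar"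
    by (simp add: edge_var_def Poly_Mapping.lookup_add Poly_Mapping.lookup_one zero_multiset_def)
  moreover have "coeff (1 + qvar) 1 = 1" by (simp add: qvar_def)
  ultimately show False using * by auto
qed

lemma search_tree_gf_eq_decreasing_tree_gf:
  "tree_gf tree_weight {T. ldes T = 0 \<and> rdes T = 0 \<and> set_tree T \<subseteq> {1..m}} =
   tree_gf tree_weight {T. (\<forall>W\<in>set (tree_blocks T). sorted_wrt (\<ge>) W) \<and> set_tree T \<subseteq> {1..m}}"
  by (rule functional_equation_unique[OF search_tree_gf decreasing_tree_gf])
    (simp_all add: fps_nth_tree_gf_0 edge_var_neq_minus_one)

text \<open>Trees with content \<open>M\<close> only use labels occurring in \<open>M\<close>, so
  restricting the labels to \<open>A\<close> does not change this coefficient.\<close>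

lemma lookup_tree_gf:
  assumes "set_mset M \<subseteq> A" "finite A" "size M = n"
  shows "Poly_Mapping.lookup (fps_nth (tree_gf tree_weight {T. P T \<and> set_tree T \<subseteq> A}) n) M =
    (\<Sum>T | P T \<and> size T = n \<and> mset (preorder_word T) = M. qvar ^ right_edges T)"
proof -
  have fin: "finite {T. T \<in> {T. P T \<and> set_tree T \<subseteq> A} \<and> size T = n}"
    using assms by (intro finite_subset[OF _ finite_trees[of A n]]) auto
  have "Poly_Mapping.lookup (fps_nth (tree_gf tree_weight {T. P T \<and> set_tree T \<subseteq> A}) n) M =
      (\<Sum>T | T \<in> {T. P T \<and> set_tree T \<subseteq> A} \<and> size T = n. Poly_Mapping.lookup (tree_weight T) M)"
    by (simp add: tree_gf_def Poly_Mapping.lookup_sum)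
  also have "\<dots> = (\<Sum>T | P T \<and> size T = n \<and> mset (preorder_word T) = M. qvar ^ right_edges T)"
  proof (rule sum.mono_neutral_cong_right[OF fin])
    have "set_tree T \<subseteq> A" if "mset (preorder_word T) = M" for T
      using assms(1) arg_cong[OF that, of set_mset] by simp
    then show "{T. P T \<and> size T = n \<and> mset (preorder_word T) = M}
        \<subseteq> {T. T \<in> {T. P T \<and> set_tree T \<subseteq> A} \<and> size T = n}" by blast
  qed (auto simp: tree_weight_def Poly_Mapping.lookup_single when_def)
  finally show ?thesis .
qed

lemma sum_search_trees_eq_sum_decreasing_trees:
  "(\<Sum>T | T \<in> labeled_trees n \<and> mset (preorder_word T) = M \<and> ldes T = 0 \<and> rdes T = 0. qvar ^ right_edges T) =
   (\<Sum>T\<in>weakly_decreasing_trees n M. qvar ^ right_edges T)"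
proof (cases "0 \<in># M \<or> size M \<noteq> n")
  case True
  have "0 \<notin># M \<and> size M = n" if "T \<in> labeled_trees n" "mset (preorder_word T) = M" for T
    using that by (auto simp: labeled_trees_def)
  moreover have "0 \<notin># M \<and> size M = n" if "T \<in> weakly_decreasing_trees n M" for T
    using that by (auto simp: weakly_decreasing_trees_def)
  ultimately have "{T. T \<in> labeled_trees n \<and> mset (preorder_word T) = M \<and> ldes T = 0 \<and> rdes T = 0} = {}"
    "weakly_decreasing_trees n M = {}" using True by blast+
  then show ?thesis by (simp only: sum.empty)
next
  case False
  \<comment> \<open>An alphabet \<open>{1..m}\<close> containing all labels in \<open>M\<close>; the
    inserted 0 covers the empty multiset.\<close>
  define m where "m = Max (insert 0 (set_mset M))"
  have M: "set_mset M \<subseteq> {1..m}"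
  proof
    fix i assume i: "i \<in># M"
    then have "i \<noteq> 0" using False by metis
    moreover have "i \<le> m" unfolding m_def using i by (intro Max_ge) auto
    ultimately show "i \<in> {1..m}" by simp
  qed
  have pos: "0 < a" if "a \<in> set_tree T" "mset (preorder_word T) = M" for a T
  proof -
    have "a \<in># M" using that by (metis set_mset_mset set_preorder_word)
    with M show ?thesis by auto
  qed
  have "(\<Sum>T | T \<in> labeled_trees n \<and> mset (preorder_word T) = M \<and> ldes T = 0 \<and> rdes T = 0. qvar ^ right_edges T) =
      (\<Sum>T | (ldes T = 0 \<and> rdes T = 0) \<and> size T = n \<and> mset (preorder_word T) = M. qvar ^ right_edges T)"
    by (rule sum.cong) (auto simp: labeled_trees_def pos)
  also have "\<dots> = Poly_Mapping.lookup (fps_nth (tree_gf tree_weight {T. (ldes T = 0 \<and> rdes T = 0) \<and> set_tree T \<subseteq> {1..m}}) n) M"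
    using False by (subst lookup_tree_gf[OF M]) simp_all
  also have "\<dots> = Poly_Mapping.lookup (fps_nth (tree_gf tree_weight
      {T. (\<forall>W\<in>set (tree_blocks T). sorted_wrt (\<ge>) W) \<and> set_tree T \<subseteq> {1..m}}) n) M"
    using search_tree_gf_eq_decreasing_tree_gf[of m] by (simp only: conj_assoc)
  also have "\<dots> = (\<Sum>T | (\<forall>W\<in>set (tree_blocks T). sorted_wrt (\<ge>) W) \<and> size T = n \<and> mset (preorder_word T) = M.
      qvar ^ right_edges T)"
    using False by (subst lookup_tree_gf[OF M]) simp_all
  also have "\<dots> = (\<Sum>T\<in>weakly_decreasing_trees n M. qvar ^ right_edges T)"
    using False by (intro sum.cong) (auto simp: weakly_decreasing_trees_def)
  finally show ?thesis .
qed

section \<open>Complete homogeneous functions, transport, and the theorem\<close>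

lemma rasc_add_rdes: "rasc T + rdes T = right_edges T"
  by (induction T) auto

text \<open>As \<open>0 ^ 0 = 1\<close>, the zero parameters select the trees without descents, in
  which every right edge is a right ascent.\<close>

lemma G_series_eq_sum_search_trees:
  "G_series n 1 0 q 0 M =
    (\<Sum>T | T \<in> labeled_trees n \<and> mset (preorder_word T) = M \<and> ldes T = 0 \<and> rdes T = 0. q ^ right_edges T)"
proof -
  have fin: "finite {T \<in> labeled_trees n. mset (preorder_word T) = M}"
    by (rule finite_subset[OF _ finite_trees[of "set_mset M" n]]) (auto simp: labeled_trees_def)
  show ?thesis
    unfolding G_series_def
  proof (rule sum.mono_neutral_cong_right)
    fix T assume "T \<in> {T. T \<in> labeled_trees n \<and> mset (preorder_word T) = M \<and> ldes T = 0 \<and> rdes T = 0}"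
    then show "1 ^ lasc T * 0 ^ ldes T * q ^ rasc T * 0 ^ rdes T = q ^ right_edges T"
      using rasc_add_rdes[of T] by simp
  qed (use fin in \<open>auto simp: power_0_left split: if_splits\<close>)
qed

section \<open>Products of complete homogeneous functions\<close>

definition decreasing_block_words :: "nat list \<Rightarrow> nat multiset \<Rightarrow> nat list list set" where
  "decreasing_block_words c M = {ws. map length ws = c \<and> (\<forall>W\<in>set ws. sorted_wrt (\<ge>) W) \<and>
     mset (concat ws) = M \<and> 0 \<notin># M}"

lemma decreasing_word_unique:
  "sorted_wrt (\<ge>) V \<Longrightarrow> V = rev (sorted_list_of_multiset (mset V))" for V :: "nat list"
proof -
  assume "sorted_wrt (\<ge>) V"
  then have "sorted (rev V)" by (simp add: sorted_wrt_rev)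
  then have "sort V = rev V" by (intro properties_for_sort) simp_all
  then show ?thesis by simp
qed

text \<open>Each monomial of a complete homogeneous function is the content of exactly one weakly
  decreasing word, so a choice of one monomial per factor is a list of such words.\<close>

lemma h_composition_eq_card:
  "finite (decreasing_block_words c M) \<and>
   h_composition c M = (of_nat (card (decreasing_block_words c M)) :: 'a::comm_semiring_1)"
proof (induction c arbitrary: M)
  case Nil
  have "decreasing_block_words [] M = (if M = {#} then {[]} else {})"
    by (auto simp: decreasing_block_words_def)
  then show ?case by (simp add: h_composition_def prod_series_def one_series_def)
next
  case (Cons k c)
  define I where "I = {A. A \<subseteq># M \<and> size A = k \<and> 0 \<notin># A}"
  define w where "w A = rev (sorted_list_of_multiset A)" for A :: "nat multiset"
  have w: "mset (w A) = A" "length (w A) = size A" "sorted_wrt (\<ge>) (w A)" for A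
  proof -
    show "mset (w A) = A" by (simp add: w_def)
    then show "length (w A) = size A" by (metis size_mset)
    show "sorted_wrt (\<ge>) (w A)" by (simp add: w_def sorted_wrt_rev)
  qed
  have finI: "finite I" unfolding I_def by (rule finite_subset[OF _ finite_sub_multisets[of M]]) auto
  have split: "decreasing_block_words (k # c) M = (\<Union>A\<in>I. (#) (w A) ` decreasing_block_words c (M - A))"
  proof (intro equalityI subsetI)
    fix vs assume vs: "vs \<in> decreasing_block_words (k # c) M"
    then obtain V ws where V: "vs = V # ws" by (cases vs) (auto simp: decreasing_block_words_def)
    have "mset V \<subseteq># M" "0 \<notin># mset V" "0 \<notin># mset (concat ws)"
      using vs by (auto simp: V decreasing_block_words_def)
    moreover have "w (mset V) = V"
      using vs decreasing_word_unique[of V] by (simp add: w_def V decreasing_block_words_def)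
    moreover have "ws \<in> decreasing_block_words c (M - mset V)"
      using vs by (auto simp: V decreasing_block_words_def)
    ultimately show "vs \<in> (\<Union>A\<in>I. (#) (w A) ` decreasing_block_words c (M - A))"
      using vs unfolding V I_def decreasing_block_words_def by (intro UN_I[of "mset V"]) auto
  next
    fix vs assume "vs \<in> (\<Union>A\<in>I. (#) (w A) ` decreasing_block_words c (M - A))"
    then obtain A ws where A: "A \<subseteq># M" "size A = k" "0 \<notin># A" and ws: "ws \<in> decreasing_block_words c (M - A)"
      and vs: "vs = w A # ws" by (auto simp: I_def)
    have "mset (concat vs) = M" using ws A(1) by (simp add: vs w decreasing_block_words_def)
    moreover have "0 \<notin># M"
    proof -
      have "0 \<notin># A + (M - A)" using A(3) ws unfolding union_iff by (auto simp: decreasing_block_words_def)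
      then show ?thesis using A(1) by simp
    qed
    ultimately show "vs \<in> decreasing_block_words (k # c) M"
      using ws A w by (auto simp: vs decreasing_block_words_def)
  qed
  have inj: "w A = w B \<longleftrightarrow> A = B" for A B using w(1) by metis
  have fin: "finite (decreasing_block_words (k # c) M)"
    unfolding split using finI Cons.IH by blast
  have "(h_composition (k # c) M :: 'a) =
      (\<Sum>A | A \<subseteq># M. of_bool (size A = k \<and> 0 \<notin># A) * h_composition c (M - A))"
    by (simp add: h_composition_def prod_series_def times_series_def complete_homogeneous_def)
  also have "\<dots> = (\<Sum>A\<in>I. h_composition c (M - A))"
    by (rule sum.mono_neutral_cong_right) (auto simp: I_def finite_sub_multisets)
  also have "\<dots> = (\<Sum>A\<in>I. of_nat (card ((#) (w A) ` decreasing_block_words c (M - A))))"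
    using Cons.IH by (intro sum.cong) (simp_all add: card_image)
  also have "\<dots> = of_nat (card (decreasing_block_words (k # c) M))"
    unfolding split using finI Cons.IH by (subst card_UN_disjoint) (auto simp: inj)
  finally show ?case using fin by blast
qed

lemma card_weakly_decreasing_trees_shape:
  assumes t: "size t = n"
  shows "card {Z \<in> weakly_decreasing_trees n M. shape Z = t} = card (decreasing_block_words (composition_type t) M)"
proof (rule bij_betw_same_card[of tree_blocks])
  show "bij_betw tree_blocks {Z \<in> weakly_decreasing_trees n M. shape Z = t}
      (decreasing_block_words (composition_type t) M)"
  proof (rule bij_betwI')
    fix Z Z' assume "Z \<in> {Z \<in> weakly_decreasing_trees n M. shape Z = t}"
      "Z' \<in> {Z \<in> weakly_decreasing_trees n M. shape Z = t}"
    then show "tree_blocks Z = tree_blocks Z' \<longleftrightarrow> Z = Z'" using tree_eqI_blocks[of Z Z'] by auto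
  next
    fix Z assume Z: "Z \<in> {Z \<in> weakly_decreasing_trees n M. shape Z = t}"
    then have "composition_type t = map length (tree_blocks Z)"
      by (auto simp flip: composition_type_eq)
    with Z show "tree_blocks Z \<in> decreasing_block_words (composition_type t) M"
      by (simp add: weakly_decreasing_trees_def decreasing_block_words_def)
  next
    fix ws assume ws: "ws \<in> decreasing_block_words (composition_type t) M"
    then have "map length ws = composition_type t" by (simp add: decreasing_block_words_def)
    from ex_tree_blocks[OF this] obtain Z :: "nat tree" where Z: "shape Z = shape t" "tree_blocks Z = ws" .
    have "shape t = t" by (induction t) auto
    with Z have "shape Z = t" by simp
    moreover have "size Z = n" using \<open>shape Z = t\<close> t by (metis size_map_tree)
    moreover have "mset (preorder_word Z) = M"
      using ws Z(2) by (simp add: decreasing_block_words_def flip: concat_tree_blocks)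
    ultimately have "Z \<in> {Z \<in> weakly_decreasing_trees n M. shape Z = t}"
      using ws Z(2) by (simp add: weakly_decreasing_trees_def decreasing_block_words_def)
    with Z(2) show "\<exists>Z\<in>{Z \<in> weakly_decreasing_trees n M. shape Z = t}. ws = tree_blocks Z" by blast
  qed
qed

lemma sum_decreasing_trees_eq_sum_h_composition:
  fixes q :: "'a::comm_semiring_1"
  shows "(\<Sum>Z\<in>weakly_decreasing_trees n M. q ^ right_edges Z) =
    (\<Sum>T\<in>unlabeled_trees n. q ^ right_edges T * h_composition (composition_type T) M)"
proof -
  have fin: "finite (unlabeled_trees n)"
    using finite_trees[of "UNIV :: unit set" n] by (simp add: unlabeled_trees_def)
  have "(\<Sum>Z\<in>weakly_decreasing_trees n M. q ^ right_edges Z) =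
      (\<Sum>t\<in>unlabeled_trees n. \<Sum>Z | Z \<in> weakly_decreasing_trees n M \<and> shape Z = t. q ^ right_edges Z)"
    using fin finite_weakly_decreasing_trees
    by (intro sum.group[symmetric]) (auto simp: weakly_decreasing_trees_def unlabeled_trees_def)
  also have "\<dots> = (\<Sum>T\<in>unlabeled_trees n. q ^ right_edges T * h_composition (composition_type T) M)"
  proof (rule sum.cong)
    fix t assume "t \<in> unlabeled_trees n"
    then have t: "size t = n" by (simp add: unlabeled_trees_def)
    have "(\<Sum>Z | Z \<in> weakly_decreasing_trees n M \<and> shape Z = t. q ^ right_edges Z) =
        (\<Sum>Z | Z \<in> weakly_decreasing_trees n M \<and> shape Z = t. q ^ right_edges t)"
      by (intro sum.cong) auto
    also have "\<dots> = q ^ right_edges t * h_composition (composition_type t) M"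
      using card_weakly_decreasing_trees_shape[OF t, of M]
        h_composition_eq_card[of "composition_type t" M, where 'a = 'a]
      by (simp add: mult.commute)
    finally show "(\<Sum>Z | Z \<in> weakly_decreasing_trees n M \<and> shape Z = t. q ^ right_edges Z) =
        q ^ right_edges t * h_composition (composition_type t) M" .
  qed simp
  finally show ?thesis .
qed

section \<open>Transport along a bijection\<close>

lemma transport_graded_action:
  assumes act: "graded_action n X deg \<phi>" and bij: "bij_betw f X Y"
  shows "graded_action n Y (transport_deg X f deg) (transport_action X f \<phi>)"
proof -
  interpret group_action "sym_group n" X \<phi> using act by (simp add: graded_action_def)
  have carrier: "\<sigma> \<in> carrier (sym_group n) \<longleftrightarrow> \<sigma> permutes {1..n}" for \<sigma> by (simp add: sym_group_def)
  have Y: "f ` X = Y" and inj: "inj_on f X" using bij by (simp_all add: bij_betw_def)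
  have in_X: "\<phi> \<sigma> x \<in> X" if "\<sigma> permutes {1..n}" "x \<in> X" for \<sigma> x
    using element_image[of \<sigma> x "\<phi> \<sigma> x"] that carrier by simp
  have id: "\<phi> id x = x" if "x \<in> X" for x
    using fun_cong[OF id_eq_one, of x] that by (simp add: sym_group_def)
  have comp: "\<phi> (\<sigma> \<circ> \<tau>) x = \<phi> \<sigma> (\<phi> \<tau> x)" if "\<sigma> permutes {1..n}" "\<tau> permutes {1..n}" "x \<in> X" for \<sigma> \<tau> x
    using composition_rule[of x \<sigma> \<tau>] that carrier by (simp add: sym_group_def)
  have "group_action (sym_group n) Y (\<lambda>\<sigma>. \<lambda>y\<in>Y. f (\<phi> \<sigma> (inv_into X f y)))"
  proof (rule group_action_sym_groupI)
    fix \<sigma> y assume "\<sigma> permutes {1..n}" "y \<in> Y"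
    then show "f (\<phi> \<sigma> (inv_into X f y)) \<in> Y" using in_X Y by (metis imageI inv_into_into)
  next
    fix y assume "y \<in> Y"
    then show "f (\<phi> id (inv_into X f y)) = y" using Y id by (metis f_inv_into_f inv_into_into)
  next
    fix \<sigma> \<tau> y assume st: "\<sigma> permutes {1..n}" "\<tau> permutes {1..n}" and "y \<in> Y"
    then have "inv_into X f y \<in> X" using Y by (metis inv_into_into)
    with st show "f (\<phi> (\<sigma> \<circ> \<tau>) (inv_into X f y)) =
        f (\<phi> \<sigma> (inv_into X f (f (\<phi> \<tau> (inv_into X f y)))))"
      using comp in_X inv_into_f_f[OF inj] by simp
  qed
  moreover have "transport_deg X f deg (transport_action X f \<phi> \<sigma> y) = transport_deg X f deg y"
    if \<sigma>: "\<sigma> \<in> carrier (sym_group n)" and "y \<in> Y" for \<sigma> y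
  proof -
    have x: "inv_into X f y \<in> X" using Y \<open>y \<in> Y\<close> by (metis inv_into_into)
    then have "deg (\<phi> \<sigma> (inv_into X f y)) = deg (inv_into X f y)"
      using act \<sigma> by (simp add: graded_action_def)
    then show ?thesis
      using \<open>y \<in> Y\<close> Y x in_X[of \<sigma>] \<sigma> carrier inv_into_f_f[OF inj]
      by (simp add: transport_deg_def transport_action_def)
  qed
  ultimately show ?thesis
    by (simp add: graded_action_def transport_action_def[abs_def] Y)
qed

text \<open>The bijection matches the fixed points of each permutation degree by degree, so the
  characters agree.\<close>

lemma transport_graded_frobenius:
  assumes act: "graded_action n X deg \<phi>" and bij: "bij_betw f X Y" and fin: "finite X"
  shows "graded_frobenius n Y (transport_deg X f deg) (transport_action X f \<phi>) =
    graded_frobenius n X deg \<phi>"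
proof (rule ext)
  fix M
  interpret group_action "sym_group n" X \<phi> using act by (simp add: graded_action_def)
  let ?deg = "transport_deg X f deg" and ?\<phi> = "transport_action X f \<phi>"
  have Y: "f ` X = Y" and inj: "inj_on f X" using bij by (simp_all add: bij_betw_def)
  have deg: "?deg (f x) = deg x" if "x \<in> X" for x
    using that inj by (simp add: transport_deg_def)
  have img: "?deg ` Y = deg ` X"
    unfolding Y[symmetric] image_image using deg by (intro image_cong) auto
  have char: "perm_character {y \<in> Y. ?deg y = k} ?\<phi> \<sigma> = perm_character {x \<in> X. deg x = k} \<phi> \<sigma>"
    if \<sigma>: "\<sigma> \<in> carrier (sym_group n)" for \<sigma> k
  proof -
    have act_f: "?\<phi> \<sigma> (f x) = f x \<longleftrightarrow> \<phi> \<sigma> x = x" if "x \<in> X" for x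
      using that inj element_image[OF \<sigma> that, of "\<phi> \<sigma> x"]
      by (simp add: transport_action_def inj_on_eq_iff)
    have "{y \<in> {y \<in> Y. ?deg y = k}. ?\<phi> \<sigma> y = y} = f ` {x \<in> {x \<in> X. deg x = k}. \<phi> \<sigma> x = x}"
      unfolding Y[symmetric] using act_f deg by auto
    moreover have "inj_on f {x \<in> {x \<in> X. deg x = k}. \<phi> \<sigma> x = x}"
      by (rule inj_on_subset[OF inj]) auto
    moreover have "finite Y" using fin Y by blast
    ultimately show ?thesis using fin by (simp add: perm_character_eq_card card_image)
  qed
  have "frobenius n (perm_character {y \<in> Y. ?deg y = k} ?\<phi>) M = frobenius n (perm_character {x \<in> X. deg x = k} \<phi>) M" for k
    unfolding frobenius_def using char by (simp cong: sum.cong)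
  then show "graded_frobenius n Y ?deg ?\<phi> M = graded_frobenius n X deg \<phi> M"
    by (simp add: graded_frobenius_def img)
qed

theorem theorem5p7:
  fixes n :: nat
  assumes "n \<ge> 1"
  shows
    "graded_action n (bernardi_trees n) right_edges (bernardi_action n) \<and>
     graded_frobenius n (bernardi_trees n) right_edges (bernardi_action n)
       = G_series n 1 0 qvar 0 \<and>
     G_series n 1 0 qvar 0 =
       (\<lambda>M. \<Sum>T\<in>unlabeled_trees n. qvar ^ right_edges T * h_composition (composition_type T) M) \<and>
     bij_betw (bernardi_region n) (bernardi_trees n) (linial_regions n) \<and>
     graded_action n (linial_regions n)
       (transport_deg (bernardi_trees n) (bernardi_region n) right_edges)
       (transport_action (bernardi_trees n) (bernardi_region n) (bernardi_action n)) \<and>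
     graded_frobenius n (linial_regions n)
       (transport_deg (bernardi_trees n) (bernardi_region n) right_edges)
       (transport_action (bernardi_trees n) (bernardi_region n) (bernardi_action n))
       = G_series n 1 0 qvar 0"
proof -
  have G: "G_series n 1 0 qvar 0 M = (\<Sum>Z\<in>weakly_decreasing_trees n M. qvar ^ right_edges Z)" for M
    by (simp only: G_series_eq_sum_search_trees sum_search_trees_eq_sum_decreasing_trees)
  have frob: "graded_frobenius n (bernardi_trees n) right_edges (bernardi_action n) = G_series n 1 0 qvar 0"
    by (rule ext) (simp only: G graded_frobenius_bernardi)
  moreover have "G_series n 1 0 qvar 0 =
      (\<lambda>M. \<Sum>T\<in>unlabeled_trees n. qvar ^ right_edges T * h_composition (composition_type T) M)"
    by (rule ext) (simp only: G sum_decreasing_trees_eq_sum_h_composition)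
  moreover note bernardi_graded_action[of n] bij_betw_bernardi_region[of n]
  moreover note transport_graded_action[OF bernardi_graded_action[of n] bij_betw_bernardi_region[of n]]
    transport_graded_frobenius[OF bernardi_graded_action[of n] bij_betw_bernardi_region[of n] finite_bernardi_trees]
  ultimately show ?thesis by (simp only: frob simp_thms)
qed

end
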